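(* Let $M$ be a quasianalytic intersectable weight sequence of moderate growth. Then for every $d\ge1$ the ring ${}_d\mathcal{E}^{\{M\}}$ has property $(\mathscr{D})$.
   Context: A weight sequence is a sequence $M=(M_k)_{k\ge0}$ of positive reals with $M_k=\mu_1\cdots\mu_k$, $M_0=1$, where $(\mu_k)$ is positive and increasing with $\mu_0=1$, and $M_k^{1/k}\to\infty$; write $m_k=M_k/k!$. $M$ is non-quasianalytic if $\sum_{k\ge1}1/\mu_k<\infty$, quasianalytic otherwise. $M$ has moderate growth if $\exists C>0\ \forall j,k: M_{j+k}\le C^{j+k}M_jM_k$. Let $\Lambda^{\{M\}}:=\{(c_k)\in\mathbb{C}^{\mathbb{N}}:\exists\rho>0,\ \sup_k|c_k|/(\rho^kM_k)<\infty\}$ and let $\mathcal{L}(M)$ be the set of all non-quasianalytic weight sequences $N$ with $N_k\ge M_k$ for all $k$ and $(N_k/k!)_k$ log-convex. A quasianalytic weight sequence $M$ is intersectable if $\Lambda^{\{M\}}=\bigcap_{N\in\mathcal{L}(M)}\Lambda^{\{N\}}$. For open $U\subseteq\mathbb{R}^d$ and $\sigma>0$, $\mathcal{B}^M_\sigma(U)$ is the set of $f\in C^\infty(U)$ with $\sup_{x\in U,\alpha\in\mathbb{N}^d}|\partial^\alpha f(x)|/(\sigma^{|\alpha|}M_{|\alpha|})<\infty$; $\mathcal{E}^{\{M\}}(U)$ is the set of $f\in C^\infty(U)$ such that for every relatively compact open $V\subseteq U$ there is $\sigma>0$ with $f|_V\in\mathcal{B}^M_\sigma(V)$. ${}_d\mathcal{E}^{\{M\}}$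 is the ring of germs at $0\in\mathbb{R}^d$ of complex valued $\mathcal{E}^{\{M\}}$-functions. A subring $\mathcal{S}$ of the ring of germs at $0\in\mathbb{R}^d$ of complex valued $C^\infty$ functions has property $(\mathscr{D})$ if for every complex valued function germ $f$ at $0$: if $f^j,f^{j+1}\in\mathcal{S}$ for some integer $j\ge1$, then $f\in\mathcal{S}$. *)

theory Defs
  imports "HOL-Analysis.Analysis"
begin

definition wmu :: "(nat \<Rightarrow> real) \<Rightarrow> nat \<Rightarrow> real" where
  "wmu M k = (if k = 0 then 1 else M k / M (k - 1))"

definition weight_seq :: "(nat \<Rightarrow> real) \<Rightarrow> bool" where
  "weight_seq M \<longleftrightarrow>
     (\<exists>mu :: nat \<Rightarrow> real. mu 0 = 1 \<and> (\<forall>k. mu k > 0) \<and> mono mu \<and>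
        (\<forall>k. M k = (\<Prod>i\<in>{1..k}. mu i))) \<and>
     filterlim (\<lambda>k. root k (M k)) at_top sequentially"

definition non_quasianalytic :: "(nat \<Rightarrow> real) \<Rightarrow> bool" where
  "non_quasianalytic M \<longleftrightarrow> summable (\<lambda>k. 1 / wmu M (Suc k))"

definition quasianalytic :: "(nat \<Rightarrow> real) \<Rightarrow> bool" where
  "quasianalytic M \<longleftrightarrow> \<not> non_quasianalytic M"

definition moderate_growth :: "(nat \<Rightarrow> real) \<Rightarrow> bool" where
  "moderate_growth M \<longleftrightarrow> (\<exists>C>0. \<forall>j k. M (j + k) \<le> C ^ (j + k) * M j * M k)"

definition log_convex_seq :: "(nat \<Rightarrow> real) \<Rightarrow> bool" where
  "log_convex_seq a \<longleftrightarrow> (\<forall>k. a (Suc k) ^ 2 \<le> a k * a (Suc (Suc k)))"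

definition Lambda_seq :: "(nat \<Rightarrow> real) \<Rightarrow> (nat \<Rightarrow> complex) set" where
  "Lambda_seq M = {c. \<exists>\<rho>>0. bdd_above (range (\<lambda>k. norm (c k) / (\<rho> ^ k * M k)))}"

definition LL :: "(nat \<Rightarrow> real) \<Rightarrow> (nat \<Rightarrow> real) set" where
  "LL M = {N. weight_seq N \<and> non_quasianalytic N \<and> (\<forall>k. N k \<ge> M k) \<and>
              log_convex_seq (\<lambda>k. N k / fact k)}"

definition intersectable :: "(nat \<Rightarrow> real) \<Rightarrow> bool" where
  "intersectable M \<longleftrightarrow> weight_seq M \<and> quasianalytic M \<and>
     Lambda_seq M = (\<Inter>N\<in>LL M. Lambda_seq N)"

definition pdiff :: "'n::finite \<Rightarrow> (real^'n \<Rightarrow> complex) \<Rightarrow> real^'n \<Rightarrow> complex" where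
  "pdiff i g x = vector_derivative (\<lambda>t. g (x + t *\<^sub>R axis i 1)) (at 0)"

text \<open>Iterated partial derivative along a list of coordinate directions
  (the multi-index alpha corresponds to the multiset of the list; |alpha| = length).\<close>
fun pdiffs :: "'n::finite list \<Rightarrow> (real^'n \<Rightarrow> complex) \<Rightarrow> real^'n \<Rightarrow> complex" where
  "pdiffs [] g = g"
| "pdiffs (i # is) g = pdiff i (pdiffs is g)"

definition smooth_on :: "(real^'n::finite) set \<Rightarrow> (real^'n \<Rightarrow> complex) \<Rightarrow> bool" where
  "smooth_on U f \<longleftrightarrow>
     (\<forall>is. continuous_on U (pdiffs is f) \<and>
        (\<forall>i. \<forall>x\<in>U. ((\<lambda>t. pdiffs is f (x + t *\<^sub>R axis i 1)) has_vector_derivative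
                         pdiffs (i # is) f x) (at 0)))"

definition B_M :: "(nat \<Rightarrow> real) \<Rightarrow> real \<Rightarrow> (real^'n::finite) set \<Rightarrow> (real^'n \<Rightarrow> complex) set" where
  "B_M M \<sigma> U = {f. smooth_on U f \<and>
     bdd_above ((\<lambda>(x, is). norm (pdiffs is f x) / (\<sigma> ^ length is * M (length is))) ` (U \<times> UNIV))}"

definition E_M :: "(nat \<Rightarrow> real) \<Rightarrow> (real^'n::finite) set \<Rightarrow> (real^'n \<Rightarrow> complex) set" where
  "E_M M U = {f. smooth_on U f \<and>
     (\<forall>V. open V \<and> V \<subseteq> U \<and> compact (closure V) \<and> closure V \<subseteq> U \<longrightarrow>
        (\<exists>\<sigma>>0. f \<in> B_M M \<sigma> V))}"

text \<open>The germ at 0 of f lies in the ring of germs of E^{M}-functions iff f coincides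
  on some open neighbourhood U of 0 with an E^{M}(U)-function, i.e. f itself is in E^{M}(U).\<close>
definition germ_E_M :: "(nat \<Rightarrow> real) \<Rightarrow> (real^'n::finite \<Rightarrow> complex) \<Rightarrow> bool" where
  "germ_E_M M f \<longleftrightarrow> (\<exists>U. open U \<and> 0 \<in> U \<and> f \<in> E_M M U)"

definition property_D :: "((real^'n::finite \<Rightarrow> complex) \<Rightarrow> bool) \<Rightarrow> bool" where
  "property_D S \<longleftrightarrow>
     (\<forall>f j. j \<ge> (1::nat) \<and> S (\<lambda>x. f x ^ j) \<and> S (\<lambda>x. f x ^ (j + 1)) \<longrightarrow> S f)"

end

theory Submission
  imports Defs "HOL-Computational_Algebra.Fundamental_Theorem_Algebra"
begin

text \<open>
  Intersectability and moderate growth give \<open>(M_i / i!)^(1/i) \<le> C (M_k / k!)^(1/k)\<close> for all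
  \<open>i \<le> L k\<close>. Write \<open>g = f^j\<close> and \<open>h = f^(j+1)\<close>. At every
  point and in every direction, the Taylor series of \<open>g\<close> and \<open>h\<close> satisfy \<open>G^(j+1) = H^j\<close>, hence
  \<open>G = F^j\<close> and \<open>H = F^(j+1)\<close> for a formal power series \<open>F\<close>, and the partial sums of \<open>F\<close> approximate
  \<open>f\<close> along the line, uniformly.

  The heart of the proof is a bound for \<open>F_k\<close> in terms of the first \<open>n = O(k)\<close> coefficients of \<open>G\<close>
  and \<open>H\<close>. Let \<open>G\<close>, \<open>H\<close> also denote the truncations at order \<open>n\<close>, let \<open>E = z^N\<close>, and consider
  \<open>w = H cnj(G) / (|G|^2 + |E|^2)\<close>, a smooth regularisation of \<open>H / G\<close>. The mean of \<open>w z^(-k)\<close> over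
  \<open>|z| = r\<close> tends to \<open>F_k\<close> as \<open>r\<close> tends to \<open>0\<close>, is bounded at \<open>r = 1\<close>, and its derivative in \<open>r\<close> is a
  mean of \<open>z^(-k) dbar w\<close>. Since \<open>|H| \<approx> |G|^(1+1/j)\<close> up to an error \<open>O(|z|^n)\<close>, this is controlled by a
  power of \<open>|z|\<close> times \<open>|G'/G|^b\<close> with \<open>b < 1\<close>, and \<open>G'/G\<close> is a sum of simple poles.

  Finally, uniform expansions along all lines make \<open>f\<close> smooth, and polarization bounds its mixed
  partial derivatives by the directional coefficients \<open>F_k\<close>.
\<close>

section \<open>Truncated power series\<close>

text \<open>The obstacle is to bound \<open>F_k\<close> without any lower bound for
  \<open>G\<close>: the truncated \<open>G\<close> may vanish anywhere in the unit disk, so Cauchy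
  estimates for \<open>H / G\<close> fail. Where \<open>G\<close> is small, \<open>H\<close> is
  smaller by the factor \<open>|G|^(1/j)\<close>, and this gain is spent in two halves. One half
  lowers the exponent of \<open>G'/G\<close> from \<open>1\<close> to \<open>b = 1 - 1/(2j)\<close>,
  so that simple poles become integrable on circles, uniformly in their position. The other half
  turns into \<open>|E|^(1/(2j))\<close>, which has to pay for \<open>z^(-k)\<close>. This asks for
  \<open>|E|^(1/(2j)) = |z|^(k+1)\<close>, that is \<open>N = 2j(k+1)\<close>, and for an error
  \<open>O(|z|^(2N+k+1))\<close> in the bound for \<open>|H|\<close>. That bound comes from a j-th
  root, which divides the order of the error by \<open>j\<close>; hence
  \<open>n = j(4j+1)(k+1)\<close>. For normalised coefficients all losses are polynomial in
  \<open>n\<close>. The normalisation rescales the variable by a factor that depends on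
  \<open>k\<close>, essentially \<open>(M_k/k!)^(1/k)\<close>, which is why weights of all orders up
  to a fixed multiple of \<open>k\<close> have to be compared with the one of order
  \<open>k\<close>.\<close>

definition fps_trunc :: "nat \<Rightarrow> complex fps \<Rightarrow> complex \<Rightarrow> complex" where
  "fps_trunc n A z = (\<Sum>i\<le>n. fps_nth A i * z ^ i)"

lemma norm_fps_trunc_le:
  assumes "\<And>i. i \<le> n \<Longrightarrow> norm (fps_nth A i) \<le> a" "norm z \<le> 1"
  shows "norm (fps_trunc n A z) \<le> (real n + 1) * a"
proof -
  have a0: "a \<ge> 0" using order_trans[OF norm_ge_zero assms(1)[of 0]] by simp
  have "norm (fps_trunc n A z) \<le> (\<Sum>i\<le>n. norm (fps_nth A i * z ^ i))"
    unfolding fps_trunc_def by (rule norm_sum)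
  also have "\<dots> \<le> (\<Sum>i\<le>n. a)"
  proof (rule sum_mono)
    fix i assume "i \<in> {..n}"
    then have "norm (fps_nth A i) * norm z ^ i \<le> a * 1"
      using assms a0 by (intro mult_mono) (auto simp: power_le_one)
    then show "norm (fps_nth A i * z ^ i) \<le> a" by (simp add: norm_mult norm_power)
  qed
  finally show ?thesis by (simp add: add.commute)
qed

text \<open>Only the index pairs with \<open>i + j > n\<close> contribute to the difference; there
  are at most \<open>(n + 1)\<^sup>2\<close> of them, each of size at most
  \<open>a * b * norm z ^ (n + 1)\<close>.\<close>

lemma fps_trunc_mult:
  assumes A: "\<And>i. i \<le> n \<Longrightarrow> norm (fps_nth A i) \<le> a"
    and B: "\<And>i. i \<le> n \<Longrightarrow> norm (fps_nth B i) \<le> b" and z: "norm z \<le> 1"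
  shows "norm (fps_trunc n A z * fps_trunc n B z - fps_trunc n (A * B) z)
           \<le> (real n + 1)\<^sup>2 * (a * b) * norm z ^ (n + 1)"
proof -
  have a0: "a \<ge> 0" using order_trans[OF norm_ge_zero A[of 0]] by simp
  have b0: "b \<ge> 0" using order_trans[OF norm_ge_zero B[of 0]] by simp
  define g where "g i j = fps_nth A i * fps_nth B j * z ^ (i + j)" for i j
  define T where "T = {(i, j). i + j \<le> n}"
  have TS: "T \<subseteq> {..n} \<times> {..n}" by (auto simp: T_def)
  have "fps_trunc n A z * fps_trunc n B z = (\<Sum>i\<le>n. \<Sum>j\<le>n. g i j)"
    by (simp add: fps_trunc_def sum_product g_def power_add mult_ac)
  also have "\<dots> = (\<Sum>(i, j)\<in>{..n} \<times> {..n}. g i j)" by (simp add: sum.cartesian_product)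
  finally have e1: "fps_trunc n A z * fps_trunc n B z = (\<Sum>(i, j)\<in>{..n} \<times> {..n}. g i j)" .
  have "fps_trunc n (A * B) z = (\<Sum>k\<le>n. \<Sum>i\<le>k. g i (k - i))"
    unfolding fps_trunc_def fps_mult_nth sum_distrib_right
    by (intro sum.cong) (auto simp: g_def atLeast0AtMost)
  also have "\<dots> = (\<Sum>(i, j)\<in>T. g i j)"
    unfolding T_def by (rule sum.triangle_reindex_eq[symmetric])
  finally have e2: "fps_trunc n (A * B) z = (\<Sum>(i, j)\<in>T. g i j)" .
  have e3: "fps_trunc n A z * fps_trunc n B z - fps_trunc n (A * B) z
      = (\<Sum>(i, j)\<in>{..n} \<times> {..n} - T. g i j)"
    unfolding e1 e2 by (rule sum_diff[symmetric]) (use TS in auto)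
  have "norm (\<Sum>(i, j)\<in>{..n} \<times> {..n} - T. g i j) \<le> (\<Sum>p\<in>{..n} \<times> {..n} - T. a * b * norm z ^ (n + 1))"
  proof (rule sum_norm_le)
    fix p assume "p \<in> {..n} \<times> {..n} - T"
    then obtain i j where p: "p = (i, j)" "i \<le> n" "j \<le> n" "i + j \<ge> n + 1" by (auto simp: T_def)
    have "norm (g i j) = norm (fps_nth A i) * norm (fps_nth B j) * norm z ^ (i + j)"
      by (simp add: g_def norm_mult norm_power)
    also have "\<dots> \<le> a * b * norm z ^ (n + 1)"
      using p a0 b0 z by (intro mult_mono A B power_decreasing) auto
    finally show "norm (case p of (i, j) \<Rightarrow> g i j) \<le> a * b * norm z ^ (n + 1)" using p by simp
  qed
  also have "\<dots> \<le> (\<Sum>p\<in>{..n} \<times> {..n}. a * b * norm z ^ (n + 1))"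
    using a0 b0 by (intro sum_mono2) auto
  also have "\<dots> = (real n + 1)\<^sup>2 * (a * b) * norm z ^ (n + 1)"
    by (simp add: power2_eq_square algebra_simps)
  finally show ?thesis unfolding e3 .
qed

lemma norm_fps_power_nth_le:
  fixes A :: "complex fps"
  assumes A: "\<And>i. i \<le> n \<Longrightarrow> norm (fps_nth A i) \<le> a" and "i \<le> n"
  shows "norm (fps_nth (A ^ p) i) \<le> (real n + 1) ^ p * a ^ p"
  using \<open>i \<le> n\<close>
proof (induction p arbitrary: i)
  case 0
  then show ?case by (cases "i = 0") simp_all
next
  case (Suc p)
  have a0: "a \<ge> 0" using order_trans[OF norm_ge_zero A[of 0]] by simp
  have "norm (fps_nth (A ^ Suc p) i) \<le> (\<Sum>k=0..i. norm (fps_nth A k * fps_nth (A ^ p) (i - k)))"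
    by (simp add: fps_mult_nth norm_sum)
  also have "\<dots> \<le> (\<Sum>k=0..i. a * ((real n + 1) ^ p * a ^ p))"
    unfolding norm_mult using Suc a0 by (intro sum_mono mult_mono A) auto
  also have "\<dots> = (real i + 1) * (a * ((real n + 1) ^ p * a ^ p))" by (simp add: add.commute)
  also have "\<dots> \<le> (real n + 1) * (a * ((real n + 1) ^ p * a ^ p))"
    using Suc.prems a0 by (intro mult_right_mono) auto
  finally show ?case by (simp add: mult_ac)
qed

text \<open>Identities between powers of formal series survive truncation up to order
  \<open>n + 1\<close>, with a constant polynomial in \<open>n\<close>. Since \<open>n\<close> will
  be a multiple of \<open>k\<close>, such constants are harmless. Each induction step adds one
  multiplication error.\<close>

lemma fps_trunc_power:
  assumes A: "\<And>i. i \<le> n \<Longrightarrow> norm (fps_nth A i) \<le> a" and z: "norm z \<le> 1"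
  shows "norm (fps_trunc n A z ^ p - fps_trunc n (A ^ p) z)
           \<le> real p * (real n + 1) ^ (p + 2) * a ^ p * norm z ^ (n + 1)"
proof (induction p)
  case 0
  have "fps_trunc n 1 z = (\<Sum>i\<le>n. if i = 0 then 1 else 0)"
    unfolding fps_trunc_def by (intro sum.cong) (auto simp: fps_one_nth)
  then show ?case by simp
next
  case (Suc p)
  have a0: "a \<ge> 0" using order_trans[OF norm_ge_zero A[of 0]] by simp
  let ?s = "real n + 1" and ?y = "norm z ^ (n + 1)"
  have "norm (fps_trunc n A z ^ Suc p - fps_trunc n (A ^ Suc p) z)
     = norm (fps_trunc n A z * (fps_trunc n A z ^ p - fps_trunc n (A ^ p) z)
        + (fps_trunc n A z * fps_trunc n (A ^ p) z - fps_trunc n (A * A ^ p) z))"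
    by (simp add: algebra_simps)
  also have "\<dots> \<le> norm (fps_trunc n A z) * norm (fps_trunc n A z ^ p - fps_trunc n (A ^ p) z)
        + norm (fps_trunc n A z * fps_trunc n (A ^ p) z - fps_trunc n (A * A ^ p) z)"
    by (metis norm_mult norm_triangle_ineq)
  also have "\<dots> \<le> ?s * a * (real p * ?s ^ (p + 2) * a ^ p * ?y) + ?s\<^sup>2 * (a * (?s ^ p * a ^ p)) * ?y"
    using a0 by (intro add_mono mult_mono Suc fps_trunc_mult norm_fps_trunc_le norm_fps_power_nth_le A z) auto
  also have "\<dots> = (real p * ?s ^ (p + 3) + ?s ^ (p + 2)) * a ^ Suc p * ?y"
    by (simp add: algebra_simps power_add power2_eq_square power3_eq_cube)
  also have "\<dots> \<le> (real p * ?s ^ (p + 3) + ?s ^ (p + 3)) * a ^ Suc p * ?y"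
    using a0 by (intro mult_right_mono add_left_mono power_increasing) auto
  also have "\<dots> = real (Suc p) * ?s ^ (Suc p + 2) * a ^ Suc p * ?y"
    by (simp add: ring_distribs power3_eq_cube power_add power2_eq_square)
  finally show ?case .
qed

section \<open>Singular integrals over circles\<close>

lemma abs_sin_ge_half:
  fixes x :: real
  assumes "\<bar>x\<bar> \<le> pi / 2"
  shows "\<bar>sin x\<bar> \<ge> \<bar>x\<bar> / 2"
proof -
  have "\<bar>sin x - (\<Sum>m<3. sin_coeff m * x ^ m)\<bar> \<le> inverse (fact 3) * \<bar>x\<bar> ^ 3"
    by (rule Maclaurin_sin_bound)
  then have 1: "\<bar>sin x - x\<bar> \<le> \<bar>x\<bar> ^ 3 / 6"
    by (simp add: eval_nat_numeral sin_coeff_def fact_numeral)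
  have "\<bar>x\<bar> \<le> 8/5" using assms pi_approx by simp
  then have "\<bar>x\<bar> ^ 2 \<le> (8/5) ^ 2" by (intro power_mono) auto
  then have "\<bar>x\<bar> * \<bar>x\<bar> ^ 2 \<le> \<bar>x\<bar> * 3" by (intro mult_left_mono) (auto simp: power2_eq_square)
  then have "\<bar>x\<bar> ^ 3 / 6 \<le> \<bar>x\<bar> / 2" by (simp add: power3_eq_cube power2_eq_square)
  then show ?thesis using 1 by linarith
qed

lemma has_integral_abs_powr:
  fixes b d c :: real
  assumes "0 < b" "b < 1" "d \<ge> 0"
  shows "((\<lambda>x. \<bar>x - c\<bar> powr (- b)) has_integral (2 * (d powr (1 - b) / (1 - b)))) {c - d..c + d}"
proof -
  have h: "((\<lambda>x. x powr (- b)) has_integral (d powr (1 - b) / (1 - b))) {0..d}"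
    using has_integral_powr_from_0[of "- b" d] assms by (simp add: add.commute)
  have 1: "((\<lambda>x. \<bar>x\<bar> powr (- b)) has_integral (d powr (1 - b) / (1 - b))) {0..d}"
    by (rule has_integral_eq[OF _ h]) auto
  have 2: "((\<lambda>x. \<bar>x\<bar> powr (- b)) has_integral (d powr (1 - b) / (1 - b))) {-d..0}"
    using has_integral_reflect_real[where f="\<lambda>x. \<bar>x\<bar> powr (- b)" and a=0 and b=d] 1 by simp
  have "((\<lambda>x. \<bar>x\<bar> powr (- b)) has_integral (d powr (1 - b) / (1 - b) + d powr (1 - b) / (1 - b))) {-d..d}"
    using assms by (intro has_integral_combine[OF _ _ 2 1]) auto
  from has_integral_affinity[OF this[folded cbox_interval], of 1 "- c"]
  show ?thesis by (simp add: algebra_simps)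
qed

text \<open>After rotation by \<open>- \<phi>\<close> the second point is real, so the distance is
  at least the imaginary part \<open>r * \<bar>sin (\<theta> - \<phi>)\<bar>\<close>, whatever
  \<open>\<rho>\<close> is. The number \<open>m * pi\<close> is the zero of the sine nearest to
  \<open>\<theta> - \<phi>\<close>, which lies in \<open>[-pi, 3 pi)\<close>.\<close>

lemma norm_rcis_diff_ge:
  fixes r \<rho> \<theta> \<phi> :: real
  assumes "r > 0" "\<theta> \<in> {0..2 * pi}" "- pi < \<phi>" "\<phi> \<le> pi"
  obtains m :: int where "m \<in> {-1..3}"
    "norm (rcis r \<theta> - rcis \<rho> \<phi>) \<ge> r / 2 * \<bar>\<theta> - (\<phi> + of_int m * pi)\<bar>"
proof -
  define y where "y = \<theta> - \<phi>"
  define m where "m = \<lfloor>y / pi + 1 / 2\<rfloor>"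
  have y: "y \<ge> - pi" "y < 3 * pi" using assms by (auto simp: y_def)
  have m1: "of_int m \<le> y / pi + 1 / 2" "y / pi + 1 / 2 < of_int m + 1"
    unfolding m_def by linarith+
  have pp: "pi > 0" by simp
  have m2: "of_int m * pi \<le> y + pi / 2" "y + pi / 2 < of_int m * pi + pi"
    using m1 pp by (auto simp: field_simps)
  have "- 1 \<le> m" unfolding m_def using y pp by (simp add: le_floor_iff field_simps)
  moreover have "m < 4" unfolding m_def using y pp by (simp add: floor_less_iff field_simps)
  ultimately have m: "m \<in> {-1..3}" by auto
  have "\<bar>sin (y - of_int m * pi)\<bar> \<ge> \<bar>y - of_int m * pi\<bar> / 2"
    using m2 by (intro abs_sin_ge_half) (unfold abs_le_iff, linarith)
  moreover have "\<bar>sin (y - of_int m * pi)\<bar> = \<bar>sin y\<bar>"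
    by (simp add: sin_diff abs_mult mult.commute[of _ pi])
  ultimately have s: "\<bar>sin y\<bar> \<ge> \<bar>y - of_int m * pi\<bar> / 2" by simp
  have "cis (- \<phi>) * (rcis r \<theta> - rcis \<rho> \<phi>) = rcis r y - of_real \<rho>"
    by (simp add: rcis_def right_diff_distrib y_def cis_mult mult.left_commute[of "cis (- \<phi>)"])
  then have "norm (rcis r \<theta> - rcis \<rho> \<phi>) = norm (rcis r y - of_real \<rho>)"
    by (metis norm_mult norm_cis mult_1)
  also have "\<dots> \<ge> \<bar>Im (rcis r y - of_real \<rho>)\<bar>" by (rule abs_Im_le_cmod)
  also have "\<bar>Im (rcis r y - of_real \<rho>)\<bar> = r * \<bar>sin y\<bar>" using assms by (simp add: abs_mult)
  finally have "norm (rcis r \<theta> - rcis \<rho> \<phi>) \<ge> r * \<bar>sin y\<bar>" .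
  moreover have "r * \<bar>sin y\<bar> \<ge> r * (\<bar>y - of_int m * pi\<bar> / 2)"
    using s assms by (intro mult_left_mono) auto
  ultimately have "norm (rcis r \<theta> - rcis \<rho> \<phi>) \<ge> r / 2 * \<bar>\<theta> - (\<phi> + of_int m * pi)\<bar>"
    by (simp add: y_def algebra_simps)
  then show ?thesis using m that by blast
qed

text \<open>Says that \<open>norm (z - a) powr (- b)\<close> has integral at most
  \<open>C * r powr (- b)\<close> over the circle of radius \<open>r\<close>, with one
  \<open>C\<close> for every pole \<open>a\<close>. A majorant \<open>S\<close> off a finite set
  replaces the singular function itself, whose integrability then never has to be shown.\<close>

definition circle_dominated :: "real \<Rightarrow> real \<Rightarrow> real \<Rightarrow> bool" where
  "circle_dominated b C r \<longleftrightarrow> (\<forall>a. \<exists>S X. finite X \<and> S integrable_on {0..2 * pi} \<and>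
     integral {0..2 * pi} S \<le> C * r powr (- b) \<and>
     (\<forall>\<theta>\<in>{0..2 * pi} - X. rcis r \<theta> \<noteq> a \<and> norm (rcis r \<theta> - a) powr (- b) \<le> S \<theta>))"

lemma circle_powr_integral:
  fixes b :: real
  assumes b: "0 < b" "b < 1"
  obtains C where "C \<ge> 0" "\<And>r. r > 0 \<Longrightarrow> circle_dominated b C r"
proof -
  \<comment> \<open>The angles \<open>p m\<close> below lie in \<open>(-2 pi, 4 pi]\<close>, so the
    interval of radius 20 around each of them covers \<open>[0, 2 pi]\<close>.\<close>
  define I where "I = 2 * ((20::real) powr (1 - b) / (1 - b))"
  have I0: "I \<ge> 0" using b by (simp add: I_def)
  define C where "C = 5 * 2 powr b * I"
  show ?thesis
  proof (rule that[of C])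
    show "C \<ge> 0" using I0 by (simp add: C_def)
    fix r :: real
    assume r: "r > 0"
    show "circle_dominated b C r"
      unfolding circle_dominated_def
    proof
      fix a :: complex
      define \<phi> where "\<phi> = Arg a"
      have phi: "- pi < \<phi>" "\<phi> \<le> pi" using Arg_bounded[of a] by (auto simp: \<phi>_def)
      have a: "a = rcis (norm a) \<phi>" by (simp add: \<phi>_def rcis_cmod_Arg)
      define p where "p m = \<phi> + of_int m * pi" for m :: int
      define S where "S \<theta> = (\<Sum>m\<in>{-1..3::int}. (r / 2) powr (- b) * \<bar>\<theta> - p m\<bar> powr (- b))" for \<theta>
      \<comment> \<open>At these angles \<open>0 powr (- b)\<close> evaluates to \<open>0\<close>
        instead of infinity, so \<open>S\<close> is no majorant there.\<close>
      define X where "X = p ` {-1..3}"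
      have int: "(\<lambda>\<theta>. \<bar>\<theta> - p m\<bar> powr (- b)) integrable_on {0..2 * pi} \<and>
         integral {0..2 * pi} (\<lambda>\<theta>. \<bar>\<theta> - p m\<bar> powr (- b)) \<le> I" if m: "m \<in> {-1..3}" for m
      proof -
        have h: "((\<lambda>x. \<bar>x - p m\<bar> powr (- b)) has_integral I) {p m - 20..p m + 20}"
          unfolding I_def by (rule has_integral_abs_powr) (use b in auto)
        have mm: "of_int m \<ge> (-1::real)" "of_int m \<le> (3::real)" using m by auto
        have mp: "of_int m * pi \<ge> -1 * pi" "of_int m * pi \<le> 3 * pi"
          using mm by (intro mult_right_mono; simp)+
        have "pi < 4" using pi_less_4 .
        then have sub: "{0..2 * pi} \<subseteq> {p m - 20..p m + 20}" using phi mp unfolding p_def by (intro iffD2[OF atLeastatMost_subset_iff] disjI2 conjI; linarith)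
        have i1: "(\<lambda>\<theta>. \<bar>\<theta> - p m\<bar> powr (- b)) integrable_on {0..2 * pi}"
          by (rule integrable_on_subinterval[OF has_integral_integrable[OF h] sub])
        have "integral {0..2 * pi} (\<lambda>\<theta>. \<bar>\<theta> - p m\<bar> powr (- b)) \<le> integral {p m - 20..p m + 20} (\<lambda>\<theta>. \<bar>\<theta> - p m\<bar> powr (- b))"
          by (rule integral_subset_le[OF sub i1 has_integral_integrable[OF h]]) auto
        then show ?thesis using i1 integral_unique[OF h] by simp
      qed
      have Sint: "S integrable_on {0..2 * pi}"
        unfolding S_def by (intro integrable_sum integrable_on_mult_right) (use int in auto)
      have "integral {0..2 * pi} S = (\<Sum>m\<in>{-1..3::int}. integral {0..2 * pi} (\<lambda>\<theta>. (r / 2) powr (- b) * \<bar>\<theta> - p m\<bar> powr (- b)))"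
        unfolding S_def by (intro integral_sum integrable_on_mult_right) (use int in auto)
      also have "\<dots> \<le> (\<Sum>m\<in>{-1..3::int}. (r / 2) powr (- b) * I)"
        unfolding integral_mult_right using int by (intro sum_mono mult_left_mono) auto
      also have "\<dots> = C * r powr (- b)"
        using r by (simp add: C_def powr_divide powr_minus field_simps)
      finally have Sle: "integral {0..2 * pi} S \<le> C * r powr (- b)" .
      have "rcis r \<theta> \<noteq> a \<and> norm (rcis r \<theta> - a) powr (- b) \<le> S \<theta>" if t: "\<theta> \<in> {0..2 * pi} - X" for \<theta>
      proof -
        obtain m :: int where m: "m \<in> {-1..3}" and
          ge: "norm (rcis r \<theta> - rcis (norm a) \<phi>) \<ge> r / 2 * \<bar>\<theta> - p m\<bar>"
          using norm_rcis_diff_ge[OF r _ phi, of \<theta> "norm a"] t unfolding p_def by blast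
        have "\<theta> \<noteq> p m" using t m by (auto simp: X_def)
        then have pos: "r / 2 * \<bar>\<theta> - p m\<bar> > 0" using r by simp
        have "norm (rcis r \<theta> - a) powr (- b) \<le> (r / 2 * \<bar>\<theta> - p m\<bar>) powr (- b)"
          using ge pos b a by (intro powr_mono2') auto
        also have "\<dots> = (r / 2) powr (- b) * \<bar>\<theta> - p m\<bar> powr (- b)"
          using r by (intro powr_mult) 
        also have "\<dots> \<le> S \<theta>"
          unfolding S_def by (rule member_le_sum[OF m]) auto
        finally show ?thesis using ge pos a by (metis norm_zero right_minus_eq not_le)
      qed
      then show "\<exists>S X. finite X \<and> S integrable_on {0..2 * pi} \<and>
          integral {0..2 * pi} S \<le> C * r powr (- b) \<and>
          (\<forall>\<theta>\<in>{0..2 * pi} - X. rcis r \<theta> \<noteq> a \<and> norm (rcis r \<theta> - a) powr (- b) \<le> S \<theta>)"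
        using Sint Sle by (intro exI[of _ S] exI[of _ X]) (auto simp: X_def)
    qed
  qed
qed

section \<open>Coefficients of a power series with two bounded consecutive powers\<close>

lemma powr_mult_powr_le_quartic:
  fixes a e x y :: real
  assumes "a \<ge> 0" "e > 0" "x \<ge> 0" "y \<ge> 0" "x + y = 4"
  shows "a powr x * e powr y \<le> (a\<^sup>2 + e\<^sup>2)\<^sup>2"
proof -
  define m where "m = max a e"
  have m: "m > 0" "a \<le> m" "e \<le> m" using assms by (auto simp: m_def)
  have "a powr x * e powr y \<le> m powr x * m powr y"
    using assms m by (intro mult_mono powr_mono2) auto
  also have "\<dots> = m powr 4" using assms by (simp flip: powr_add)
  also have "\<dots> = (m\<^sup>2)\<^sup>2" using m by (simp add: powr_numeral)
  also have "\<dots> \<le> (a\<^sup>2 + e\<^sup>2)\<^sup>2" by (intro power_mono) (auto simp: m_def max_def)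
  finally show ?thesis .
qed

text \<open>To be read with \<open>a = |G|\<close>, \<open>b = |H|\<close>, \<open>e = |E|\<close>
  and the truncation error \<open>c\<close>. The three bounds serve the quotient itself, the part of
  its dbar derivative with \<open>E'\<close>, and the part with \<open>G'\<close> once
  \<open>|G'/G|\<close> to the power \<open>1 - 1 / (2 * j)\<close> has been split off. In the last
  two, \<open>le\<close> is inserted and a power of \<open>e\<close> is taken out such that the
  remaining exponents of \<open>a\<close> and \<open>e\<close> add up to four; the square of
  \<open>a\<^sup>2 + e\<^sup>2\<close> then dominates.\<close>

lemma cusp_weight_bounds:
  fixes a b c e :: real and j :: nat
  assumes a: "a \<ge> 0" and b: "b \<ge> 0" and c: "c \<ge> 0" and e: "e > 0" and j: "j \<ge> 1"
    and le: "b \<le> a * a powr (1 / j) + c"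
  shows "b * a / (a\<^sup>2 + e\<^sup>2) \<le> a powr (1 / j) + c / e"
    and "b * a * e\<^sup>2 / (a\<^sup>2 + e\<^sup>2)\<^sup>2 \<le> e powr (1 / j) + c / e"
    and "b * e\<^sup>2 * a powr (1 - 1 / (2 * j)) / (a\<^sup>2 + e\<^sup>2)\<^sup>2
            \<le> e powr (1 / (2 * j)) + c * e powr (- 1 - 1 / (2 * j))"
proof -
  let ?D = "a\<^sup>2 + e\<^sup>2"
  have D: "?D > 0" using e by (simp add: add_nonneg_pos)
  have D2: "?D\<^sup>2 > 0" by (rule zero_less_power[OF D])
  define i where "i = 1 / real j"
  have i: "0 < i" "i \<le> 1" using j by (auto simp: i_def)
  have le': "b \<le> a * a powr i + c" using le by (simp add: i_def)
  have i2: "1 / (2 * real j) = i / 2" by (simp add: i_def)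
  have ae: "a * e \<le> ?D"
  proof -
    have "2 * a * e \<le> ?D" by (rule sum_squares_bound)
    moreover have "0 \<le> a * e" using a e by simp
    ultimately show ?thesis by linarith
  qed
  have "b * a \<le> (a * a powr i + c) * a" using le' a by (rule mult_right_mono)
  also have "\<dots> = a powr i * a\<^sup>2 + c / e * (a * e)"
    using e by (simp add: field_simps power2_eq_square)
  also have "\<dots> \<le> a powr i * ?D + c / e * ?D"
    using ae c e by (intro add_mono mult_left_mono) auto
  finally show "b * a / ?D \<le> a powr (1 / j) + c / e"
    using D by (simp add: pos_divide_le_eq i_def[symmetric] distrib_right)
  have "b * a * e\<^sup>2 \<le> (a * a powr i + c) * a * e\<^sup>2"
    using le' a by (intro mult_right_mono) auto
  also have "\<dots> = e powr i * (a powr (2 + i) * e powr (2 - i)) + c / e * (a powr 1 * e powr 3)"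
  proof (cases "a = 0")
    case False
    then have "a > 0" using a by simp
    then show ?thesis using e
      by (simp add: powr_add powr_diff powr_numeral field_simps power2_eq_square power3_eq_cube)
  qed (use i in simp)
  also have "\<dots> \<le> e powr i * ?D\<^sup>2 + c / e * ?D\<^sup>2"
    using a e i c by (intro add_mono mult_left_mono powr_mult_powr_le_quartic) auto
  finally show "b * a * e\<^sup>2 / ?D\<^sup>2 \<le> e powr (1 / j) + c / e"
    using D2 by (simp add: pos_divide_le_eq i_def[symmetric] distrib_right)
  have "b * e\<^sup>2 * a powr (1 - i / 2) \<le> (a * a powr i + c) * e\<^sup>2 * a powr (1 - i / 2)"
    using le' a by (intro mult_right_mono) auto
  also have "\<dots> = e powr (i / 2) * (a powr (2 + i / 2) * e powr (2 - i / 2))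
      + c * e powr (- 1 - i / 2) * (a powr (1 - i / 2) * e powr (3 + i / 2))"
  proof (cases "a = 0")
    case False
    then have a: "a > 0" using a by simp
    have 1: "a * a powr i * a powr (1 - i / 2) = a powr (2 + i / 2)"
      using a by (simp add: powr_mult_base flip: powr_add)
    have 2: "e powr (i / 2) * e powr (2 - i / 2) = e\<^sup>2"
      using e by (simp add: powr_numeral flip: powr_add)
    have 3: "e powr (- 1 - i / 2) * e powr (3 + i / 2) = e\<^sup>2"
      using e by (simp add: powr_numeral flip: powr_add)
    have "(a * a powr i + c) * e\<^sup>2 * a powr (1 - i / 2)
        = (a * a powr i * a powr (1 - i / 2)) * e\<^sup>2 + c * e\<^sup>2 * a powr (1 - i / 2)"
      by (simp add: algebra_simps)
    also have "\<dots> = a powr (2 + i / 2) * (e powr (i / 2) * e powr (2 - i / 2))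
        + c * (e powr (- 1 - i / 2) * e powr (3 + i / 2)) * a powr (1 - i / 2)"
      by (simp only: 1 2 3)
    finally show ?thesis by (simp add: mult_ac)
  qed simp
  also have "\<dots> \<le> e powr (i / 2) * ?D\<^sup>2 + c * e powr (- 1 - i / 2) * ?D\<^sup>2"
    using a e i c by (intro add_mono mult_left_mono powr_mult_powr_le_quartic) auto
  finally show "b * e\<^sup>2 * a powr (1 - 1 / (2 * j)) / ?D\<^sup>2
            \<le> e powr (1 / (2 * j)) + c * e powr (- 1 - 1 / (2 * j))"
    using D2 by (simp add: pos_divide_le_eq i2 distrib_right)
qed

lemma add_powr_le:
  fixes x y b :: real
  assumes "x \<ge> 0" "y \<ge> 0" "0 < b" "b \<le> 1"
  shows "(x + y) powr b \<le> x powr b + y powr b"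
proof (cases "x + y = 0")
  case False
  define s where "s = x + y"
  have s: "s > 0" using False assms by (simp add: s_def)
  have *: "t / s \<le> (t / s) powr b" if "0 \<le> t" "t \<le> s" for t
    using powr_mono'[of b 1 "t / s"] that s assms by (simp add: powr_one_gt_zero_iff)
  have "x / s + y / s \<le> (x / s) powr b + (y / s) powr b"
    using assms by (intro add_mono *) (auto simp: s_def)
  moreover have "x / s + y / s = 1" using s by (simp add: s_def flip: add_divide_distrib)
  ultimately have "1 \<le> (x powr b + y powr b) / s powr b"
    using assms s by (simp add: powr_divide add_divide_distrib)
  then show ?thesis using s by (simp add: field_simps s_def)
qed (use assms in auto)

text \<open>Subadditivity of the concave power allows a sum of simple poles to be integrated pole by
  pole.\<close>

lemma norm_sum_list_powr_le:
  fixes b :: real and g :: "'a \<Rightarrow> complex"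
  assumes "0 < b" "b \<le> 1"
  shows "norm (\<Sum>x\<leftarrow>xs. g x) powr b \<le> (\<Sum>x\<leftarrow>xs. norm (g x) powr b)"
proof (induction xs)
  case (Cons x xs)
  have "norm (\<Sum>x\<leftarrow>x # xs. g x) powr b \<le> (norm (g x) + norm (\<Sum>x\<leftarrow>xs. g x)) powr b"
    using assms by (intro powr_mono2) (auto intro: norm_triangle_ineq)
  also have "\<dots> \<le> norm (g x) powr b + norm (\<Sum>x\<leftarrow>xs. g x) powr b"
    using assms by (intro add_powr_le) auto
  finally show ?case using Cons by simp
qed simp

lemma poly_logderiv_factorized:
  fixes xs :: "complex list"
  assumes "\<And>x. x \<in> set xs \<Longrightarrow> z \<noteq> x"
  shows "poly (pderiv (\<Prod>x\<leftarrow>xs. [:- x, 1:])) z = poly (\<Prod>x\<leftarrow>xs. [:- x, 1:]) z * (\<Sum>x\<leftarrow>xs. 1 / (z - x))"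
  using assms
proof (induction xs)
  case (Cons x xs)
  then have zx: "z - x \<noteq> 0" by auto
  define Q where "Q = (\<Prod>x\<leftarrow>xs. [:- x, 1:])"
  have IH: "poly (pderiv Q) z = poly Q z * (\<Sum>x\<leftarrow>xs. 1 / (z - x))" using Cons by (auto simp: Q_def)
  have "poly (pderiv ([:- x, 1:] * Q)) z = (z - x) * poly (pderiv Q) z + poly Q z"
    unfolding pderiv_mult by (simp add: pderiv_pCons algebra_simps)
  also have "\<dots> = poly ([:- x, 1:] * Q) z * (1 / (z - x) + (\<Sum>x\<leftarrow>xs. 1 / (z - x)))"
  proof -
    define s where "s = (\<Sum>x\<leftarrow>xs. 1 / (z - x))"
    define q where "q = poly Q z"
    have "(z - x) * (q * s) + q = (z - x) * q * (1 / (z - x) + s)"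
      using zx by (simp add: distrib_left)
    then show ?thesis unfolding IH by (simp add: s_def q_def algebra_simps)
  qed
  finally show ?case by (simp add: Q_def)
qed (simp add: pderiv_1)

lemma circle_powr_sum_integral:
  fixes b C r :: real
  assumes C: "circle_dominated b C r"
  shows "\<exists>S X. finite X \<and> S integrable_on {0..2 * pi} \<and>
        integral {0..2 * pi} S \<le> length xs * (C * r powr (- b)) \<and>
        (\<forall>\<theta>\<in>{0..2 * pi} - X. (\<forall>x\<in>set xs. rcis r \<theta> \<noteq> x) \<and>
           (\<Sum>x\<leftarrow>xs. norm (rcis r \<theta> - x) powr (- b)) \<le> S \<theta>)"
proof (induction xs)
  case Nil
  show ?case by (intro exI[of _ "\<lambda>_. 0"] exI[of _ "{}"]) (simp add: integrable_0)
next
  case (Cons a xs)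
  obtain S X where S: "finite X" "S integrable_on {0..2 * pi}"
    "integral {0..2 * pi} S \<le> length xs * (C * r powr (- b))"
    "\<forall>\<theta>\<in>{0..2 * pi} - X. (\<forall>x\<in>set xs. rcis r \<theta> \<noteq> x) \<and>
           (\<Sum>x\<leftarrow>xs. norm (rcis r \<theta> - x) powr (- b)) \<le> S \<theta>" using Cons by blast
  obtain S' X' where S': "finite X'" "S' integrable_on {0..2 * pi}"
    "integral {0..2 * pi} S' \<le> C * r powr (- b)"
    "\<forall>\<theta>\<in>{0..2 * pi} - X'. rcis r \<theta> \<noteq> a \<and> norm (rcis r \<theta> - a) powr (- b) \<le> S' \<theta>" using C unfolding circle_dominated_def by blast
  show ?case
    by (intro exI[of _ "\<lambda>x. S' x + S x"] exI[of _ "X \<union> X'"])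
      (use S S' in \<open>auto simp: integrable_add integral_add algebra_simps intro!: add_mono\<close>)
qed

lemma vector_derivative_norm_bound:
  fixes f :: "real \<Rightarrow> complex"
  assumes "convex S" "\<And>x. x \<in> S \<Longrightarrow> (f has_vector_derivative f' x) (at x within S)"
    "\<And>x. x \<in> S \<Longrightarrow> norm (f' x) \<le> B" "x \<in> S" "y \<in> S"
  shows "norm (f x - f y) \<le> B * \<bar>x - y\<bar>"
proof -
  have "norm (f x - f y) \<le> B * norm (x - y)"
  proof (rule differentiable_bound[OF assms(1) _ _ assms(4,5)])
    show "(f has_derivative (\<lambda>h. h *\<^sub>R f' x)) (at x within S)" if "x \<in> S" for x
      using assms(2)[OF that] by (simp add: has_vector_derivative_def)
    show "onorm (\<lambda>h. h *\<^sub>R f' x) \<le> B" if "x \<in> S" for x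
      using assms(3)[OF that] by (intro onorm_le) (simp add: mult.commute[of B] mult_left_mono)
  qed
  then show ?thesis by simp
qed

lemma integral_rcis_power_quotient:
  assumes "r > 0"
  shows "((\<lambda>\<theta>. rcis r \<theta> ^ i / rcis r \<theta> ^ k) has_integral (if i = k then 2 * pi else 0)) {0..2 * pi}"
proof (cases "i = k")
  case True
  have "((\<lambda>\<theta>. 1::complex) has_integral (2 * pi)) {0..2 * pi}"
    using has_integral_const_real[of "1::complex" 0 "2 * pi"] by (simp add: scaleR_conv_of_real)
  then show ?thesis using True assms by (simp add: rcis_zero_mod)
next
  case False
  define m where "m = real i - real k"
  have m: "m \<noteq> 0" using False by (simp add: m_def)
  define c where "c = complex_of_real (r ^ i / r ^ k)"
  have eq: "rcis r \<theta> ^ i / rcis r \<theta> ^ k = c * cis (m * \<theta>)" for \<theta>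
  proof -
    have "rcis r \<theta> ^ i / rcis r \<theta> ^ k = rcis (r ^ i / r ^ k) (m * \<theta>)"
      by (simp add: DeMoivre2 rcis_divide m_def algebra_simps)
    then show ?thesis by (simp add: rcis_def c_def)
  qed
  define F where "F \<theta> = c * cis (m * \<theta>) / (\<i> * m)" for \<theta>
  have "((\<lambda>\<theta>. c * cis (m * \<theta>)) has_integral (F (2 * pi) - F 0)) {0..2 * pi}"
  proof (rule fundamental_theorem_of_calculus)
    fix x :: real
    have "((\<lambda>x. m * x) has_real_derivative m) (at x within {0..2 * pi})"
      by (auto intro!: derivative_eq_intros)
    then have "((\<lambda>x. cis (m * x)) has_vector_derivative m *\<^sub>R (\<i> * cis (m * x))) (at x within {0..2 * pi})"
      unfolding has_real_derivative_iff_has_vector_derivative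
      by (rule vector_diff_chain_within[where g=cis, unfolded o_def])
        (auto intro!: derivative_eq_intros simp: has_vector_derivative_def)
    then have "((\<lambda>x. c / (\<i> * m) * cis (m * x)) has_vector_derivative (c / (\<i> * m) * (m *\<^sub>R (\<i> * cis (m * x))))) (at x within {0..2 * pi})"
      by (rule has_vector_derivative_mult_right)
    then show "(F has_vector_derivative c * cis (m * x)) (at x within {0..2 * pi})"
      using m unfolding F_def by (simp add: scaleR_conv_of_real mult_ac)
  qed simp
  moreover have "cis (m * (2 * pi)) = 1"
  proof -
    have "cis (m * (2 * pi)) = cis (2 * pi * of_int (int i - int k))" by (simp add: m_def mult_ac)
    then show ?thesis using cis_multiple_2pi[of "of_int (int i - int k)"] by simp
  qed
  ultimately show ?thesis using False by (simp add: eq F_def)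
qed

lemma poly_path_has_vector_derivative:
  fixes \<gamma> :: "real \<Rightarrow> complex"
  assumes "(\<gamma> has_vector_derivative \<gamma>') (at t within S)"
  shows "((\<lambda>t. poly p (\<gamma> t)) has_vector_derivative \<gamma>' * poly (pderiv p) (\<gamma> t)) (at t within S)"
  using field_vector_diff_chain_within[OF assms, of "poly p" "poly (pderiv p) (\<gamma> t)"]
  by (simp add: o_def poly_DERIV has_field_derivative_at_within)

lemma inverse_path_has_vector_derivative:
  fixes \<gamma> :: "real \<Rightarrow> complex"
  assumes "(\<gamma> has_vector_derivative \<gamma>') (at t within S)" "\<gamma> t \<noteq> 0"
  shows "((\<lambda>t. inverse (\<gamma> t)) has_vector_derivative - (\<gamma>' * (inverse (\<gamma> t))\<^sup>2)) (at t within S)"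
  using field_vector_diff_chain_within[OF assms(1), of inverse "- (inverse (\<gamma> t) ^ Suc (Suc 0))"]
    DERIV_inverse[OF assms(2), of "\<gamma> ` S"]
  by (simp add: o_def power2_eq_square)

section \<open>The regularised quotient, its Wirtinger derivatives and its circle means\<close>

context
  fixes G H E :: "complex poly" and k :: nat
begin

text \<open>Written with conjugates rather than norms, so that the product rule for polynomials and
  their conjugates applies along a path; \<open>cden_eq\<close> is the form with norms.\<close>

definition cden :: "complex \<Rightarrow> complex" where
  "cden z = poly G z * cnj (poly G z) + poly E z * cnj (poly E z)"

text \<open>A smooth substitute for the meromorphic function \<open>H / (G z^k)\<close>; the polynomial
  \<open>E\<close> makes the denominator nonzero where \<open>G\<close> vanishes.\<close>
definition cquot :: "complex \<Rightarrow> complex" where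
  "cquot z = poly H z * inverse (poly (monom 1 k) z) * cnj (poly G z) * inverse (cden z)"

text \<open>The Wirtinger derivative of \<open>cquot\<close> with respect to \<open>z\<close>.
  Writing \<open>z^k\<close> as \<open>poly (monom 1 k) z\<close> lets one differentiation rule for
  polynomials cover all factors.\<close>

definition cquot_d :: "complex \<Rightarrow> complex" where
  "cquot_d z = (poly (pderiv H) z * inverse (poly (monom 1 k) z)
        - poly H z * (poly (pderiv (monom 1 k)) z * (inverse (poly (monom 1 k) z))\<^sup>2)) * cnj (poly G z) * inverse (cden z)
     - poly H z * inverse (poly (monom 1 k) z) * cnj (poly G z)
        * ((poly (pderiv G) z * cnj (poly G z) + poly (pderiv E) z * cnj (poly E z)) * (inverse (cden z))\<^sup>2)"

text \<open>The Wirtinger derivative of \<open>cquot\<close> with respect to the conjugate variable.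
  Only \<open>cnj G / cden\<close> contributes; in its quotient rule the terms with
  \<open>G * cnj G\<close> cancel, and what is left carries the factor \<open>E\<close>, which is
  small near the origin.\<close>

definition cquot_dbar :: "complex \<Rightarrow> complex" where
  "cquot_dbar z = poly H z * inverse (poly (monom 1 k) z) * poly E z
      * cnj (poly E z * poly (pderiv G) z - poly G z * poly (pderiv E) z) * (inverse (cden z))\<^sup>2"

lemma cden_eq: "cden z = of_real ((norm (poly G z))\<^sup>2 + (norm (poly E z))\<^sup>2)"
  by (simp add: cden_def complex_mult_cnj cmod_power2)

lemma cquot_path_has_vector_derivative:
  assumes g: "(\<gamma> has_vector_derivative \<gamma>') (at t within S)" and z: "\<gamma> t \<noteq> 0" "cden (\<gamma> t) \<noteq> 0"
  shows "((\<lambda>t. cquot (\<gamma> t)) has_vector_derivative cquot_d (\<gamma> t) * \<gamma>' + cquot_dbar (\<gamma> t) * cnj \<gamma>') (at t within S)"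
proof -
  let ?z = "\<gamma> t"
  note P = poly_path_has_vector_derivative[OF g]
  note C = has_vector_derivative_cnj[OF P]
  have k0: "poly (monom 1 k) ?z \<noteq> 0" using z by (simp add: poly_monom)
  define D' where "D' = poly G ?z * cnj (\<gamma>' * poly (pderiv G) ?z) + \<gamma>' * poly (pderiv G) ?z * cnj (poly G ?z)
     + (poly E ?z * cnj (\<gamma>' * poly (pderiv E) ?z) + \<gamma>' * poly (pderiv E) ?z * cnj (poly E ?z))"
  have D: "((\<lambda>t. cden (\<gamma> t)) has_vector_derivative D') (at t within S)"
    unfolding cden_def D'_def by (intro has_vector_derivative_add has_vector_derivative_mult P C)
  note I = inverse_path_has_vector_derivative[OF D z(2)]
  note K = inverse_path_has_vector_derivative[OF P[of "monom 1 k"] k0]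
  let ?m = "inverse (poly (monom 1 k) ?z)" and ?i = "inverse (cden ?z)"
  have der: "((\<lambda>t. cquot (\<gamma> t)) has_vector_derivative
     poly H ?z * ?m * cnj (poly G ?z) * - (D' * ?i\<^sup>2)
     + (poly H ?z * ?m * cnj (\<gamma>' * poly (pderiv G) ?z)
        + (poly H ?z * - (\<gamma>' * poly (pderiv (monom 1 k)) ?z * ?m\<^sup>2) + \<gamma>' * poly (pderiv H) ?z * ?m) * cnj (poly G ?z)) * ?i) (at t within S)"
    (is "(_ has_vector_derivative ?R) _")
    unfolding cquot_def by (intro has_vector_derivative_mult P C I K)
  \<comment> \<open>Brings the term with the derivative of \<open>cnj G\<close> to the common
    denominator, the square of \<open>cden\<close>, where the cancellation behind
    \<open>cquot_dbar\<close> takes place.\<close>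
  have "?i = cden ?z * ?i\<^sup>2" using z(2) by (simp add: power2_eq_square)
  also have "\<dots> = (poly G ?z * cnj (poly G ?z) + poly E ?z * cnj (poly E ?z)) * ?i\<^sup>2" by (simp add: cden_def)
  finally have i: "poly H ?z * ?m * cnj (\<gamma>' * poly (pderiv G) ?z) * ?i
     = poly H ?z * ?m * cnj (\<gamma>' * poly (pderiv G) ?z) * ((poly G ?z * cnj (poly G ?z) + poly E ?z * cnj (poly E ?z)) * ?i\<^sup>2)" by simp
  have "?R = cquot_d ?z * \<gamma>' + cquot_dbar ?z * cnj \<gamma>'"
    unfolding distrib_right[of _ _ ?i] i unfolding cquot_d_def cquot_dbar_def D'_def
    by (simp only: complex_cnj_mult complex_cnj_diff) (simp add: algebra_simps)
  then show ?thesis using der by simp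
qed

lemma continuous_on_cquot_derivs:
  assumes "\<And>z. z \<in> S \<Longrightarrow> z \<noteq> 0 \<and> cden z \<noteq> 0"
  shows "continuous_on S cquot" "continuous_on S cquot_d" "continuous_on S cquot_dbar"
proof -
  have c: "continuous_on S (poly p)" for p :: "complex poly" by (intro continuous_intros)
  have d: "continuous_on S cden" unfolding cden_def by (intro continuous_intros c)
  show "continuous_on S cquot" "continuous_on S cquot_d" "continuous_on S cquot_dbar"
    unfolding cquot_def cquot_d_def cquot_dbar_def
    by (intro continuous_intros c d; use assms in \<open>auto simp: poly_monom\<close>)+
qed

text \<open>In polar coordinates the radial derivative equals the angular derivative divided by
  \<open>\<i> * r\<close>, plus \<open>2 * cis (- \<theta>)\<close> times the dbar derivative. The
  angular derivative integrates to zero over a full circle. In particular circle means of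
  holomorphic functions are constant, so the dbar term measures exactly the effect of the
  regularisation.\<close>

lemma circle_mean_has_vector_derivative:
  assumes z: "\<And>z. z \<noteq> 0 \<Longrightarrow> cden z \<noteq> 0" and r: "0 < r0" "r \<in> {r0..1}"
  shows "((\<lambda>r. integral {0..2 * pi} (\<lambda>\<theta>. cquot (rcis r \<theta>))) has_vector_derivative
     integral {0..2 * pi} (\<lambda>\<theta>. 2 * cis (- \<theta>) * cquot_dbar (rcis r \<theta>))) (at r within {r0..1})"
proof -
  have nz: "rcis r \<theta> \<noteq> 0" if "r \<in> {r0..1}" for r \<theta> using that \<open>0 < r0\<close> by simp
  define ur where "ur r \<theta> = cquot_d (rcis r \<theta>) * cis \<theta> + cquot_dbar (rcis r \<theta>) * cis (- \<theta>)" for r \<theta>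
  define ut where "ut \<theta> = cquot_d (rcis r \<theta>) * (\<i> * rcis r \<theta>) + cquot_dbar (rcis r \<theta>) * cnj (\<i> * rcis r \<theta>)" for \<theta>
  have cr: "continuous_on S (\<lambda>(r, \<theta>). rcis r \<theta>)" for S
    unfolding rcis_def case_prod_beta cis_conv_exp by (intro continuous_intros)
  have cc: "continuous_on S (\<lambda>x. cis (f x))" if "continuous_on S f" for S and f :: "real \<times> real \<Rightarrow> real"
    unfolding cis_conv_exp using that by (intro continuous_intros)
  have comp: "continuous_on ({r0..1} \<times> {0..2 * pi}) (\<lambda>(r, \<theta>). h (rcis r \<theta>))" if "continuous_on (- {0}) h" for h :: "complex \<Rightarrow> complex"
  proof -
    have "(\<lambda>(r, \<theta>). rcis r \<theta>) ` ({r0..1} \<times> {0..2 * pi}) \<subseteq> - {0}"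
      using r(1) by clarsimp
    from continuous_on_compose2[OF that cr this] show ?thesis by (simp add: case_prod_beta)
  qed
  have cq: "continuous_on (- {0}) cquot" "continuous_on (- {0}) cquot_d" "continuous_on (- {0}) cquot_dbar"
    using continuous_on_cquot_derivs[of "- {0}"] z by auto
  have comp1: "continuous_on {0..2 * pi} (\<lambda>\<theta>. h (rcis r \<theta>))" if "continuous_on (- {0}) h" "r \<in> {r0..1}" for h :: "complex \<Rightarrow> complex" and r
    using continuous_on_compose2[OF comp[OF that(1)], of "{0..2 * pi}" "\<lambda>\<theta>. (r, \<theta>)"] that(2)
    by (simp add: image_subset_iff continuous_on_Pair)
  have "((\<lambda>r. integral (cbox 0 (2 * pi)) (\<lambda>\<theta>. cquot (rcis r \<theta>))) has_vector_derivative
     integral (cbox 0 (2 * pi)) (ur r)) (at r within {r0..1})"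
  proof (rule leibniz_rule_vector_derivative)
    show "r \<in> {r0..1}" "convex {r0..1}" using r by auto
    fix r \<theta> assume r: "r \<in> {r0..1}"
    have "((\<lambda>r. rcis r \<theta>) has_vector_derivative cis \<theta>) (at r within {r0..1})"
      unfolding rcis_def by (auto intro!: derivative_eq_intros simp: has_vector_derivative_def scaleR_conv_of_real)
    from cquot_path_has_vector_derivative[OF this nz[OF r] z[OF nz[OF r]]]
    show "((\<lambda>r. cquot (rcis r \<theta>)) has_vector_derivative ur r \<theta>) (at r within {r0..1})"
      by (simp add: ur_def cis_cnj)
    show "(\<lambda>\<theta>. cquot (rcis r \<theta>)) integrable_on cbox 0 (2 * pi)"
      using comp1[OF cq(1) r] by (simp add: integrable_continuous_interval)
  next
    show "continuous_on ({r0..1} \<times> cbox 0 (2 * pi)) (\<lambda>(r, \<theta>). ur r \<theta>)"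
      unfolding ur_def using comp[OF cq(2)] comp[OF cq(3)]
      by (auto simp: case_prod_beta intro!: continuous_intros cc)
  qed
  then have 1: "((\<lambda>r. integral {0..2 * pi} (\<lambda>\<theta>. cquot (rcis r \<theta>))) has_vector_derivative
     integral {0..2 * pi} (ur r)) (at r within {r0..1})" by simp
  have r0: "r \<noteq> 0" using r by auto
  have "(ut has_integral (cquot (rcis r (2 * pi)) - cquot (rcis r 0))) {0..2 * pi}"
  proof (rule fundamental_theorem_of_calculus)
    fix x :: real
    have "((\<lambda>\<theta>. rcis r \<theta>) has_vector_derivative \<i> * rcis r x) (at x within {0..2 * pi})"
      unfolding rcis_def by (auto intro!: derivative_eq_intros simp: has_vector_derivative_def scaleR_conv_of_real)
    from cquot_path_has_vector_derivative[OF this nz[OF r(2)] z[OF nz[OF r(2)]]]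
    show "((\<lambda>\<theta>. cquot (rcis r \<theta>)) has_vector_derivative ut x) (at x within {0..2 * pi})"
      by (simp add: ut_def)
  qed simp
  then have 2: "(ut has_integral 0) {0..2 * pi}" by (simp add: rcis_def)
  have ur: "ur r \<theta> = ut \<theta> / (\<i> * r) + 2 * cis (- \<theta>) * cquot_dbar (rcis r \<theta>)" for \<theta>
    using r0 by (simp add: ur_def ut_def rcis_def cis_cnj field_simps)
  have i3: "(\<lambda>\<theta>. 2 * cis (- \<theta>) * cquot_dbar (rcis r \<theta>)) integrable_on {0..2 * pi}"
    using comp1[OF cq(3) r(2)] unfolding cis_conv_exp
    by (intro integrable_continuous_interval continuous_intros) auto
  have "(ur r has_integral (0 / (\<i> * r) + integral {0..2 * pi} (\<lambda>\<theta>. 2 * cis (- \<theta>) * cquot_dbar (rcis r \<theta>)))) {0..2 * pi}"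
    unfolding ur[abs_def] by (intro has_integral_add has_integral_divide 2 integrable_integral i3)
  then show ?thesis using 1 by (simp add: integral_unique)
qed

end

section \<open>Bounds for the regularised quotient that do not see the zeros of
  \<open>G\<close>\<close>

context
  fixes G H :: "complex poly" and j k N :: nat and P Q C :: real
  assumes j: "j \<ge> 1" and P: "P \<ge> 0" and Q: "Q \<ge> 1" and N: "N = 2 * j * (k + 1)"
    and H: "\<And>z. norm z \<le> 1 \<Longrightarrow> norm (poly H z)
        \<le> norm (poly G z) * norm (poly G z) powr (1 / j) + P * norm z ^ (2 * N + (k + 1))"
    and G: "\<And>z. norm z \<le> 1 \<Longrightarrow> norm (poly G z) \<le> Q"
    and G': "\<And>z. norm z \<le> 1 \<Longrightarrow> norm (poly (pderiv G) z) \<le> Q"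
    and C: "C \<ge> 0" "\<And>r. r > 0 \<Longrightarrow> circle_dominated (1 - 1 / (2 * j)) C r"
begin

text \<open>On the unit circle \<open>E\<close> and \<open>z^k\<close> have modulus one, so this is
  the case \<open>e = 1\<close> of \<open>cusp_weight_bounds\<close>. It controls the circle mean at
  radius one.\<close>

lemma cquot_norm_bound:
  assumes z: "norm z = 1"
  shows "norm (cquot G H (monom 1 N) k z) \<le> Q + P"
proof -
  define a where "a = norm (poly G z)"
  have a: "a \<ge> 0" "a \<le> Q" using G[of z] z by (auto simp: a_def)
  have E: "norm (poly (monom 1 N) z) = 1" using z by (simp add: poly_monom norm_power)
  have "norm (cquot G H (monom 1 N) k z) = norm (poly H z) * a / (a\<^sup>2 + 1\<^sup>2)"
    using z unfolding cquot_def cden_eq norm_mult norm_inverse norm_of_real E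
    by (simp add: a_def poly_monom norm_power divide_inverse)
  also have "\<dots> \<le> a powr (1 / j) + P / 1"
    using H[of z] z P j by (intro cusp_weight_bounds(1)) (auto simp: a_def)
  also have "a powr (1 / j) \<le> Q powr (1 / j)" using a by (intro powr_mono2) auto
  also have "Q powr (1 / j) \<le> Q powr 1" using Q j by (intro powr_mono) auto
  finally show ?thesis using Q by simp
qed

text \<open>The weights of \<open>cusp_weight_bounds\<close> provide a factor
  \<open>r ^ (k + 1)\<close>, which cancels \<open>z^(-k)\<close> and leaves one power of
  \<open>r\<close>. The term with \<open>E'\<close> loses that power, since
  \<open>E' = N * E / z\<close>; the term with \<open>G'\<close> keeps it and will use it against
  the poles of \<open>G'/G\<close>.\<close>

lemma cquot_dbar_norm_bound:
  assumes z: "z \<noteq> 0" "norm z \<le> 1" "poly G z \<noteq> 0"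
  shows "norm (cquot_dbar G H (monom 1 N) k z)
     \<le> (1 + P) * (N + Q * norm z * norm (poly (pderiv G) z / poly G z) powr (1 - 1 / (2 * j)))"
proof -
  define a a' b r e c where "a = norm (poly G z)" and "a' = norm (poly (pderiv G) z)"
    and "b = norm (poly H z)" and "r = norm z" and "e = r ^ N" and "c = P * r ^ (2 * N + (k + 1))"
  define \<beta> where "\<beta> = 1 - 1 / (2 * real j)"
  let ?W = "norm (poly (monom 1 N) z * poly (pderiv G) z - poly G z * poly (pderiv (monom 1 N)) z)"
  let ?q = "Q * (a' / a) powr \<beta> * a powr \<beta>"
  have \<beta>: "0 < \<beta>" "\<beta> < 1" using j by (auto simp: \<beta>_def divide_simps)
  have r: "0 < r" "r \<le> 1" using z by (auto simp: r_def)
  have pos: "a > 0" "a' \<ge> 0" "b \<ge> 0" "e > 0" "c \<ge> 0" using z r P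
    by (auto simp: a_def a'_def b_def e_def c_def)
  have le: "b \<le> a * a powr (1 / j) + c" using H[of z] z by (simp add: a_def b_def c_def r_def)
  define D where "D = a\<^sup>2 + e\<^sup>2"
  have D: "D > 0" using pos by (simp add: D_def add_pos_pos)
  \<comment> \<open>The choice of \<open>N\<close> makes \<open>e powr (1 / (2 * j))\<close> equal
    to \<open>r ^ (k + 1)\<close>, one power more than \<open>z^(-k)\<close> takes away.\<close>
  have jj: "real N / real j = real (2 * (k + 1))" "real N / (2 * real j) = real (k + 1)" using j by (auto simp: N field_simps)
  have e1: "e powr (1 / j) = r ^ (2 * (k + 1))"
  proof -
    have "e powr (1 / j) = r powr (real N / j)" using r by (simp add: e_def powr_powr flip: powr_realpow)
    then show ?thesis unfolding jj using r by (simp only: powr_realpow)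
  qed
  have e2: "e powr (1 / (2 * j)) = r ^ (k + 1)"
  proof -
    have "e powr (1 / (2 * j)) = r powr (real N / (2 * real j))" using r by (simp add: e_def powr_powr flip: powr_realpow)
    then show ?thesis unfolding jj using r by (simp only: powr_realpow)
  qed
  have Nk: "N \<ge> k + 1" using j by (cases j) (auto simp: N)
  have p1: "r ^ (2 * (k + 1)) \<le> r ^ (k + 1)" "r ^ (N + (k + 1)) \<le> r ^ (k + 1)" "r ^ N \<le> r ^ (k + 1)"
    using r Nk by (intro power_decreasing; simp)+
  have ce: "c / e = P * r ^ (N + (k + 1))"
    using r by (simp add: c_def e_def power_add mult_2)
  \<comment> \<open>Here the error order \<open>2 * N + (k + 1)\<close> is needed: one
    \<open>e\<close> and the factor \<open>r ^ (k + 1)\<close> are divided out, and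
    \<open>r ^ N\<close> is left, which is at most \<open>r ^ (k + 1)\<close>.\<close>
  have "c * e powr (- 1 - 1 / (2 * j)) = P * r ^ N"
  proof -
    have eq: "e powr (- 1 - 1 / (2 * j)) = 1 / (e * r ^ (k + 1))"
      unfolding powr_diff powr_neg_one[OF pos(4)] e2 by simp
    have "P * r ^ (2 * N + (k + 1)) * (1 / (r ^ N * r ^ (k + 1))) = P * r ^ N"
      using r by (simp add: power_add mult_2)
    then show ?thesis unfolding eq unfolding c_def e_def .
  qed
  then have b3: "b * e\<^sup>2 * a powr \<beta> / D\<^sup>2 \<le> (1 + P) * r ^ (k + 1)"
    using cusp_weight_bounds(3)[OF less_imp_le[OF pos(1)] pos(3,5,4) j le] p1 P
      mult_left_mono[OF p1(3) P] unfolding D_def \<beta>_def e2 by (simp add: distrib_right)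
  have b2: "b * a * e\<^sup>2 / D\<^sup>2 \<le> (1 + P) * r ^ (k + 1)"
    using cusp_weight_bounds(2)[OF less_imp_le[OF pos(1)] pos(3,5,4) j le] p1 P
      mult_left_mono[OF p1(2) P] unfolding D_def ce e1 by (simp add: distrib_right)
  \<comment> \<open>Interpolation: the part \<open>1 - \<beta>\<close> of the exponent of
    \<open>|G'|\<close> is estimated trivially by \<open>Q\<close>, so that the logarithmic
    derivative appears only with the integrable exponent \<open>\<beta> < 1\<close>.\<close>
  have q: "a' \<le> Q * (a' / a) powr \<beta> * a powr \<beta>"
  proof (cases "a' = 0")
    case False
    then have a': "a' > 0" using pos by simp
    have "a' = a' powr (1 - \<beta>) * ((a' / a) powr \<beta> * a powr \<beta>)"
      using a' pos by (simp add: powr_divide flip: powr_add)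
    also have "\<dots> \<le> Q * ((a' / a) powr \<beta> * a powr \<beta>)"
    proof (rule mult_right_mono)
      have "a' powr (1 - \<beta>) \<le> Q powr (1 - \<beta>)" using a' G'[of z] z \<beta> by (intro powr_mono2) (auto simp: a'_def)
      also have "\<dots> \<le> Q powr 1" using Q \<beta> by (intro powr_mono) auto
      finally show "a' powr (1 - \<beta>) \<le> Q" using Q by simp
    qed simp
    finally show ?thesis by (simp add: mult_ac)
  qed (use pos Q in simp)
  have E: "norm (poly (monom 1 N) z) = e" "norm (poly (monom 1 k) z) = r ^ k"
    by (simp_all add: poly_monom norm_power e_def r_def)
  have N1: "N = Suc (N - 1)" using Nk by simp
  have E': "norm (poly (pderiv (monom 1 N)) z) = N * e / r"
  proof -
    have "r ^ N = r ^ (N - 1) * r" by (subst N1) simp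
    then show ?thesis using r by (simp add: pderiv_monom poly_monom norm_mult norm_power e_def r_def)
  qed
  have "?W
     \<le> e * a' + a * (N * e / r)"
    using norm_triangle_ineq4[of "poly (monom 1 N) z * poly (pderiv G) z" "poly G z * poly (pderiv (monom 1 N)) z"]
    by (simp only: norm_mult E E' a_def a'_def)
  also have "\<dots> \<le> e * ?q + a * (N * e / r)"
    using q pos by (intro add_right_mono mult_left_mono) auto
  finally have w: "?W
     \<le> e * ?q + a * (N * e / r)" .
  have "norm (cquot_dbar G H (monom 1 N) k z)
    = b / r ^ k * e * ?W / D\<^sup>2"
    using D unfolding cquot_dbar_def cden_eq norm_mult norm_inverse norm_power norm_of_real E complex_mod_cnj
    by (simp add: b_def D_def a_def divide_inverse power_inverse)
  also have "\<dots> \<le> b / r ^ k * e * (e * ?q + a * (N * e / r)) / D\<^sup>2"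
    using w pos r by (intro divide_right_mono mult_left_mono) auto
  also have "\<dots> = (Q * (a' / a) powr \<beta> / r ^ k) * (b * e\<^sup>2 * a powr \<beta> / D\<^sup>2) + (N / r ^ (k + 1)) * (b * a * e\<^sup>2 / D\<^sup>2)"
    using r D by (simp add: add_divide_distrib distrib_left power2_eq_square mult_ac)
  also have "\<dots> \<le> (Q * (a' / a) powr \<beta> / r ^ k) * ((1 + P) * r ^ (k + 1)) + (N / r ^ (k + 1)) * ((1 + P) * r ^ (k + 1))"
    using b2 b3 Q r by (intro add_mono mult_left_mono) auto
  also have "\<dots> = (1 + P) * (N + Q * r * (a' / a) powr \<beta>)"
    using r by (simp add: field_simps)
  finally show ?thesis by (simp add: a_def a'_def r_def \<beta>_def norm_divide)
qed

text \<open>Off finitely many angles, \<open>|G'/G|\<close> to the power \<open>\<beta>\<close> is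
  at most the sum of \<open>|z - x|\<close> to the power \<open>- \<beta>\<close> over the roots
  \<open>x\<close> of \<open>G\<close>, whose circle integral is at most
  \<open>degree G * C * r powr (- \<beta>)\<close>. The factor \<open>norm z = r\<close> of the
  pointwise bound turns this into \<open>r powr (1 - \<beta>) \<le> 1\<close>, so the estimate is
  uniform as \<open>r\<close> tends to \<open>0\<close>.\<close>

lemma cquot_dbar_circle_integral_bound:
  assumes r: "0 < r" "r \<le> 1" and G0: "poly G 0 \<noteq> 0"
  shows "norm (integral {0..2 * pi} (\<lambda>\<theta>. 2 * cis (- \<theta>) * cquot_dbar G H (monom 1 N) k (rcis r \<theta>)))
     \<le> 2 * (1 + P) * (2 * pi * N + Q * degree G * C)"
proof -
  define \<beta> where "\<beta> = 1 - 1 / (2 * real j)"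
  have \<beta>: "0 < \<beta>" "\<beta> < 1" using j by (auto simp: \<beta>_def divide_simps)
  have Gn: "G \<noteq> 0" using G0 by auto
  obtain A where A: "size A = degree G" "G = smult (lead_coeff G) (\<Prod>x\<in>#A. [:- x, 1:])"
    using alg_closed_imp_factorization[OF Gn] by blast
  obtain xs where xs: "mset xs = A" using ex_mset by blast
  have len: "length xs = degree G" using A(1) xs by (metis size_mset)
  define R where "R = (\<Prod>x\<leftarrow>xs. [:- x, 1:])"
  have R: "(\<Prod>x\<in>#A. [:- x, 1:]) = R"
    unfolding xs[symmetric] R_def mset_map[symmetric] prod_mset_prod_list ..
  define lc where "lc = lead_coeff G"
  have lc: "lc \<noteq> 0" using Gn by (simp add: lc_def)
  have GR: "G = smult lc R" using A(2) unfolding R lc_def .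
  obtain S X where SX: "finite X \<and> S integrable_on {0..2 * pi} \<and>
    integral {0..2 * pi} S \<le> length xs * (C * r powr (- \<beta>)) \<and>
    (\<forall>\<theta>\<in>{0..2 * pi} - X. (\<forall>x\<in>set xs. rcis r \<theta> \<noteq> x) \<and>
           (\<Sum>x\<leftarrow>xs. norm (rcis r \<theta> - x) powr (- \<beta>)) \<le> S \<theta>)"
    using circle_powr_sum_integral[OF C(2)[OF r(1)], of xs] unfolding \<beta>_def of_nat_mult of_nat_numeral by (elim exE)
  note S = SX[THEN conjunct1] SX[THEN conjunct2, THEN conjunct1] SX[THEN conjunct2, THEN conjunct2, THEN conjunct1]
  have SS: "(\<forall>x\<in>set xs. rcis r \<theta> \<noteq> x) \<and> (\<Sum>x\<leftarrow>xs. norm (rcis r \<theta> - x) powr (- \<beta>)) \<le> S \<theta>"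
    if "\<theta> \<in> {0..2 * pi} - X" for \<theta>
    by (rule bspec[OF SX[THEN conjunct2, THEN conjunct2, THEN conjunct2] that])
  define F where "F \<theta> = 2 * cis (- \<theta>) * cquot_dbar G H (monom 1 N) k (rcis r \<theta>)" for \<theta>
  define g where "g \<theta> = 2 * (1 + P) * (N + Q * r * S \<theta>)" for \<theta>
  have cd: "cden G (monom 1 N) z \<noteq> 0" if "z \<noteq> 0" for z
  proof -
    have "(norm (poly G z))\<^sup>2 + (norm (poly (monom 1 N) z))\<^sup>2 > 0"
      using that by (intro add_nonneg_pos) (auto simp: poly_monom)
    then show ?thesis unfolding cden_eq by (metis less_irrefl of_real_eq_0_iff)
  qed
  have subn: "rcis r ` {0..2 * pi} \<subseteq> - {0}" using r by auto
  have rc: "continuous_on {0..2 * pi} (\<lambda>\<theta>. rcis r \<theta>)"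
    unfolding rcis_def cis_conv_exp by (intro continuous_intros)
  have "continuous_on {0..2 * pi} (\<lambda>\<theta>. cquot_dbar G H (monom 1 N) k (rcis r \<theta>))"
  proof -
    have "continuous_on (- {0}) (cquot_dbar G H (monom 1 N) k)" by (rule continuous_on_cquot_derivs(3)) (use cd in auto)
    then show ?thesis by (rule continuous_on_compose2[OF _ rc subn])
  qed
  then have Fc: "continuous_on {0..2 * pi} F"
    unfolding F_def cis_conv_exp by (intro continuous_intros)
  have gi: "(g has_integral (2 * (1 + P) * (2 * pi * N + Q * r * integral {0..2 * pi} S))) {0..2 * pi}"
  proof -
    have "((\<lambda>\<theta>. real N) has_integral (2 * pi * N)) {0..2 * pi}"
      using has_integral_const_real[of "real N" 0 "2 * pi"] by simp
    then show ?thesis unfolding g_def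
      by (intro has_integral_mult_right has_integral_add integrable_integral S(2))
  qed
  have bound: "norm (F \<theta>) \<le> g \<theta>" if t: "\<theta> \<in> {0..2 * pi} - X" for \<theta>
  proof -
    let ?z = "rcis r \<theta>"
    have nx: "\<And>x. x \<in> set xs \<Longrightarrow> ?z \<noteq> x" using SS[OF t] by blast
    have "poly R ?z \<noteq> 0" unfolding R_def using nx by (induction xs) auto
    then have Gz: "poly G ?z \<noteq> 0" using lc unfolding GR by simp
    have "poly (pderiv G) ?z = lc * poly (pderiv R) ?z"
      unfolding GR by (simp add: pderiv_smult)
    also have "\<dots> = lc * poly R ?z * (\<Sum>x\<leftarrow>xs. 1 / (?z - x))"
      unfolding R_def using poly_logderiv_factorized[OF nx] by (simp add: mult_ac)
    also have "\<dots> = poly G ?z * (\<Sum>x\<leftarrow>xs. 1 / (?z - x))" unfolding GR by simp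
    finally have "poly (pderiv G) ?z / poly G ?z = (\<Sum>x\<leftarrow>xs. 1 / (?z - x))" using Gz by simp
    then have "norm (poly (pderiv G) ?z / poly G ?z) powr \<beta> \<le> (\<Sum>x\<leftarrow>xs. norm (1 / (?z - x)) powr \<beta>)"
      using norm_sum_list_powr_le[of \<beta> "\<lambda>x. 1 / (?z - x)" xs] \<beta> by simp
    also have "\<dots> = (\<Sum>x\<leftarrow>xs. norm (?z - x) powr (- \<beta>))"
      by (simp add: norm_divide powr_divide powr_minus_divide)
    also have "\<dots> \<le> S \<theta>" using SS[OF t] by blast
    finally have L: "norm (poly (pderiv G) ?z / poly G ?z) powr \<beta> \<le> S \<theta>" .
    have "norm (F \<theta>) = 2 * norm (cquot_dbar G H (monom 1 N) k ?z)" by (simp add: F_def norm_mult)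
    also have "\<dots> \<le> 2 * ((1 + P) * (N + Q * norm ?z * norm (poly (pderiv G) ?z / poly G ?z) powr \<beta>))"
      using cquot_dbar_norm_bound[of ?z] r Gz by (simp add: \<beta>_def)
    also have "\<dots> \<le> 2 * ((1 + P) * (N + Q * norm ?z * S \<theta>))"
      using L P Q by (intro mult_left_mono add_left_mono) auto
    finally have "norm (F \<theta>) \<le> 2 * ((1 + P) * (N + Q * norm ?z * S \<theta>))" .
    moreover have "norm ?z = r" using r by simp
    ultimately show ?thesis by (simp only: g_def mult.assoc)
  qed
  have X: "negligible X" using S(1) by (rule negligible_finite)
  \<comment> \<open>The pointwise bound is known only off the finite set \<open>X\<close>; setting
    both sides to zero there changes no integral.\<close>
  define F' where "F' \<theta> = (if \<theta> \<in> X then 0 else F \<theta>)" for \<theta>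
  define g' where "g' \<theta> = (if \<theta> \<in> X then 0 else g \<theta>)" for \<theta>
  have "(F has_integral integral {0..2 * pi} F) {0..2 * pi}"
    using Fc by (intro integrable_integral integrable_continuous_interval)
  then have F': "(F' has_integral integral {0..2 * pi} F) {0..2 * pi}"
    by (rule has_integral_spike[OF X, rotated]) (simp add: F'_def)
  have g': "(g' has_integral (2 * (1 + P) * (2 * pi * N + Q * r * integral {0..2 * pi} S))) {0..2 * pi}"
    using gi by (rule has_integral_spike[OF X, rotated]) (simp add: g'_def)
  have "norm (integral {0..2 * pi} F') \<le> integral {0..2 * pi} g'"
    using F' g' bound by (intro integral_norm_bound_integral) (auto simp: F'_def g'_def has_integral_integrable)
  then have "norm (integral {0..2 * pi} F) \<le> 2 * (1 + P) * (2 * pi * N + Q * (r * integral {0..2 * pi} S))"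
    using F' g' by (simp add: integral_unique mult_ac)
  also have "\<dots> \<le> 2 * (1 + P) * (2 * pi * N + Q * (length xs * C))"
  proof -
    have "r * integral {0..2 * pi} S \<le> r * (length xs * (C * r powr (- \<beta>)))"
      using S(3) r by (intro mult_left_mono) auto
    also have "\<dots> = length xs * C * r powr (1 - \<beta>)"
      using r by (simp add: powr_diff powr_minus divide_inverse)
    also have "\<dots> \<le> length xs * C * 1"
      using r \<beta> C(1) by (intro mult_left_mono powr_le1) auto
    finally show ?thesis using P Q by (intro mult_left_mono add_left_mono) auto
  qed
  finally show ?thesis unfolding F_def len by (simp add: mult_ac)
qed

text \<open>\<open>T\<close> is a Taylor polynomial of \<open>H / G\<close> at the origin. For small
  \<open>r\<close> the quotient is close to \<open>T / z^k\<close>, whose circle mean is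
  \<open>coeff T k\<close>; the mean moves by a bounded amount between radius \<open>r\<close> and
  radius one. Neither \<open>c\<close> nor a lower bound for \<open>poly G 0\<close> enters the
  conclusion: both are used only in the limit \<open>r\<close> to \<open>0\<close>.\<close>

lemma cusp_coeff_bound:
  assumes G0: "poly G 0 \<noteq> 0"
    and T: "\<And>z. norm z \<le> 1 \<Longrightarrow> norm (poly H z - poly G z * poly T z) \<le> c * norm z ^ (k + 1)"
  shows "norm (coeff T k) \<le> Q + P + (1 + P) * (2 * N + Q * degree G * C)"
proof -
  let ?u = "cquot G H (monom 1 N) k" and ?D = "cden G (monom 1 N)"
  let ?t = "\<lambda>r \<theta>. poly T (rcis r \<theta>) / rcis r \<theta> ^ k"
  define A where "A r = integral {0..2 * pi} (\<lambda>\<theta>. ?u (rcis r \<theta>))" for r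
  define B where "B = 2 * (1 + P) * (2 * pi * N + Q * degree G * C)"
  have B0: "B \<ge> 0" using P Q C by (simp add: B_def)
  have cd: "?D z \<noteq> 0" if "z \<noteq> 0" for z
  proof -
    have "(norm (poly G z))\<^sup>2 + (norm (poly (monom 1 N) z))\<^sup>2 > 0"
      using that by (intro add_nonneg_pos) (auto simp: poly_monom)
    then show ?thesis unfolding cden_eq by (metis less_irrefl of_real_eq_0_iff)
  qed
  have uint: "(\<lambda>\<theta>. ?u (rcis r \<theta>)) integrable_on {0..2 * pi}" if r: "r > 0" for r
  proof -
    have subn: "rcis r ` {0..2 * pi} \<subseteq> - {0}" using r by auto
    have rc: "continuous_on {0..2 * pi} (\<lambda>\<theta>. rcis r \<theta>)"
      unfolding rcis_def cis_conv_exp by (intro continuous_intros)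
    have "continuous_on {0..2 * pi} (\<lambda>\<theta>. ?u (rcis r \<theta>))"
    proof -
      have "continuous_on (- {0}) (?u)" by (rule continuous_on_cquot_derivs(1)) (use cd in auto)
      then show ?thesis by (rule continuous_on_compose2[OF _ rc subn])
    qed
    then show ?thesis by (rule integrable_continuous_interval)
  qed
  have A1: "norm (A 1) \<le> 2 * pi * (Q + P)"
  proof -
    have "norm (A 1) \<le> integral {0..2 * pi} (\<lambda>\<theta>. Q + P)"
      unfolding A_def
      by (intro integral_norm_bound_integral uint cquot_norm_bound) auto
    then show ?thesis by simp
  qed
  have Adiff: "norm (A r - A 1) \<le> B" if r: "0 < r" "r \<le> 1" for r
  proof -
    have "norm (A r - A 1) \<le> B * \<bar>r - 1\<bar>"
    proof (rule vector_derivative_norm_bound[where S="{r..1}"])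
      fix s assume s: "s \<in> {r..1}"
      show "(A has_vector_derivative integral {0..2 * pi} (\<lambda>\<theta>. 2 * cis (- \<theta>) * cquot_dbar G H (monom 1 N) k (rcis s \<theta>))) (at s within {r..1})"
        unfolding A_def[abs_def] using circle_mean_has_vector_derivative[OF cd r(1) s] .
      show "norm (integral {0..2 * pi} (\<lambda>\<theta>. 2 * cis (- \<theta>) * cquot_dbar G H (monom 1 N) k (rcis s \<theta>))) \<le> B"
        unfolding B_def using s r
        by (intro cquot_dbar_circle_integral_bound[OF _ _ G0]) auto
    qed (use r in auto)
    also have "\<dots> \<le> B * 1" using r B0 by (intro mult_left_mono) auto
    finally show ?thesis by simp
  qed
  obtain Tm where Tm: "\<And>z. norm z \<le> 1 \<Longrightarrow> norm (poly T z) \<le> Tm" and Tm0: "Tm > 0"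
  proof -
    have "compact (poly T ` cball 0 1)" by (intro compact_continuous_image continuous_intros compact_cball)
    then obtain b where "b > 0" "\<forall>w\<in>poly T ` cball 0 1. norm w \<le> b"
      using compact_imp_bounded bounded_pos by blast
    then show ?thesis using that[of b] by simp
  qed
  define g0 where "g0 = norm (poly G 0) / 2"
  have g0: "g0 > 0" using G0 by (simp add: g0_def)
  obtain \<rho> where \<rho>: "\<rho> > 0" "\<And>z. norm z < \<rho> \<Longrightarrow> norm (poly G z) \<ge> g0"
  proof -
    have "isCont (poly G) 0" by (intro continuous_intros)
    then obtain d where d: "d > 0" "\<And>z. dist z 0 < d \<Longrightarrow> dist (poly G z) (poly G 0) < g0"
      using g0 unfolding continuous_at_eps_delta by blast
    have "norm (poly G z) \<ge> g0" if "norm z < d" for z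
    proof -
      have "norm (poly G z - poly G 0) < g0" using d(2)[of z] that by (simp add: dist_norm)
      moreover have "norm (poly G 0) \<le> norm (poly G z) + norm (poly G z - poly G 0)"
        by (metis norm_triangle_sub norm_minus_commute)
      ultimately show ?thesis by (simp add: g0_def)
    qed
    then show ?thesis using that d(1) by blast
  qed
  have c0: "c \<ge> 0" using order_trans[OF norm_ge_zero T[of 1]] by simp
  define K where "K = c / g0 + Tm / g0\<^sup>2"
  have K0: "K \<ge> 0" using c0 Tm0 g0 by (simp add: K_def)
  \<comment> \<open>The difference is \<open>cnj G * (H - G * T) - T * E * cnj E\<close> over
    \<open>cden * z^k\<close>. Both terms of the numerator are of order \<open>r ^ (k + 1)\<close>,
    the second because \<open>2 * N \<ge> k + 1\<close>, and the denominator is at least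
    \<open>g0\<^sup>2 * r ^ k\<close>.\<close>
  have near: "norm (?u z - poly T z / z ^ k) \<le> K * norm z" if z: "z \<noteq> 0" "norm z < \<rho>" "norm z \<le> 1" for z
  proof -
    define a where "a = norm (poly G z)"
    let ?ee = "poly (monom 1 N) z * cnj (poly (monom 1 N) z)"
    let ?num = "cnj (poly G z) * (poly H z - poly G z * poly T z) - poly T z * ?ee"
    have a: "a \<ge> g0" using \<rho>(2) z by (simp add: a_def)
    have a0: "a > 0" using a g0 by simp
    define r where "r = norm z"
    have r: "r > 0" "r \<le> 1" using z by (auto simp: r_def)
    have D: "?D z \<noteq> 0" by (rule cd[OF z(1)])
    have nD: "norm (?D z) = a\<^sup>2 + (r ^ N)\<^sup>2"
      unfolding cden_eq norm_of_real by (simp add: a_def r_def poly_monom norm_power)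
    have "?u z - poly T z / z ^ k = (poly H z * cnj (poly G z) - poly T z * ?D z) / (?D z * z ^ k)"
      using D z(1) by (simp add: cquot_def poly_monom field_simps)
    also have "poly H z * cnj (poly G z) - poly T z * ?D z
       = ?num"
      by (simp add: cden_def algebra_simps)
    finally have "norm (?u z - poly T z / z ^ k) = norm (?num) / ((a\<^sup>2 + (r ^ N)\<^sup>2) * r ^ k)"
      by (simp add: norm_divide norm_mult nD norm_power r_def)
    also have "\<dots> \<le> (a * (c * r ^ (k + 1)) + Tm * r ^ (k + 1)) / (a\<^sup>2 * r ^ k)"
    proof (rule frac_le)
      have "norm (cnj (poly G z) * (poly H z - poly G z * poly T z)) \<le> a * (c * r ^ (k + 1))"
        unfolding norm_mult using T[of z] z by (intro mult_mono) (auto simp: a_def r_def)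
      moreover have "norm (poly T z * ?ee) \<le> Tm * r ^ (k + 1)"
      proof -
        have "k + 1 \<le> 2 * N" using j N by (cases j) auto
        then have "r ^ (2 * N) \<le> r ^ (k + 1)" using r by (intro power_decreasing) auto
        then show ?thesis unfolding norm_mult using Tm[of z] z Tm0
          by (intro mult_mono) (auto simp: poly_monom norm_power r_def mult_2 power_add norm_mult)
      qed
      ultimately show "norm (?num) \<le> a * (c * r ^ (k + 1)) + Tm * r ^ (k + 1)"
        by (rule order_trans[OF norm_triangle_ineq4 add_mono])
    qed (use a0 r c0 Tm0 in \<open>auto intro!: add_nonneg_nonneg mult_right_mono\<close>)
    also have "\<dots> = (c / a + Tm / a\<^sup>2) * r"
      using a0 r by (simp add: field_simps power2_eq_square)
    also have "\<dots> \<le> K * r"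
      unfolding K_def using a g0 r c0 Tm0 by (intro mult_right_mono add_mono divide_left_mono power_mono mult_pos_pos zero_less_power) auto
    finally show ?thesis by (simp add: r_def)
  qed
  have Tint: "((\<lambda>\<theta>. ?t r \<theta>) has_integral (2 * pi * coeff T k)) {0..2 * pi}" if r: "r > 0" for r
  proof -
    have "((\<lambda>\<theta>. \<Sum>i\<le>degree T. coeff T i * (rcis r \<theta> ^ i / rcis r \<theta> ^ k)) has_integral
       (\<Sum>i\<le>degree T. coeff T i * (if i = k then 2 * pi else 0))) {0..2 * pi}"
      by (intro has_integral_sum has_integral_mult_right integral_rcis_power_quotient r) auto
    also have "(\<Sum>i\<le>degree T. coeff T i * (if i = k then 2 * pi else 0)) = 2 * pi * coeff T k"
    proof -
      have "(\<Sum>i\<le>degree T. coeff T i * (if i = k then 2 * pi else 0)) = (\<Sum>i\<le>degree T. if i = k then 2 * pi * coeff T k else 0)"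
        by (intro sum.cong) auto
      then show ?thesis by (simp add: sum.delta' coeff_eq_0)
    qed
    finally show ?thesis by (simp add: poly_altdef sum_divide_distrib)
  qed
  have fin: "norm (2 * pi * coeff T k) \<le> 2 * pi * (Q + P) + B + 2 * pi * K * r"
    if r: "0 < r" "r < \<rho>" "r \<le> 1" for r
  proof -
    have "norm (integral {0..2 * pi} (\<lambda>\<theta>. ?u (rcis r \<theta>) - ?t r \<theta>)) \<le> integral {0..2 * pi} (\<lambda>\<theta>. K * r)"
    proof (rule integral_norm_bound_integral)
      show "(\<lambda>\<theta>. ?u (rcis r \<theta>) - ?t r \<theta>) integrable_on {0..2 * pi}"
        by (intro integrable_diff uint r has_integral_integrable[OF Tint[OF r(1)]])
      show "norm (?u (rcis r \<theta>) - ?t r \<theta>) \<le> K * r" for \<theta>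
        using near[of "rcis r \<theta>"] r by simp
    qed auto
    moreover have "integral {0..2 * pi} (\<lambda>\<theta>. ?u (rcis r \<theta>) - ?t r \<theta>) = A r - 2 * pi * coeff T k"
      using integral_diff[OF uint[OF r(1)] has_integral_integrable[OF Tint[OF r(1)]]] integral_unique[OF Tint[OF r(1)]]
      by (simp add: A_def)
    ultimately have "norm (A r - 2 * pi * coeff T k) \<le> 2 * pi * K * r" by (simp add: mult_ac)
    moreover have "norm (2 * pi * coeff T k) \<le> norm (A 1) + norm (A r - A 1) + norm (A r - 2 * pi * coeff T k)"
      by (smt (verit, best) norm_triangle_sub norm_minus_commute)
    ultimately show ?thesis using A1 Adiff[of r] r by simp
  qed
  \<comment> \<open>The constant \<open>K\<close> may be huge, as it involves \<open>1 / g0\<close>,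
    but it comes with the factor \<open>r\<close> and disappears in the limit.\<close>
  have "norm (2 * pi * coeff T k) \<le> 2 * pi * (Q + P) + B"
  proof (rule field_le_epsilon)
    fix e :: real assume e: "e > 0"
    define r where "r = min (min (\<rho> / 2) 1) (e / (2 * pi * K + 1))"
    have d: "2 * pi * K + 1 > 0" using K0 by (simp add: add_nonneg_pos)
    have "e / (2 * pi * K + 1) > 0" using e d by simp
    then have "0 < r" using \<rho>(1) by (simp add: r_def)
    moreover have "r \<le> \<rho> / 2" "r \<le> 1" unfolding r_def by linarith+
    ultimately have r: "0 < r" "r < \<rho>" "r \<le> 1" using \<rho>(1) by linarith+
    have "r \<le> e / (2 * pi * K + 1)" by (simp add: r_def)
    then have "(2 * pi * K + 1) * r \<le> e" using d by (simp add: pos_le_divide_eq mult.commute)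
    then have "2 * pi * K * r \<le> e" using r by (simp add: distrib_right)
    then show "norm (2 * pi * coeff T k) \<le> 2 * pi * (Q + P) + B + e" using fin[OF r] by linarith
  qed
  then have "2 * pi * norm (coeff T k) \<le> 2 * pi * (Q + P) + B" by (simp add: norm_mult)
  also have "B = 2 * pi * ((1 + P) * (2 * N + Q * degree G * C / pi))"
    by (simp add: B_def field_simps)
  finally have "2 * pi * norm (coeff T k) \<le> 2 * pi * (Q + P + (1 + P) * (2 * N + Q * degree G * C / pi))"
    by (simp add: distrib_left)
  then have 1: "norm (coeff T k) \<le> Q + P + (1 + P) * (2 * N + Q * degree G * C / pi)"
    by (rule mult_left_le_imp_le) simp
  have "Q * degree G * C / pi \<le> Q * degree G * C / 1"
    using Q C pi_gt3 by (intro divide_left_mono) auto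
  then have "(1 + P) * (2 * N + Q * degree G * C / pi) \<le> (1 + P) * (2 * N + Q * degree G * C)"
    using P by (intro mult_left_mono) auto
  then show ?thesis using 1 by linarith
qed

end

section \<open>From polynomials to power series: truncation, perturbation and scaling\<close>

lemma mult_ge_one: "1 \<le> a \<Longrightarrow> 1 \<le> b \<Longrightarrow> 1 \<le> a * b" for a b :: real
  using mult_mono[of 1 a 1 b] by simp

lemma add_power_ge:
  fixes x y :: real
  assumes "x \<ge> 0" "y \<ge> 0" "j \<ge> 1"
  shows "x ^ j + y ^ j \<le> (x + y) ^ j"
  using \<open>j \<ge> 1\<close>
proof (induction j rule: dec_induct)
  case (step j)
  have "x ^ Suc j + y ^ Suc j \<le> (x + y) * (x ^ j + y ^ j)"
    using assms by (simp add: algebra_simps)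
  also have "\<dots> \<le> (x + y) * (x + y) ^ j" using step assms by (intro mult_left_mono) auto
  finally show ?case by simp
qed simp

text \<open>Since \<open>x ^ j + y ^ j \<le> (x + y) ^ j\<close>, a j-th root may be taken of both
  summands separately. The order of the error drops from \<open>j * m\<close> to \<open>m\<close>,
  the source of the factor \<open>j\<close> in \<open>cusp_order\<close>.\<close>

lemma cusp_relation_root:
  fixes w v :: complex and j m :: nat
  assumes j: "j \<ge> 1" and P: "P \<ge> 1" and r: "r \<ge> 0"
    and le: "norm (w ^ j - v ^ (j + 1)) \<le> P * r ^ (j * m)"
  shows "norm w \<le> norm v * norm v powr (1 / j) + P * r ^ m"
proof -
  let ?a = "norm v"
  have "norm w ^ j \<le> norm (v ^ (j + 1)) + norm (w ^ j - v ^ (j + 1))"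
    by (metis norm_power norm_triangle_sub)
  also have "\<dots> \<le> ?a ^ (j + 1) + P * r ^ (j * m)" using le by (simp add: norm_power norm_mult)
  also have "?a ^ (j + 1) = (?a * ?a powr (1 / j)) ^ j"
  proof -
    have "(?a powr (1 / j)) ^ j = ?a"
      using j by (cases "?a = 0") (auto simp: powr_powr simp flip: powr_realpow)
    then show ?thesis by (simp add: power_mult_distrib)
  qed
  also have "P * r ^ (j * m) \<le> (P * r ^ m) ^ j"
  proof -
    have "P ^ 1 \<le> P ^ j" using P j by (intro power_increasing) auto
    then show ?thesis using r by (simp add: power_mult_distrib power_mult mult_right_mono mult.commute[of j])
  qed
  also have "(?a * ?a powr (1 / j)) ^ j + (P * r ^ m) ^ j \<le> (?a * ?a powr (1 / j) + P * r ^ m) ^ j"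
    using P r j by (intro add_power_ge) auto
  finally have "norm w ^ j \<le> (?a * ?a powr (1 / j) + P * r ^ m) ^ j" by simp
  then show ?thesis using P r j by (subst (asm) power_mono_iff) auto
qed

lemma pderiv_sum: "pderiv (\<Sum>i\<in>A. f i) = (\<Sum>i\<in>A. pderiv (f i))" for f :: "'b \<Rightarrow> complex poly"
  by (induction A rule: infinite_finite_induct) (simp_all add: pderiv_add)

text \<open>Equals \<open>j * (2 * N + (k + 1))\<close> for \<open>N = 2 * j * (k + 1)\<close>: the
  number of known coefficients that is spent on bounding the coefficient of index
  \<open>k\<close>.\<close>

definition cusp_order :: "nat \<Rightarrow> nat \<Rightarrow> nat" where
  "cusp_order j k = j * (4 * j + 1) * (k + 1)"

definition cusp_coeffs_le :: "nat \<Rightarrow> nat \<Rightarrow> (nat \<Rightarrow> real) \<Rightarrow> complex fps \<Rightarrow> bool" where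
  "cusp_coeffs_le j k c F \<longleftrightarrow>
     (\<forall>i\<le>cusp_order j k. norm (fps_nth (F ^ j) i) \<le> c i \<and> norm (fps_nth (F ^ (j + 1)) i) \<le> c i)"

lemma poly_sum_monom_eq_fps_trunc: "poly (\<Sum>i\<le>n. monom (fps_nth A i) i) z = fps_trunc n A z"
  by (simp add: poly_sum poly_monom fps_trunc_def)

lemma degree_sum_monom_le: "degree (\<Sum>i\<le>n. monom (c i) i) \<le> n"
  by (intro degree_sum_le) (auto intro: order_trans[OF degree_monom_le])

lemma coeff_sum_monom: "k \<le> n \<Longrightarrow> coeff (\<Sum>i\<le>n. monom (c i) i) k = c k"
  by (simp add: coeff_sum coeff_monom sum.delta')

text \<open>The nonzero constant term makes the truncation of \<open>F ^ j\<close> nonzero at the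
  origin, as \<open>cusp_coeff_bound\<close> requires, but its size does not enter \<open>W\<close>.
  The coefficient bound is 2 rather than 1 in order to leave room for a perturbation of
  \<open>F\<close>.\<close>

lemma fps_cusp_coeff_poly_bound:
  fixes j :: nat
  assumes j: "j \<ge> 1"
  obtains W where "W \<ge> 1" "\<And>(F :: complex fps) k. fps_nth F 0 \<noteq> 0 \<Longrightarrow>
      cusp_coeffs_le j k (\<lambda>_. 2) F \<Longrightarrow>
      norm (fps_nth F k) \<le> W * (real (cusp_order j k) + 1) ^ (j + 6)"
proof -
  have "0 < 1 - 1 / (2 * real j)" "1 - 1 / (2 * real j) < 1" using j by (auto simp: divide_simps)
  from circle_powr_integral[OF this]
  obtain C where C: "C \<ge> 0" "\<And>r. r > 0 \<Longrightarrow> circle_dominated (1 - 1 / (2 * j)) C r"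
    unfolding of_nat_mult of_nat_numeral by metis
  \<comment> \<open>Collects the constants of the two truncation errors below, with exponents
    \<open>j\<close> and \<open>j + 1\<close> and coefficient bound 2.\<close>
  define p where "p = (2 * real j + 1) * 2 ^ (j + 1)"
  have p: "p \<ge> 1" unfolding p_def using j by (intro mult_ge_one one_le_power) auto
  define W where "W = 2 + p + (1 + p) * (2 + 2 * C)"
  have W: "W \<ge> 1" using p C by (simp add: W_def add_nonneg_nonneg)
  show ?thesis
  proof (rule that[OF W])
    fix F :: "complex fps" and k
    assume F0: "fps_nth F 0 \<noteq> 0"
      and F: "cusp_coeffs_le j k (\<lambda>_. 2) F"
    define n N where "n = cusp_order j k" and "N = 2 * j * (k + 1)"
    have n: "n = j * (2 * N + (k + 1))" by (simp add: n_def cusp_order_def N_def algebra_simps)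
    have jl: "1 * x \<le> j * x" for x using j by (intro mult_right_mono) auto
    have nk: "N \<le> n" "k + 1 \<le> n" using jl[of "2 * N + (k + 1)"] n by auto
    define s where "s = real n + 1"
    have s: "s \<ge> 1" by (simp add: s_def)
    define P Q where "P = p * s ^ (j + 3)" and "Q = 2 * s\<^sup>2"
    have s1: "s ^ i \<ge> 1" for i using s by simp
    have P: "P \<ge> 1" unfolding P_def using p s1 by (intro mult_ge_one) auto
    have Q: "Q \<ge> 1" unfolding Q_def using s1[of 2] by simp
    define G where "G = (\<Sum>i\<le>n. monom (fps_nth (F ^ j) i) i)"
    define H where "H = (\<Sum>i\<le>n. monom (fps_nth (F ^ (j + 1)) i) i)"
    define T where "T = (\<Sum>i\<le>n. monom (fps_nth F i) i)"
    have GHT: "poly G z = fps_trunc n (F ^ j) z" "poly H z = fps_trunc n (F ^ (j + 1)) z" "poly T z = fps_trunc n F z" for z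
      by (simp_all add: G_def H_def T_def poly_sum_monom_eq_fps_trunc)
    have F1: "norm (fps_nth (F ^ j) i) \<le> 2" and F2: "norm (fps_nth (F ^ (j + 1)) i) \<le> 2" if "i \<le> n" for i
      using F that unfolding cusp_coeffs_le_def n_def by blast+
    \<comment> \<open>The powers \<open>H ^ j\<close> and \<open>G ^ (j + 1)\<close> of the
      truncations are both close to the truncation of \<open>F ^ (j * (j + 1))\<close>, hence to
      each other.\<close>
    have h1: "norm (poly H z) \<le> norm (poly G z) * norm (poly G z) powr (1 / j) + P * norm z ^ (2 * N + (k + 1))"
      if z: "norm z \<le> 1" for z
    proof (rule cusp_relation_root[OF j P norm_ge_zero])
      let ?X = "fps_trunc n (F ^ (j * (j + 1))) z"
      have e: "(F ^ (j + 1)) ^ j = F ^ (j * (j + 1))" "(F ^ j) ^ (j + 1) = F ^ (j * (j + 1))"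
        by (simp_all only: power_mult[symmetric] mult.commute)
      have "norm (poly H z ^ j - ?X) \<le> real j * s ^ (j + 2) * 2 ^ j * norm z ^ (n + 1)"
        unfolding GHT e(1)[symmetric] s_def by (rule fps_trunc_power[OF F2 z])
      moreover have "norm (poly G z ^ (j + 1) - ?X) \<le> real (j + 1) * s ^ (j + 1 + 2) * 2 ^ (j + 1) * norm z ^ (n + 1)"
        unfolding GHT e(2)[symmetric] s_def by (rule fps_trunc_power[OF F1 z])
      ultimately have "norm (poly H z ^ j - poly G z ^ (j + 1)) \<le>
         real j * s ^ (j + 2) * 2 ^ j * norm z ^ (n + 1) + real (j + 1) * s ^ (j + 1 + 2) * 2 ^ (j + 1) * norm z ^ (n + 1)"
        by (rule norm_diff_triangle_le[OF _ _, of _ ?X, unfolded norm_minus_commute[of ?X]])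
      also have "\<dots> \<le> real j * s ^ (j + 3) * 2 ^ (j + 1) * norm z ^ (n + 1) + real (j + 1) * s ^ (j + 3) * 2 ^ (j + 1) * norm z ^ (n + 1)"
      proof (intro add_mono mult_right_mono)
        have "s ^ (j + 2) \<le> s ^ (j + 3)" "(2::real) ^ j \<le> 2 ^ (j + 1)" using s by (intro power_increasing; simp)+
        then show "real j * s ^ (j + 2) * 2 ^ j \<le> real j * s ^ (j + 3) * 2 ^ (j + 1)"
          using s by (intro mult_mono) auto
        show "real (j + 1) * s ^ (j + 1 + 2) \<le> real (j + 1) * s ^ (j + 3)" by (simp add: numeral_3_eq_3)
      qed auto
      also have "\<dots> = P * norm z ^ (n + 1)" by (simp add: P_def p_def algebra_simps)
      also have "\<dots> \<le> P * norm z ^ (j * (2 * N + (k + 1)))"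
        using P z n by (intro mult_left_mono power_decreasing) auto
      finally show "norm (poly H z ^ j - poly G z ^ (j + 1)) \<le> P * norm z ^ (j * (2 * N + (k + 1)))" .
    qed
    have h2: "norm (poly G z) \<le> Q" if z: "norm z \<le> 1" for z
    proof -
      have "norm (poly G z) \<le> s * 2" unfolding GHT s_def by (rule norm_fps_trunc_le[OF F1 z])
      also have "\<dots> \<le> Q" using s by (simp add: Q_def power2_eq_square)
      finally show ?thesis .
    qed
    have h3: "norm (poly (pderiv G) z) \<le> Q" if z: "norm z \<le> 1" for z
    proof -
      have "poly (pderiv G) z = (\<Sum>i\<le>n. of_nat i * fps_nth (F ^ j) i * z ^ (i - 1))"
        by (simp add: G_def pderiv_sum pderiv_monom poly_sum poly_monom)
      also have "norm \<dots> \<le> (\<Sum>i\<le>n. s * 2)"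
      proof (rule sum_norm_le)
        fix i assume i: "i \<in> {..n}"
        have "norm (of_nat i * fps_nth (F ^ j) i * z ^ (i - 1)) = real i * norm (fps_nth (F ^ j) i) * norm z ^ (i - 1)"
          by (simp add: norm_mult norm_power)
        also have "\<dots> \<le> s * 2 * 1" using i z F1[of i] by (intro mult_mono power_le_one) (auto simp: s_def)
        finally show "norm (of_nat i * fps_nth (F ^ j) i * z ^ (i - 1)) \<le> s * 2" by simp
      qed
      also have "\<dots> = Q" by (simp add: Q_def s_def power2_eq_square algebra_simps)
      finally show ?thesis .
    qed
    \<comment> \<open>This bound involves the unknown coefficients of \<open>F\<close>. That is
      harmless, because it enters only the constant \<open>c\<close> of
      \<open>cusp_coeff_bound\<close>, which is absent from the result.\<close>
    define b where "b = (\<Sum>i\<le>n. norm (fps_nth F i))"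
    have b: "norm (fps_nth F i) \<le> b" if "i \<le> n" for i
      unfolding b_def by (rule member_le_sum) (use that in auto)
    have b0: "b \<ge> 0" unfolding b_def by (intro sum_nonneg) auto
    have h4: "norm (poly H z - poly G z * poly T z) \<le> s\<^sup>2 * (2 * b) * norm z ^ (k + 1)" if z: "norm z \<le> 1" for z
    proof -
      have "norm (poly G z * poly T z - poly H z) \<le> s\<^sup>2 * (2 * b) * norm z ^ (n + 1)"
        using fps_trunc_mult[OF F1 b z] by (simp add: GHT s_def mult.commute[of F])
      also have "\<dots> \<le> s\<^sup>2 * (2 * b) * norm z ^ (k + 1)"
        using nk z b0 by (intro mult_left_mono power_decreasing) auto
      finally show ?thesis by (simp add: norm_minus_commute)
    qed
    have g0: "poly G 0 \<noteq> 0"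
    proof -
      have "poly G 0 = coeff G 0" by (simp add: poly_0_coeff_0)
      also have "\<dots> = fps_nth (F ^ j) 0" unfolding G_def by (rule coeff_sum_monom) simp
      finally show ?thesis using F0 by simp
    qed
    have bd: "norm (coeff T k) \<le> Q + P + (1 + P) * (2 * N + Q * degree G * C)"
      using P by (intro cusp_coeff_bound[OF j _ Q N_def h1 h2 h3 C g0 h4]) auto
    have Tk: "coeff T k = fps_nth F k" unfolding T_def using nk by (intro coeff_sum_monom) simp
    have "degree G \<le> n" unfolding G_def by (rule degree_sum_monom_le)
    then have "Q * degree G \<le> Q * s" using Q by (intro mult_left_mono) (auto simp: s_def)
    define q where "q = Q * degree G"
    have q: "q \<le> 2 * s ^ 3"
      using \<open>Q * degree G \<le> Q * s\<close> by (simp add: q_def Q_def power2_eq_square power3_eq_cube)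
    have q0: "q \<ge> 0" using Q by (simp add: q_def)
    have "Q + P + (1 + P) * (2 * N + q * C)
       \<le> 2 * s ^ (j + 6) + p * s ^ (j + 6) + (s ^ (j + 3) + p * s ^ (j + 3)) * (2 * s ^ 3 + 2 * s ^ 3 * C)"
    proof (intro add_mono mult_mono)
      show "Q \<le> 2 * s ^ (j + 6)" unfolding Q_def using s by (intro mult_left_mono power_increasing) auto
      show "P \<le> p * s ^ (j + 6)" unfolding P_def using s p by (intro mult_left_mono power_increasing) auto
      show "1 \<le> s ^ (j + 3)" by (rule s1)
      show "P \<le> p * s ^ (j + 3)" by (simp add: P_def)
      have "s ^ 1 \<le> s ^ 3" using s by (intro power_increasing) auto
      then show "real (2 * N) \<le> 2 * s ^ 3" using nk by (simp add: s_def)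
    qed (use C(1) s p Q q q0 in auto)
    also have "\<dots> = W * s ^ (j + 6)"
      by (simp add: W_def algebra_simps power_add power_numeral_reduce)
    finally show "norm (fps_nth F k) \<le> W * (real (cusp_order j k) + 1) ^ (j + 6)"
      using bd unfolding Tk q_def s_def n_def by linarith
  qed
qed

lemma tendsto_fps_nth_power_add_const:
  fixes F :: "complex fps"
  shows "((\<lambda>e. fps_nth ((F + fps_const e) ^ p) i) \<longlongrightarrow> fps_nth (F ^ p) i) (at 0)"
proof (induction p arbitrary: i)
  case (Suc p)
  have 1: "((\<lambda>e. fps_nth (F + fps_const e) l) \<longlongrightarrow> fps_nth F l) (at 0)" for l
  proof -
    have "((\<lambda>e. fps_nth F l + e) \<longlongrightarrow> fps_nth F l + 0) (at 0)" by (intro tendsto_intros)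
    then show ?thesis by (cases "l = 0") simp_all
  qed
  have "((\<lambda>e. \<Sum>l=0..i. fps_nth (F + fps_const e) l * fps_nth ((F + fps_const e) ^ p) (i - l))
      \<longlongrightarrow> (\<Sum>l=0..i. fps_nth F l * fps_nth (F ^ p) (i - l))) (at 0)"
    by (intro tendsto_intros 1 Suc)
  then show ?case by (simp only: power_Suc fps_mult_nth)
qed simp

text \<open>A polynomial in \<open>k\<close> is absorbed in \<open>B ^ (k + 1)\<close>. A vanishing
  constant term is removed by passing to \<open>F + fps_const e\<close> and letting \<open>e\<close>
  tend to \<open>0\<close>; for fixed \<open>k\<close> only finitely many coefficients are
  concerned, and they depend continuously on \<open>e\<close>.\<close>

lemma fps_cusp_coeff_exp_bound:
  fixes j :: nat
  assumes j: "j \<ge> 1"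
  obtains B where "B \<ge> 1" "\<And>(F :: complex fps) k.
      cusp_coeffs_le j k (\<lambda>_. 1) F \<Longrightarrow>
      norm (fps_nth F k) \<le> B ^ (k + 1)"
proof -
  obtain W where W: "W \<ge> 1" "\<And>(F :: complex fps) k. fps_nth F 0 \<noteq> 0 \<Longrightarrow>
      cusp_coeffs_le j k (\<lambda>_. 2) F \<Longrightarrow>
      norm (fps_nth F k) \<le> W * (real (cusp_order j k) + 1) ^ (j + 6)"
    using fps_cusp_coeff_poly_bound[OF j] by metis
  define c where "c = 2 * (real (j * (4 * j + 1)) + 1)"
  have c: "c \<ge> 1" by (simp add: c_def)
  define B where "B = W * c ^ (j + 6)"
  have B: "B \<ge> 1" unfolding B_def using W(1) c by (intro mult_ge_one) auto
  have WB: "W * (real (cusp_order j k) + 1) ^ (j + 6) \<le> B ^ (k + 1)" for k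
  proof -
    have k2: "real k + 1 \<le> 2 ^ k"
      using of_nat_less_two_power[of k, where ?'a=real] by (metis Suc_leI less_exp of_nat_Suc of_nat_le_iff of_nat_numeral of_nat_power add.commute)
    have "real (cusp_order j k) + 1 \<le> (real (j * (4 * j + 1)) + 1) * (real k + 1)"
      by (simp add: cusp_order_def algebra_simps)
    also have "\<dots> \<le> (real (j * (4 * j + 1)) + 1) ^ (k + 1) * 2 ^ (k + 1)"
    proof (rule mult_mono)
      show "real (j * (4 * j + 1)) + 1 \<le> (real (j * (4 * j + 1)) + 1) ^ (k + 1)"
        using self_le_power[of "real (j * (4 * j + 1)) + 1" "k + 1"] by simp
      show "real k + 1 \<le> 2 ^ (k + 1)" using k2 by simp
    qed auto
    also have "\<dots> = c ^ (k + 1)" unfolding c_def by (simp only: power_mult_distrib mult.commute)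
    finally have "(real (cusp_order j k) + 1) ^ (j + 6) \<le> (c ^ (k + 1)) ^ (j + 6)" by (intro power_mono) auto
    moreover have "W \<le> W ^ (k + 1)" using self_le_power[of W "k + 1"] W(1) by simp
    ultimately have "W * (real (cusp_order j k) + 1) ^ (j + 6) \<le> W ^ (k + 1) * (c ^ (k + 1)) ^ (j + 6)"
      using W(1) by (intro mult_mono) auto
    also have "(c ^ (k + 1)) ^ (j + 6) = (c ^ (j + 6)) ^ (k + 1)" by (simp only: power_mult[symmetric] mult.commute)
    also have "W ^ (k + 1) * (c ^ (j + 6)) ^ (k + 1) = B ^ (k + 1)" by (simp only: B_def power_mult_distrib)
    finally show ?thesis .
  qed
  show ?thesis
  proof (rule that[OF B])
    fix F :: "complex fps" and k
    assume "cusp_coeffs_le j k (\<lambda>_. 1) F"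
    then have F: "norm (fps_nth (F ^ j) i) \<le> 1" "norm (fps_nth (F ^ (j + 1)) i) \<le> 1" if "i \<le> cusp_order j k" for i
      using that unfolding cusp_coeffs_le_def by blast+
    show "norm (fps_nth F k) \<le> B ^ (k + 1)"
    proof (cases "fps_nth F 0 = 0")
      case False
      have "norm (fps_nth F k) \<le> W * (real (cusp_order j k) + 1) ^ (j + 6)"
        by (rule W(2)[OF False]) (unfold cusp_coeffs_le_def, use F in \<open>force intro: order_trans\<close>)
      then show ?thesis using WB[of k] by simp
    next
      case True
      \<comment> \<open>The bound 1 at \<open>e = 0\<close> is strictly below 2, so 2 persists for
        small \<open>e\<close>.\<close>
      have ev: "\<forall>\<^sub>F e in at 0. \<forall>i\<in>{..cusp_order j k}. norm (fps_nth ((F + fps_const e) ^ p) i) \<le> 2"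
        if "\<And>i. i \<le> cusp_order j k \<Longrightarrow> norm (fps_nth (F ^ p) i) \<le> 1" for p
      proof (rule eventually_ball_finite)
        show "\<forall>i\<in>{..cusp_order j k}. \<forall>\<^sub>F e in at 0. norm (fps_nth ((F + fps_const e) ^ p) i) \<le> 2"
        proof safe
        fix i assume i: "i \<le> cusp_order j k"
        have "((\<lambda>e. norm (fps_nth ((F + fps_const e) ^ p) i)) \<longlongrightarrow> norm (fps_nth (F ^ p) i)) (at 0)"
          by (intro tendsto_intros tendsto_fps_nth_power_add_const)
        moreover have "norm (fps_nth (F ^ p) i) < 2" using that[OF i] by simp
        ultimately have "\<forall>\<^sub>F e in at 0. norm (fps_nth ((F + fps_const e) ^ p) i) < 2" by (rule order_tendstoD(2))
        then show "\<forall>\<^sub>F e in at 0. norm (fps_nth ((F + fps_const e) ^ p) i) \<le> 2"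
          by (rule eventually_mono) simp
        qed
      qed simp
      have nz: "\<forall>\<^sub>F e in at (0::complex). e \<noteq> 0" by (rule eventually_neq_at_within)
      have "\<forall>\<^sub>F e in at 0. \<forall>i\<in>{..cusp_order j k}. norm (fps_nth ((F + fps_const e) ^ j) i) \<le> 2"
        "\<forall>\<^sub>F e in at 0. \<forall>i\<in>{..cusp_order j k}. norm (fps_nth ((F + fps_const e) ^ (j + 1)) i) \<le> 2"
        by (rule ev, erule F)+
      then have "\<forall>\<^sub>F e in at 0. norm (fps_nth (F + fps_const e) k) \<le> B ^ (k + 1)"
        using nz
      proof eventually_elim
        case (elim e)
        have "norm (fps_nth (F + fps_const e) k) \<le> W * (real (cusp_order j k) + 1) ^ (j + 6)"
          by (rule W(2)) (use elim True in \<open>auto simp: cusp_coeffs_le_def\<close>)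
        then show ?case using WB[of k] by simp
      qed
      moreover have "((\<lambda>e. norm (fps_nth (F + fps_const e) k)) \<longlongrightarrow> norm (fps_nth F k)) (at 0)"
        using tendsto_norm[OF tendsto_fps_nth_power_add_const[of F 1 k]] by simp
      ultimately show ?thesis by (intro tendsto_upperbound) auto
    qed
  qed
qed

text \<open>Scaling: the normalised bound is applied to \<open>F (z / \<tau>) / K\<close>. Its p-th
  power carries the factor \<open>1 / K ^ p\<close>, and \<open>K \<le> K ^ p\<close> because
  \<open>K \<ge> 1\<close>.\<close>

lemma fps_cusp_coeff_bound:
  fixes j :: nat
  assumes j: "j \<ge> 1"
  obtains B where "B \<ge> 1" "\<And>(F :: complex fps) k K \<tau>. K \<ge> 1 \<Longrightarrow> \<tau> > 0 \<Longrightarrow>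
      cusp_coeffs_le j k (\<lambda>i. K * \<tau> ^ i) F \<Longrightarrow>
      norm (fps_nth F k) \<le> K * \<tau> ^ k * B ^ (k + 1)"
proof -
  obtain B where B: "B \<ge> 1" "\<And>(F :: complex fps) k.
      cusp_coeffs_le j k (\<lambda>_. 1) F \<Longrightarrow>
      norm (fps_nth F k) \<le> B ^ (k + 1)"
    using fps_cusp_coeff_exp_bound[OF j] by metis
  show ?thesis
  proof (rule that[OF B(1)])
    fix F :: "complex fps" and k :: nat and K \<tau> :: real
    assume K: "K \<ge> 1" and l: "\<tau> > 0"
      and F: "cusp_coeffs_le j k (\<lambda>i. K * \<tau> ^ i) F"
    define F' where "F' = fps_const (1 / of_real K) * (F oo (fps_const (1 / of_real \<tau>) * fps_X))"
    have nth: "fps_nth (F' ^ p) i = fps_nth (F ^ p) i / (of_real K ^ p * of_real \<tau> ^ i)" for p i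
    proof -
      have c0: "fps_nth (fps_const (1 / of_real \<tau>) * fps_X) 0 = (0::complex)" by simp
      show ?thesis
        unfolding F'_def power_mult_distrib fps_compose_power[OF c0] unfolding fps_compose_linear fps_const_power
        by (simp add: power_divide)
    qed
    have small: "norm (fps_nth (F' ^ p) i) \<le> 1" if "p \<ge> 1" "norm (fps_nth (F ^ p) i) \<le> K * \<tau> ^ i" for p i
    proof -
      have "K * \<tau> ^ i \<le> K ^ p * \<tau> ^ i"
        using K l that self_le_power[of K p] by (intro mult_right_mono) auto
      then have "norm (fps_nth (F ^ p) i) \<le> K ^ p * \<tau> ^ i" using that by linarith
      then show ?thesis using K l by (simp add: nth norm_divide norm_mult norm_power divide_le_eq_1)
    qed
    have "norm (fps_nth F' k) \<le> B ^ (k + 1)"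
            by (rule B(2), unfold cusp_coeffs_le_def) (use small j F in \<open>auto simp del: power_Suc simp: cusp_coeffs_le_def\<close>)
    moreover have "norm (fps_nth F' k) = norm (fps_nth F k) / (K * \<tau> ^ k)"
      using nth[of 1 k] K l by (simp add: norm_divide norm_mult norm_power)
    moreover have "K * \<tau> ^ k > 0" using K l by simp
    ultimately show "norm (fps_nth F k) \<le> K * \<tau> ^ k * B ^ (k + 1)"
      by (simp add: pos_divide_le_eq mult.commute)
  qed
qed

section \<open>Weight sequences\<close>

lemma weight_seq_basics:
  assumes "weight_seq M"
  shows "M 0 = 1" "\<And>k. M k > 0" "log_convex_seq M"
proof -
  obtain mu :: "nat \<Rightarrow> real" where mu: "\<And>k. mu k > 0" "mono mu" "\<And>k. M k = (\<Prod>i\<in>{1..k}. mu i)"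
    using assms unfolding weight_seq_def by auto
  show "M 0 = 1" by (simp add: mu)
  show pos: "M k > 0" for k unfolding mu(3) by (intro prod_pos) (use mu in auto)
  have S: "M (Suc k) = M k * mu (Suc k)" for k by (simp add: mu(3))
  show "log_convex_seq M" unfolding log_convex_seq_def
  proof
    fix k
    have "M (Suc k) * M k * mu (Suc k) \<le> M (Suc k) * M k * mu (Suc (Suc k))"
      using pos[of k] pos[of "Suc k"] mu(2) by (intro mult_left_mono) (auto simp: mono_def)
    then show "(M (Suc k))\<^sup>2 \<le> M k * M (Suc (Suc k))"
      unfolding S[of "Suc k"] power2_eq_square using S[of k] by (simp add: mult_ac)
  qed
qed

text \<open>By log-convexity and \<open>a 0 = 1\<close>, induction gives
  \<open>a i ^ Suc i \<le> a (Suc i) ^ i\<close>; a root of order \<open>i * Suc i\<close> of this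
  is the claim for neighbours.\<close>

lemma log_convex_seq_root_mono:
  fixes a :: "nat \<Rightarrow> real"
  assumes "log_convex_seq a" "a 0 = 1" and pos: "\<And>k. a k > 0" and "1 \<le> i" "i \<le> k"
  shows "a i powr (1 / i) \<le> a k powr (1 / k)"
proof -
  have lc: "(a (Suc k))\<^sup>2 \<le> a k * a (Suc (Suc k))" for k using assms(1) by (simp add: log_convex_seq_def)
  have st: "a i ^ Suc i \<le> a (Suc i) ^ i" for i
  proof (induction i)
    case (Suc i)
    have "a (Suc i) ^ i * a (Suc i) ^ Suc (Suc i) = ((a (Suc i))\<^sup>2) ^ Suc i"
      by (simp only: power_mult[symmetric] power_add[symmetric]) (simp add: mult_2)
    also have "\<dots> \<le> (a i * a (Suc (Suc i))) ^ Suc i" by (intro power_mono lc) simp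
    also have "\<dots> = a i ^ Suc i * a (Suc (Suc i)) ^ Suc i" by (rule power_mult_distrib)
    also have "\<dots> \<le> a (Suc i) ^ i * a (Suc (Suc i)) ^ Suc i"
      using Suc pos[of "Suc (Suc i)"] by (intro mult_right_mono) auto
    finally show ?case using pos[of "Suc i"] by (simp del: power_Suc)
  qed (simp add: assms(2))
  have st': "a (Suc i) powr (1 / Suc i) \<le> a (Suc (Suc i)) powr (1 / Suc (Suc i))" for i
  proof -
    let ?n = "Suc i"
    have "a ?n powr (1 / ?n) = (a ?n ^ Suc ?n) powr (1 / (real ?n * real (Suc ?n)))"
      using pos[of ?n] by (subst powr_realpow[symmetric]) (auto simp: powr_powr simp del: of_nat_Suc)
    also have "\<dots> \<le> (a (Suc ?n) ^ ?n) powr (1 / (real ?n * real (Suc ?n)))"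
      using st[of ?n] pos[of ?n] by (intro powr_mono2) auto
    also have "\<dots> = a (Suc ?n) powr (1 / Suc ?n)"
      using pos[of "Suc ?n"] by (subst powr_realpow[symmetric]) (auto simp: powr_powr simp del: of_nat_Suc)
    finally show ?thesis .
  qed
  have "(\<lambda>i. a (Suc i) powr (1 / Suc i)) (i - 1) \<le> (\<lambda>i. a (Suc i) powr (1 / Suc i)) (k - 1)"
    by (rule lift_Suc_mono_le[where f="\<lambda>i. a (Suc i) powr (1 / Suc i)"]) (use st' assms in auto)
  then show ?thesis using assms by simp
qed

lemma powr_root_power:
  fixes x :: real
  assumes "x > 0" "k \<ge> 1"
  shows "(x powr (1 / real k)) ^ i = x powr (i / k)"
  using assms by (simp add: powr_powr flip: powr_realpow)

text \<open>Every sequence in \<^const>\<open>LL\<close> has increasing roots of \<open>N_k / k!\<close>; intersectability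
  transfers this to \<open>M\<close>, up to a geometric factor, by testing with a suitable sequence.\<close>
lemma intersectable_almost_root_mono:
  assumes M: "weight_seq M" and I: "intersectable M"
  obtains C where "C \<ge> 1"
    "\<And>i k. 1 \<le> i \<Longrightarrow> i \<le> k \<Longrightarrow> M i / fact i \<le> C ^ i * (M k / fact k) powr (i / k)"
proof -
  note W = weight_seq_basics[OF M]
  define m where "m k = M k / fact k" for k
  have m: "m k > 0" for k using W(2) by (simp add: m_def)
  \<comment> \<open>The test sequence. It lies in \<open>Lambda_seq N\<close> for every
    \<open>N\<close> in \<open>LL M\<close>, because each summand is at most
    \<open>N k / fact k\<close> by monotonicity of the roots and the number \<open>k\<close> of
    summands is at most \<open>2 ^ k\<close>. Its membership in \<open>Lambda_seq M\<close> bounds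
    each \<open>m i powr (k / i)\<close> by a geometric factor times \<open>m k\<close>, which is
    the claim raised to the power \<open>k / i\<close>.\<close>
  define c where "c k = complex_of_real (fact k * (\<Sum>i\<in>{1..k}. m i powr (k / i)))" for k
  have nc: "norm (c k) = fact k * (\<Sum>i\<in>{1..k}. m i powr (k / i))" for k
    unfolding c_def norm_of_real by (simp add: sum_nonneg)
  have "c \<in> Lambda_seq N" if N: "N \<in> LL M" for N
  proof -
    have N': "weight_seq N" "\<And>k. N k \<ge> M k" "log_convex_seq (\<lambda>k. N k / fact k)" using N by (auto simp: LL_def)
    note WN = weight_seq_basics[OF N'(1)]
    have "norm (c k) \<le> 2 ^ k * N k" for k
    proof -
      have "m i powr (k / i) \<le> N k / fact k" if i: "i \<in> {1..k}" for i
      proof -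
        have "m i powr (k / i) \<le> (N i / fact i) powr (k / i)"
          using m[of i] N'(2)[of i] by (intro powr_mono2) (auto simp: m_def divide_right_mono)
        also have "\<dots> = ((N i / fact i) powr (1 / i)) powr k" using i by (simp add: powr_powr)
        also have "\<dots> \<le> ((N k / fact k) powr (1 / k)) powr k"
          using i WN by (intro powr_mono2 log_convex_seq_root_mono[OF N'(3)]) auto
        also have "\<dots> = N k / fact k" using i WN(2)[of k] by (simp add: powr_powr)
        finally show ?thesis .
      qed
      then have "(\<Sum>i\<in>{1..k}. m i powr (k / i)) \<le> (\<Sum>i\<in>{1..k}. N k / fact k)" by (intro sum_mono)
      also have "\<dots> = k * (N k / fact k)" by simp
      also have "\<dots> \<le> 2 ^ k * (N k / fact k)"
        using WN(2)[of k] of_nat_less_two_power[of k, where ?'a=real] by (intro mult_right_mono) auto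
      finally show ?thesis unfolding nc by (simp add: field_simps)
    qed
    then have "norm (c k) / (2 ^ k * N k) \<le> 1" for k using WN(2)[of k] by (simp add: divide_le_eq)
    then show ?thesis unfolding Lambda_seq_def by (auto intro!: exI[of _ 2] bdd_aboveI2)
  qed
  then have "c \<in> Lambda_seq M" using I by (auto simp: intersectable_def)
  then obtain \<rho> where r: "\<rho> > 0" "bdd_above (range (\<lambda>k. norm (c k) / (\<rho> ^ k * M k)))"
    by (auto simp: Lambda_seq_def)
  then obtain B where B: "\<And>k. norm (c k) / (\<rho> ^ k * M k) \<le> B" by (auto simp: bdd_above_def)
  \<comment> \<open>At least one, so that \<open>B' powr (i / k) \<le> B' ^ i\<close> later
    on.\<close>
  define B' where "B' = max 1 B"
  show ?thesis
  proof (rule that)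
    show "max 1 (B' * \<rho>) \<ge> 1" by simp
    fix i k :: nat assume i: "1 \<le> i" "i \<le> k"
    have k: "k \<ge> 1" using i by simp
    have d: "\<rho> ^ k * M k > 0" using r W by simp
    have "norm (c k) \<le> B * (\<rho> ^ k * M k)" using B[of k] d by (simp add: pos_divide_le_eq)
    also have "\<dots> \<le> B' * (\<rho> ^ k * M k)" using d by (intro mult_right_mono) (auto simp: B'_def)
    finally have 1: "(\<Sum>i\<in>{1..k}. m i powr (k / i)) \<le> B' * (\<rho> ^ k * m k)"
      unfolding nc m_def by (simp add: field_simps)
    have "m i powr (k / i) \<le> (\<Sum>i\<in>{1..k}. m i powr (k / i))"
      by (rule member_le_sum) (use i in auto)
    with 1 have 2: "m i powr (k / i) \<le> B' * (\<rho> ^ k * m k)" by simp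
    have "m i = (m i powr (k / i)) powr (i / k)" using m[of i] i by (simp add: powr_powr)
    also have "\<dots> \<le> (B' * (\<rho> ^ k * m k)) powr (i / k)" using 2 by (intro powr_mono2) auto
    also have "\<dots> = B' powr (i / k) * \<rho> ^ i * m k powr (i / k)"
    proof -
      have "(\<rho> ^ k) powr (i / k) = \<rho> ^ i" using r k by (simp add: powr_powr flip: powr_realpow)
      then show ?thesis using r m[of k] by (simp add: powr_mult B'_def)
    qed
    also have "\<dots> \<le> B' ^ i * \<rho> ^ i * m k powr (i / k)"
    proof (intro mult_right_mono)
      have "real i * 1 \<le> real i * real k" using k by (intro mult_left_mono) auto
      then have "B' powr (i / k) \<le> B' powr i" using k by (intro powr_mono) (auto simp: B'_def divide_simps)
      then show "B' powr (i / k) \<le> B' ^ i" by (simp add: powr_realpow B'_def)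
    qed (use r in auto)
    also have "\<dots> = (B' * \<rho>) ^ i * m k powr (i / k)" by (simp add: power_mult_distrib)
    also have "\<dots> \<le> (max 1 (B' * \<rho>)) ^ i * m k powr (i / k)"
      using r by (intro mult_right_mono power_mono) (auto simp: B'_def)
    finally show "M i / fact i \<le> (max 1 (B' * \<rho>)) ^ i * (M k / fact k) powr (i / k)" by (simp add: m_def)
  qed
qed

text \<open>The left side over \<open>fact i\<close> is a single term of the exponential series at
  \<open>i\<close>.\<close>

lemma power_self_le_exp_fact: "real i ^ i \<le> exp 1 ^ i * fact i"
proof -
  have s: "(\<lambda>n. real i ^ n /\<^sub>R fact n) sums exp (real i)" by (rule exp_converges)
  have "(\<Sum>n\<in>{i}. real i ^ n /\<^sub>R fact n) \<le> (\<Sum>n. real i ^ n /\<^sub>R fact n)"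
    using s by (intro sum_le_suminf) (auto simp: sums_iff)
  then have "real i ^ i / fact i \<le> exp (real i)" using s by (simp add: sums_iff divide_inverse mult.commute)
  moreover have "exp (real i) = exp 1 ^ i" by (simp flip: exp_of_nat_mult)
  ultimately show ?thesis by (simp add: divide_le_eq)
qed

text \<open>For fixed \<open>p\<close> the exponent of \<open>C\<close> is linear in
  \<open>k\<close>, so a root of order \<open>p * k\<close> leaves the constant
  \<open>C ^ p\<close>.\<close>

lemma moderate_growth_multiple:
  assumes M: "weight_seq M" and C: "C \<ge> 1" "\<And>j k. M (j + k) \<le> C ^ (j + k) * M j * M k"
  shows "M (p * k) \<le> C ^ (k * p\<^sup>2) * M k ^ p"
proof (induction p)
  case 0
  then show ?case using weight_seq_basics(1)[OF M] by simp
next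
  case (Suc p)
  have pos: "M k > 0" for k using weight_seq_basics[OF M] by simp
  have "M (Suc p * k) = M (p * k + k)" by (simp add: add.commute)
  also have "\<dots> \<le> C ^ (p * k + k) * M (p * k) * M k" by (rule C)
  also have "\<dots> \<le> C ^ (p * k + k) * (C ^ (k * p\<^sup>2) * M k ^ p) * M k"
    using Suc C pos[of k] by (intro mult_right_mono mult_left_mono) auto
  also have "\<dots> = C ^ (p * k + k + k * p\<^sup>2) * M k ^ Suc p" by (simp add: power_add)
  also have "\<dots> \<le> C ^ (k * (Suc p)\<^sup>2) * M k ^ Suc p"
    using C pos[of k] by (intro mult_right_mono power_increasing) (auto simp: power2_eq_square algebra_simps)
  finally show ?case .
qed

text \<open>For \<open>i \<le> k\<close> this is the consequence of intersectability. For
  \<open>k \<le> i \<le> L * k\<close>, log-convexity of \<open>M\<close> itself and moderate growth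
  compare the i-th root of \<open>M i\<close> with the k-th root of \<open>M k\<close>. The
  factorials are then reinserted through the chain from \<open>fact k powr (i / k)\<close> over
  \<open>k ^ i\<close> and \<open>i ^ i\<close> to \<open>exp 1 ^ i * fact i\<close>.\<close>

lemma weight_root_bound:
  assumes M: "weight_seq M" and I: "intersectable M" and G: "moderate_growth M" and L: "L \<ge> 1"
  obtains C where "C \<ge> 1"
    "\<And>i k. 1 \<le> k \<Longrightarrow> i \<le> L * k \<Longrightarrow> M i / fact i \<le> C ^ i * (M k / fact k) powr (i / k)"
proof -
  note W = weight_seq_basics[OF M]
  obtain C1 where C1: "C1 \<ge> 1"
    "\<And>i k. 1 \<le> i \<Longrightarrow> i \<le> k \<Longrightarrow> M i / fact i \<le> C1 ^ i * (M k / fact k) powr (i / k)"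
    using intersectable_almost_root_mono[OF M I] by blast
  obtain C' where C': "C' > 0" "\<And>j k. M (j + k) \<le> C' ^ (j + k) * M j * M k"
    using G by (auto simp: moderate_growth_def)
  define D where "D = max 1 C'"
  have D: "D \<ge> 1" "M (j + k) \<le> D ^ (j + k) * M j * M k" for j k
  proof -
    have "C' ^ (j + k) * M j * M k \<le> D ^ (j + k) * M j * M k"
      using C' W(2)[of j] W(2)[of k] by (intro mult_right_mono power_mono) (auto simp: D_def)
    then show "M (j + k) \<le> D ^ (j + k) * M j * M k" using C'(2)[of j k] by linarith
  qed (simp add: D_def)
  define E where "E = max C1 (exp 1 * D ^ L)"
  show ?thesis
  proof (rule that)
    show E1: "E \<ge> 1" using C1 by (simp add: E_def)
    fix i k :: nat assume k: "1 \<le> k" and i: "i \<le> L * k"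
    consider "i = 0" | "1 \<le> i" "i \<le> k" | "k \<le> i" "1 \<le> i" using k by linarith
    then show "M i / fact i \<le> E ^ i * (M k / fact k) powr (i / k)"
    proof cases
      case 1
      then show ?thesis using W(1) W(2)[of k] by simp
    next
      case 2
      have "M i / fact i \<le> C1 ^ i * (M k / fact k) powr (i / k)" by (rule C1(2)[OF 2])
      also have "\<dots> \<le> E ^ i * (M k / fact k) powr (i / k)"
        using C1 by (intro mult_right_mono power_mono) (auto simp: E_def)
      finally show ?thesis .
    next
      case 3
      have "M i powr (1 / i) \<le> M (L * k) powr (1 / (L * k))"
        using log_convex_seq_root_mono[OF W(3,1,2) 3(2) i] .
      also have "\<dots> \<le> (D ^ (k * L\<^sup>2) * M k ^ L) powr (1 / (L * k))"
        using moderate_growth_multiple[OF M D, of L k] W(2)[of "L * k"] by (intro powr_mono2) auto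
      also have "\<dots> = D ^ L * M k powr (1 / k)"
      proof -
        have "(D ^ (k * L\<^sup>2)) powr (1 / (L * k)) = D ^ L"
          using D(1) L k by (simp add: powr_powr power2_eq_square flip: powr_realpow)
        moreover have "(M k ^ L) powr (1 / (L * k)) = M k powr (1 / k)"
          using W(2)[of k] L by (simp add: powr_powr flip: powr_realpow)
        ultimately show ?thesis using D(1) W(2)[of k] by (simp add: powr_mult)
      qed
      finally have "(M i powr (1 / i)) ^ i \<le> (D ^ L * M k powr (1 / k)) ^ i" by (intro power_mono) auto
      then have "M i \<le> (D ^ L) ^ i * M k powr (i / k)"
        using 3 k W(2)[of i] W(2)[of k] by (simp add: power_mult_distrib powr_root_power)
      also have "M k powr (i / k) = (fact k) powr (i / k) * (M k / fact k) powr (i / k)"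
        using W(2)[of k] by (simp flip: powr_mult)
      also have "(fact k :: real) powr (i / k) \<le> exp 1 ^ i * fact i"
      proof -
        have "(fact k :: real) powr (i / k) \<le> (real k ^ k) powr (i / k)"
          using fact_le_power[of k, where ?'a=real] by (intro powr_mono2) auto
        also have "\<dots> = real k ^ i" using k by (simp add: powr_powr flip: powr_realpow)
        also have "\<dots> \<le> real i ^ i" using 3 by (intro power_mono) auto
        also have "\<dots> \<le> exp 1 ^ i * fact i" by (rule power_self_le_exp_fact)
        finally show ?thesis .
      qed
      finally have "M i \<le> (D ^ L) ^ i * (exp 1 ^ i * fact i * (M k / fact k) powr (i / k))"
        using D(1) by (simp add: mult_left_mono mult_right_mono)
      then have "M i / fact i \<le> (exp 1 * D ^ L) ^ i * (M k / fact k) powr (i / k)"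
        by (simp add: divide_le_eq power_mult_distrib mult_ac)
      also have "\<dots> \<le> E ^ i * (M k / fact k) powr (i / k)"
        using D(1) by (intro mult_right_mono power_mono) (auto simp: E_def)
      finally show ?thesis .
    qed
  qed
qed

section \<open>Taylor series along lines\<close>

lemma has_vector_derivative_shift_line:
  fixes u :: "'a::real_normed_vector \<Rightarrow> complex"
  assumes "((\<lambda>t. u ((y + s *\<^sub>R e) + t *\<^sub>R e)) has_vector_derivative D) (at 0)"
  shows "((\<lambda>t. u (y + t *\<^sub>R e)) has_vector_derivative D) (at s within S)"
proof -
  have "((\<lambda>t. t - s) has_vector_derivative 1) (at s)" by (auto intro!: derivative_eq_intros)
  from vector_diff_chain_at[OF this, of "\<lambda>t. u ((y + s *\<^sub>R e) + t *\<^sub>R e)" D] assms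
  have "((\<lambda>t. u (y + t *\<^sub>R e)) has_vector_derivative D) (at s)"
    by (simp add: o_def algebra_simps)
  then show ?thesis by (rule has_vector_derivative_at_within)
qed

text \<open>Continuous partial derivatives give differentiability in every direction: increments are
  changed one coordinate at a time, by induction on the set \<open>S\<close> of coordinates in use,
  with the mean value inequality for each new coordinate.\<close>

lemma has_vector_derivative_line_of_partials:
  fixes u :: "real^'n::finite \<Rightarrow> complex"
  assumes U: "open U" "x \<in> U"
    and der: "\<And>i y. y \<in> U \<Longrightarrow> ((\<lambda>t. u (y + t *\<^sub>R axis i 1)) has_vector_derivative D i y) (at 0)"
    and cont: "\<And>i. continuous_on U (D i)"
  shows "((\<lambda>t. u (x + t *\<^sub>R v)) has_vector_derivative (\<Sum>i\<in>UNIV. v $ i *\<^sub>R D i x)) (at 0)"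
proof -
  have main: "\<exists>\<delta>>0. \<forall>w. (\<forall>i. i \<notin> S \<longrightarrow> w $ i = 0) \<and> norm w < \<delta> \<longrightarrow>
      norm (u (x + w) - u x - (\<Sum>i\<in>S. w $ i *\<^sub>R D i x)) \<le> \<epsilon> * norm w"
    if "finite S" "\<epsilon> > 0" for S :: "'n set" and \<epsilon> :: real
    using that
  proof (induction S arbitrary: \<epsilon> rule: finite_induct)
    case empty
    have "norm (u (x + w) - u x) \<le> \<epsilon> * norm w" if "\<forall>i. w $ i = 0" for w :: "real^'n"
    proof -
      have "w = 0" using that by (simp add: vec_eq_iff)
      then show ?thesis by simp
    qed
    then show ?case by (auto intro!: exI[of _ 1])
  next
    case (insert j S)
    obtain d1 where d1: "d1 > 0" "\<And>w. (\<forall>i. i \<notin> S \<longrightarrow> w $ i = 0) \<Longrightarrow> norm w < d1 \<Longrightarrow>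
      norm (u (x + w) - u x - (\<Sum>i\<in>S. w $ i *\<^sub>R D i x)) \<le> \<epsilon> / 2 * norm w"
      using insert.IH[of "\<epsilon> / 2"] insert.prems by auto
    obtain d2 where d2: "d2 > 0" "ball x d2 \<subseteq> U" using U open_contains_ball by blast
    have "isCont (D j) x" using cont U continuous_on_eq_continuous_at by blast
    then obtain d3 where d3: "d3 > 0" "\<And>y. dist y x < d3 \<Longrightarrow> dist (D j y) (D j x) < \<epsilon> / 2"
      using insert.prems unfolding continuous_at_eps_delta by (metis half_gt_zero)
    define \<delta> where "\<delta> = min d1 (min d2 d3)"
    have "norm (u (x + w) - u x - (\<Sum>i\<in>insert j S. w $ i *\<^sub>R D i x)) \<le> \<epsilon> * norm w"
      if w: "\<forall>i. i \<notin> insert j S \<longrightarrow> w $ i = 0" "norm w < \<delta>" for w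
    proof -
      define w' where "w' = (\<chi> i. if i = j then 0 else w $ i)"
      have w'1: "w' $ i = (if i = j then 0 else w $ i)" for i by (simp add: w'_def)
      have w'2: "w = w' + (w $ j) *\<^sub>R axis j 1" by (simp add: vec_eq_iff w'_def axis_def)
      have nw: "norm (w' + s *\<^sub>R axis j 1) \<le> norm w" if "\<bar>s\<bar> \<le> \<bar>w $ j\<bar>" for s
        by (rule norm_le_componentwise_cart) (use that in \<open>auto simp: w'1 axis_def\<close>)
      have nw': "norm w' \<le> norm w" using nw[of 0] by simp
      have b1: "norm (u (x + w') - u x - (\<Sum>i\<in>S. w' $ i *\<^sub>R D i x)) \<le> \<epsilon> / 2 * norm w'"
        using w nw' insert.hyps by (intro d1) (auto simp: w'1 \<delta>_def)
      have s1: "(\<Sum>i\<in>S. w' $ i *\<^sub>R D i x) = (\<Sum>i\<in>S. w $ i *\<^sub>R D i x)"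
        using insert.hyps by (intro sum.cong) (auto simp: w'1)
      define h where "h s = u (x + w' + s *\<^sub>R axis j 1) - s *\<^sub>R D j x" for s
      have b2: "norm (h (w $ j) - h 0) \<le> \<epsilon> / 2 * \<bar>w $ j - 0\<bar>"
      proof (rule vector_derivative_norm_bound[where S = "closed_segment 0 (w $ j)" and f' = "\<lambda>s. D j (x + w' + s *\<^sub>R axis j 1) - D j x"])
        fix s assume s: "s \<in> closed_segment 0 (w $ j)"
        then have "\<bar>s\<bar> \<le> \<bar>w $ j\<bar>" by (auto simp: closed_segment_eq_real_ivl split: if_splits)
        then have n: "norm (w' + s *\<^sub>R axis j 1) < \<delta>" using nw w(2) by fastforce
        have "x + w' + s *\<^sub>R axis j 1 \<in> U"
        proof (rule subsetD[OF d2(2)])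
          have "dist x (x + (w' + s *\<^sub>R axis j 1)) = norm (w' + s *\<^sub>R axis j 1)"
            unfolding dist_norm by (subst norm_minus_commute) simp
          then show "x + w' + s *\<^sub>R axis j 1 \<in> ball x d2"
            using n by (simp add: \<delta>_def add.assoc)
        qed
        then have "((\<lambda>t. u (x + w' + t *\<^sub>R axis j 1)) has_vector_derivative D j (x + w' + s *\<^sub>R axis j 1)) (at s within closed_segment 0 (w $ j))"
          by (rule has_vector_derivative_shift_line[OF der])
        then show "(h has_vector_derivative D j (x + w' + s *\<^sub>R axis j 1) - D j x) (at s within closed_segment 0 (w $ j))"
          unfolding h_def by (auto intro!: derivative_eq_intros simp: has_vector_derivative_def algebra_simps)
        show "norm (D j (x + w' + s *\<^sub>R axis j 1) - D j x) \<le> \<epsilon> / 2"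
          using d3(2)[of "x + w' + s *\<^sub>R axis j 1"] n by (simp add: \<delta>_def dist_norm add.assoc less_imp_le)
      qed auto
      have "h (w $ j) - h 0 = u (x + w) - w $ j *\<^sub>R D j x - u (x + w')"
        using w'2 by (simp add: h_def add.assoc)
      then have eq: "u (x + w) - u x - (\<Sum>i\<in>insert j S. w $ i *\<^sub>R D i x)
         = (h (w $ j) - h 0) + (u (x + w') - u x - (\<Sum>i\<in>S. w' $ i *\<^sub>R D i x))"
        using insert.hyps by (simp add: s1)
      have "norm (u (x + w) - u x - (\<Sum>i\<in>insert j S. w $ i *\<^sub>R D i x))
         \<le> \<epsilon> / 2 * \<bar>w $ j\<bar> + \<epsilon> / 2 * norm w'"
        unfolding eq using norm_triangle_mono[OF b2 b1] by (simp only: diff_0_right)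
      also have "\<dots> \<le> \<epsilon> / 2 * norm w + \<epsilon> / 2 * norm w"
        using insert.prems nw' component_le_norm_cart[of w j] by (intro add_mono mult_left_mono) auto
      finally show ?thesis by simp
    qed
    moreover have "\<delta> > 0" using d1 d2 d3 by (simp add: \<delta>_def)
    ultimately show ?case by blast
  qed
  define L where "L = (\<Sum>i\<in>UNIV. v $ i *\<^sub>R D i x)"
  have "((\<lambda>t. u (x + t *\<^sub>R v)) has_derivative (\<lambda>h. h *\<^sub>R L)) (at 0)"
    unfolding has_derivative_at_alt
  proof (intro conjI allI impI)
    show "bounded_linear (\<lambda>h. h *\<^sub>R L)" by (rule bounded_linear_scaleR_left)
    fix e :: real assume e: "0 < e"
    define \<epsilon> where "\<epsilon> = e / (norm v + 1)"
    have nv: "norm v + 1 > 0" by (simp add: add_nonneg_pos)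
    have ep: "\<epsilon> > 0" using e nv by (simp add: \<epsilon>_def)
    obtain \<delta> where dl: "\<delta> > 0" "\<And>w. norm w < \<delta> \<Longrightarrow>
      norm (u (x + w) - u x - (\<Sum>i\<in>UNIV. w $ i *\<^sub>R D i x)) \<le> \<epsilon> * norm w"
      using main[of UNIV \<epsilon>] ep by auto
    show "\<exists>d>0. \<forall>y. norm (y - 0) < d \<longrightarrow> norm (u (x + y *\<^sub>R v) - u (x + 0 *\<^sub>R v) - (y - 0) *\<^sub>R L) \<le> e * norm (y - 0)"
    proof (intro exI[of _ "\<delta> / (norm v + 1)"] conjI allI impI)
      show "\<delta> / (norm v + 1) > 0" using dl nv by simp
      fix y :: real assume y: "norm (y - 0) < \<delta> / (norm v + 1)"
      have "norm (y *\<^sub>R v) \<le> \<bar>y\<bar> * (norm v + 1)" by (simp add: mult_left_mono)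
      also have "\<dots> < \<delta>" using y nv by (simp add: pos_less_divide_eq)
      finally have "norm (u (x + y *\<^sub>R v) - u x - (\<Sum>i\<in>UNIV. (y *\<^sub>R v) $ i *\<^sub>R D i x)) \<le> \<epsilon> * norm (y *\<^sub>R v)"
        by (rule dl)
      also have "\<dots> = (\<epsilon> * norm v) * \<bar>y\<bar>" by simp
      also have "\<epsilon> * norm v \<le> e"
        using nv e by (simp add: \<epsilon>_def field_simps)
      finally show "norm (u (x + y *\<^sub>R v) - u (x + 0 *\<^sub>R v) - (y - 0) *\<^sub>R L) \<le> e * norm (y - 0)"
        by (simp add: L_def scaleR_sum_right mult_right_mono)
    qed
  qed
  then show ?thesis by (simp add: has_vector_derivative_def L_def)
qed

text \<open>Taylor's formula for a function given together with all its derivatives. The mean value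
  inequality replaces the integral remainder, at the cost of the factorial in the remainder; for
  smoothness only the order in \<open>t\<close> matters.\<close>

lemma taylor_tower:
  fixes \<phi> :: "nat \<Rightarrow> real \<Rightarrow> complex"
  assumes "\<And>k s. \<bar>s\<bar> < \<rho> \<Longrightarrow> (\<phi> k has_vector_derivative \<phi> (Suc k) s) (at s)"
    and "\<And>s. \<bar>s\<bar> < \<rho> \<Longrightarrow> norm (\<phi> (Suc n) s) \<le> A" and "\<bar>t\<bar> < \<rho>"
  shows "norm (\<phi> 0 t - (\<Sum>k\<le>n. (t ^ k / fact k) *\<^sub>R \<phi> k 0)) \<le> A * \<bar>t\<bar> ^ (n + 1)"
  using assms
proof (induction n arbitrary: \<phi> t)
  case 0
  have "norm (\<phi> 0 t - \<phi> 0 0) \<le> A * \<bar>t - 0\<bar>"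
    by (rule vector_derivative_norm_bound[where S="{-\<rho><..<\<rho>}" and f' = "\<phi> (Suc 0)"])
      (use 0 in \<open>auto intro: has_vector_derivative_at_within\<close>)
  then show ?case by simp
next
  case (Suc n)
  define h where "h s = \<phi> 0 s - (\<Sum>k\<le>Suc n. (s ^ k / fact k) *\<^sub>R \<phi> k 0)" for s
  define h' where "h' s = \<phi> 1 s - (\<Sum>k\<le>n. (s ^ k / fact k) *\<^sub>R \<phi> (Suc k) 0)" for s
  have t: "\<bar>s\<bar> < \<rho>" if "s \<in> closed_segment 0 t" for s
    using that Suc.prems(3) by (auto simp: closed_segment_eq_real_ivl split: if_splits)
  have A0: "A \<ge> 0" using Suc.prems(2)[of t] Suc.prems(3) norm_ge_zero order_trans by blast
  have "norm (h t - h 0) \<le> (A * \<bar>t\<bar> ^ (n + 1)) * \<bar>t - 0\<bar>"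
  proof (rule vector_derivative_norm_bound[where S="closed_segment 0 t" and f' = h'])
    fix s assume s: "s \<in> closed_segment 0 t"
    have "((\<lambda>s. \<Sum>k\<le>Suc n. (s ^ k / fact k) *\<^sub>R \<phi> k 0) has_vector_derivative
       (\<Sum>k\<le>Suc n. (if k = 0 then 0 else s ^ (k - 1) / fact (k - 1)) *\<^sub>R \<phi> k 0)) (at s within closed_segment 0 t)"
    proof (rule has_vector_derivative_sum)
      fix k
      have "((\<lambda>s. s ^ k / fact k) has_field_derivative (if k = 0 then 0 else s ^ (k - 1) / fact (k - 1))) (at s within closed_segment 0 t)"
      proof (cases k)
        case (Suc m)
        have "((\<lambda>s. s ^ k / fact k) has_field_derivative real k * (1 * s ^ (k - Suc 0)) / fact k) (at s within closed_segment 0 t)"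
          by (intro DERIV_cdivide DERIV_power DERIV_ident)
        then show ?thesis using Suc by (simp add: divide_simps del: of_nat_Suc)
      qed simp
      then show "((\<lambda>s. (s ^ k / fact k) *\<^sub>R \<phi> k 0) has_vector_derivative (if k = 0 then 0 else s ^ (k - 1) / fact (k - 1)) *\<^sub>R \<phi> k 0) (at s within closed_segment 0 t)"
        using has_vector_derivative_scaleR[OF _ has_vector_derivative_const[of "\<phi> k 0"]] by fastforce
    qed
    also have "(\<Sum>k\<le>Suc n. (if k = 0 then 0 else s ^ (k - 1) / fact (k - 1)) *\<^sub>R \<phi> k 0) = (\<Sum>k\<le>n. (s ^ k / fact k) *\<^sub>R \<phi> (Suc k) 0)"
      by (subst sum.atMost_Suc_shift) simp
    finally show "(h has_vector_derivative h' s) (at s within closed_segment 0 t)"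
      unfolding h_def h'_def using Suc.prems(1)[OF t[OF s], of 0]
      by (intro has_vector_derivative_diff) (auto intro: has_vector_derivative_at_within)
    have "norm (h' s) \<le> A * \<bar>s\<bar> ^ (n + 1)"
      using Suc.IH[of "\<lambda>k. \<phi> (Suc k)" s] Suc.prems t[OF s] by (simp add: h'_def)
    also have "\<dots> \<le> A * \<bar>t\<bar> ^ (n + 1)"
      using s A0 by (intro mult_left_mono power_mono) (auto simp: closed_segment_eq_real_ivl split: if_splits)
    finally show "norm (h' s) \<le> A * \<bar>t\<bar> ^ (n + 1)" .
  qed auto
  moreover have "h 0 = 0"
    unfolding h_def by (subst sum.atMost_Suc_shift) simp
  ultimately show ?case by (simp add: h_def mult_ac)
qed

text \<open>The k-th derivative of \<open>g\<close> in direction \<open>v\<close>, expanded over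
  words of length \<open>k\<close> instead of multi-indices, to match \<open>pdiffs\<close>.\<close>

definition dir_deriv :: "real^'n::finite \<Rightarrow> (real^'n \<Rightarrow> complex) \<Rightarrow> nat \<Rightarrow> real^'n \<Rightarrow> complex" where
  "dir_deriv v g k y = (\<Sum>is | length is = k. prod_list (map (($) v) is) *\<^sub>R pdiffs is g y)"

lemma card_words: "card {is :: 'n::finite list. length is = k} = CARD('n) ^ k"
  using card_lists_length_eq[of "UNIV :: 'n set" k] by simp

lemma sum_words_Suc:
  "(\<Sum>is | length is = Suc k. f is) = (\<Sum>is | length is = k. \<Sum>i\<in>(UNIV::'n::finite set). f (i # is))"
proof -
  have e: "{is :: 'n list. length is = Suc k} = (\<lambda>(is, i). i # is) ` ({is. length is = k} \<times> UNIV)"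
    by (auto simp: length_Suc_conv image_iff)
  have "(\<Sum>is | length is = Suc k. f is) = (\<Sum>(is, i)\<in>{is. length is = k} \<times> UNIV. f (i # is))"
    unfolding e by (subst sum.reindex) (auto simp: inj_on_def case_prod_beta)
  then show ?thesis by (simp add: sum.cartesian_product)
qed

lemma dir_deriv_has_vector_derivative:
  assumes g: "smooth_on U g" and U: "open U" "x + s *\<^sub>R v \<in> U"
  shows "((\<lambda>t. dir_deriv v g k (x + t *\<^sub>R v)) has_vector_derivative dir_deriv v g (Suc k) (x + s *\<^sub>R v)) (at s)"
proof -
  have 1: "((\<lambda>t. pdiffs is g (x + t *\<^sub>R v)) has_vector_derivative (\<Sum>i\<in>UNIV. v $ i *\<^sub>R pdiffs (i # is) g (x + s *\<^sub>R v))) (at s)" for "is"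
    by (rule has_vector_derivative_shift_line[OF has_vector_derivative_line_of_partials[OF U]])
      (use g in \<open>auto simp: smooth_on_def simp del: pdiffs.simps\<close>)
  have "((\<lambda>t. dir_deriv v g k (x + t *\<^sub>R v)) has_vector_derivative
     (\<Sum>is | length is = k. prod_list (map (($) v) is) *\<^sub>R (\<Sum>i\<in>UNIV. v $ i *\<^sub>R pdiffs (i # is) g (x + s *\<^sub>R v)))) (at s)"
    unfolding dir_deriv_def
    by (intro has_vector_derivative_sum) (use 1 in \<open>auto intro!: derivative_eq_intros\<close>)
  also have "(\<Sum>is | length is = k. prod_list (map (($) v) is) *\<^sub>R (\<Sum>i\<in>UNIV. v $ i *\<^sub>R pdiffs (i # is) g (x + s *\<^sub>R v)))
     = dir_deriv v g (Suc k) (x + s *\<^sub>R v)"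
    unfolding dir_deriv_def sum_words_Suc by (simp add: scaleR_sum_right mult_ac)
  finally show ?thesis .
qed

lemma norm_dir_deriv_le:
  fixes v :: "real^'n::finite" and A :: real
  assumes "norm v \<le> 1" "\<And>is :: 'n list. length is = k \<Longrightarrow> norm (pdiffs is g y) \<le> A"
  shows "norm (dir_deriv v g k y) \<le> CARD('n) ^ k * A"
proof -
  have p: "\<bar>prod_list (map (($) v) is)\<bar> \<le> 1" for "is"
  proof (induction "is")
    case (Cons i "is")
    have "\<bar>v $ i\<bar> \<le> 1" using component_le_norm_cart[of v i] assms(1) by linarith
    then show ?case using Cons by (simp add: abs_mult mult_le_one)
  qed simp
  have "norm (dir_deriv v g k y) \<le> (\<Sum>is :: 'n list | length is = k. A)"
    unfolding dir_deriv_def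
  proof (rule sum_norm_le)
    fix "is" :: "'n list" assume "is \<in> {is. length is = k}"
    then have "norm (pdiffs is g y) \<le> A" using assms(2) by simp
    then have "\<bar>prod_list (map (($) v) is)\<bar> * norm (pdiffs is g y) \<le> 1 * A"
      using p by (intro mult_mono) auto
    then show "norm (prod_list (map (($) v) is) *\<^sub>R pdiffs is g y) \<le> A" by simp
  qed
  then show ?thesis by (simp add: card_words)
qed

text \<open>The formal Taylor series of \<open>g (x + t *\<^sub>R v)\<close> at
  \<open>t = 0\<close>. It need not converge, and only its truncations are evaluated.\<close>

definition line_fps :: "real^'n::finite \<Rightarrow> (real^'n \<Rightarrow> complex) \<Rightarrow> real^'n \<Rightarrow> complex fps" where
  "line_fps v g x = Abs_fps (\<lambda>k. dir_deriv v g k x / fact k)"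

lemma line_fps_taylor:
  fixes g :: "real^'n::finite \<Rightarrow> complex" and A R r t :: real
  assumes g: "smooth_on (ball 0 R) g" and v: "norm v \<le> 1" and x: "norm x < r" and t: "\<bar>t\<bar> < R - r"
    and b: "\<And>is y. y \<in> ball 0 R \<Longrightarrow> length is = n + 1 \<Longrightarrow> norm (pdiffs is g y) \<le> A"
  shows "norm (g (x + t *\<^sub>R v) - fps_trunc n (line_fps v g x) (of_real t)) \<le> CARD('n) ^ (n + 1) * A * \<bar>t\<bar> ^ (n + 1)"
proof -
  have inb: "x + s *\<^sub>R v \<in> ball 0 R" if "\<bar>s\<bar> < R - r" for s
  proof -
    have "norm (x + s *\<^sub>R v) \<le> norm x + \<bar>s\<bar> * norm v" by (rule order_trans[OF norm_triangle_ineq]) simp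
    also have "\<bar>s\<bar> * norm v \<le> \<bar>s\<bar> * 1" using v by (intro mult_left_mono) auto
    finally show ?thesis using x that by simp
  qed
  have "norm ((\<lambda>k t. dir_deriv v g k (x + t *\<^sub>R v)) 0 t - (\<Sum>k\<le>n. (t ^ k / fact k) *\<^sub>R (\<lambda>k t. dir_deriv v g k (x + t *\<^sub>R v)) k 0))
     \<le> (CARD('n) ^ (n + 1) * A) * \<bar>t\<bar> ^ (n + 1)"
  proof (rule taylor_tower[OF _ _ t])
    fix k s assume s: "\<bar>s\<bar> < R - r"
    show "((\<lambda>t. dir_deriv v g k (x + t *\<^sub>R v)) has_vector_derivative dir_deriv v g (Suc k) (x + s *\<^sub>R v)) (at s)"
      by (rule dir_deriv_has_vector_derivative[OF g open_ball inb[OF s]])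
    show "norm (dir_deriv v g (Suc n) (x + s *\<^sub>R v)) \<le> CARD('n) ^ (n + 1) * A"
      using norm_dir_deriv_le[OF v, of "n + 1" g "x + s *\<^sub>R v" A] b[OF inb[OF s]] by simp
  qed
  moreover have "dir_deriv v g 0 (x + t *\<^sub>R v) = g (x + t *\<^sub>R v)" by (simp add: dir_deriv_def)
  moreover have "(\<Sum>k\<le>n. (t ^ k / fact k) *\<^sub>R dir_deriv v g k x) = fps_trunc n (line_fps v g x) (of_real t)"
    unfolding fps_trunc_def line_fps_def by (intro sum.cong) (auto simp: scaleR_conv_of_real)
  ultimately show ?thesis by simp
qed

section \<open>Uniqueness of expansions, and roots of expansions\<close>

lemma le_zero_if_le_linear:
  fixes a K \<delta> :: real
  assumes d: "\<delta> > 0" and le: "\<And>t. 0 < t \<Longrightarrow> t < \<delta> \<Longrightarrow> a \<le> K * t"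
  shows "a \<le> 0"
proof (rule tendsto_lowerbound)
  have "((\<lambda>t. K * t) \<longlongrightarrow> K * 0) (at_right 0)" by (intro tendsto_intros)
  then show "((\<lambda>t. K * t) \<longlongrightarrow> 0) (at_right 0)" by simp
  show "\<forall>\<^sub>F t in at_right 0. a \<le> K * t"
    unfolding eventually_at_right_field using d le by blast
qed simp

text \<open>A polynomial of degree at most \<open>n\<close> that is \<open>o(t^n)\<close> vanishes:
  its constant term is a limit equal to \<open>0\<close>, and division by \<open>t\<close> reduces
  the degree.\<close>

lemma poly_coeffs_zero_if_small:
  fixes c :: "nat \<Rightarrow> complex"
  assumes "\<And>\<epsilon>. \<epsilon> > 0 \<Longrightarrow> \<exists>\<delta>>0. \<forall>t. 0 < t \<and> t < \<delta> \<longrightarrow> norm (\<Sum>i\<le>n. c i * of_real t ^ i) \<le> \<epsilon> * t ^ n"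
    and "i \<le> n"
  shows "c i = 0"
  using assms
proof (induction n arbitrary: c i)
  case 0
  have "norm (c 0) \<le> 0"
  proof (rule field_le_epsilon)
    fix e :: real assume "e > 0"
    then obtain \<delta> where d: "\<delta> > 0" "\<And>t. 0 < t \<Longrightarrow> t < \<delta> \<Longrightarrow> norm (\<Sum>i\<le>0. c i * of_real t ^ i) \<le> e * t ^ 0"
      using 0(1)[of e] by auto
    show "norm (c 0) \<le> 0 + e" using d(2)[of "\<delta> / 2"] d(1) by simp
  qed
  then show ?case using 0 by simp
next
  case (Suc n)
  define S where "S = (\<Sum>i\<le>n. norm (c (Suc i)))"
  obtain \<delta> where d: "\<delta> > 0" "\<And>t. 0 < t \<Longrightarrow> t < \<delta> \<Longrightarrow> norm (\<Sum>i\<le>Suc n. c i * of_real t ^ i) \<le> 1 * t ^ Suc n"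
    using Suc.prems(1)[of 1] by auto
  have split: "(\<Sum>i\<le>Suc n. c i * of_real t ^ i) = c 0 + of_real t * (\<Sum>i\<le>n. c (Suc i) * of_real t ^ i)" for t
    by (subst sum.atMost_Suc_shift) (simp add: sum_distrib_left mult_ac)
  have "norm (c 0) \<le> 0"
  proof (rule le_zero_if_le_linear[where \<delta> = "min \<delta> 1" and K = "1 + S"])
    fix t :: real assume t: "0 < t" "t < min \<delta> 1"
    have "norm (\<Sum>i\<le>n. c (Suc i) * of_real t ^ i) \<le> S"
      unfolding S_def
    proof (rule sum_norm_le)
      fix i
      have "norm (c (Suc i)) * t ^ i \<le> norm (c (Suc i)) * 1"
        using t by (intro mult_left_mono power_le_one) auto
      then show "norm (c (Suc i) * of_real t ^ i) \<le> norm (c (Suc i))" using t by (simp add: norm_mult norm_power)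
    qed
    then have "norm (of_real t * (\<Sum>i\<le>n. c (Suc i) * of_real t ^ i)) \<le> t * S"
      using t by (simp add: norm_mult)
    moreover have "norm (\<Sum>i\<le>Suc n. c i * of_real t ^ i) \<le> t"
      using d(2)[of t] t power_le_one[of t n] by (simp add: mult_left_le order_trans)
    moreover have "norm (c 0) \<le> norm (\<Sum>i\<le>Suc n. c i * of_real t ^ i) + norm (of_real t * (\<Sum>i\<le>n. c (Suc i) * of_real t ^ i))"
      using norm_triangle_ineq4[of "\<Sum>i\<le>Suc n. c i * of_real t ^ i" "of_real t * (\<Sum>i\<le>n. c (Suc i) * of_real t ^ i)"]
      unfolding split by simp
    ultimately show "norm (c 0) \<le> (1 + S) * t" by (simp add: algebra_simps)
  qed (use d in auto)
  then have c0: "c 0 = 0" by simp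
  have "c (Suc i) = 0" if "i \<le> n" for i
  proof (rule Suc.IH[of "\<lambda>i. c (Suc i)", OF _ that])
    fix e :: real assume "e > 0"
    then obtain \<delta> where d: "\<delta> > 0" "\<And>t. 0 < t \<Longrightarrow> t < \<delta> \<Longrightarrow> norm (\<Sum>i\<le>Suc n. c i * of_real t ^ i) \<le> e * t ^ Suc n"
      using Suc.prems(1)[of e] by auto
    have "norm (\<Sum>i\<le>n. c (Suc i) * of_real t ^ i) \<le> e * t ^ n" if t: "0 < t" "t < \<delta>" for t
    proof -
      have "t * norm (\<Sum>i\<le>n. c (Suc i) * of_real t ^ i) \<le> t * (e * t ^ n)"
        using d(2)[OF t] t unfolding split c0 by (simp add: norm_mult mult_ac)
      then show ?thesis using t by simp
    qed
    then show "\<exists>\<delta>>0. \<forall>t. 0 < t \<and> t < \<delta> \<longrightarrow> norm (\<Sum>i\<le>n. c (Suc i) * of_real t ^ i) \<le> e * t ^ n" using d(1) by blast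
  qed
  then show ?case using c0 Suc.prems(2) by (cases i) auto
qed

lemma norm_power_diff_le:
  fixes z w :: complex
  assumes "norm z \<le> B" "norm w \<le> B" "B \<ge> 1"
  shows "norm (z ^ p - w ^ p) \<le> real p * B ^ p * norm (z - w)"
proof (induction p)
  case (Suc p)
  have "norm (z ^ Suc p - w ^ Suc p) = norm (z * (z ^ p - w ^ p) + (z - w) * w ^ p)" by (simp add: algebra_simps)
  also have "\<dots> \<le> norm z * norm (z ^ p - w ^ p) + norm (z - w) * norm w ^ p"
    by (metis norm_mult norm_power norm_triangle_ineq)
  also have "\<dots> \<le> B * (real p * B ^ p * norm (z - w)) + norm (z - w) * B ^ Suc p"
  proof (intro add_mono mult_mono Suc)
    have "norm w ^ p \<le> B ^ p" using assms by (intro power_mono) auto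
    also have "\<dots> \<le> B ^ Suc p" using assms by (intro power_increasing) auto
    finally show "norm w ^ p \<le> B ^ Suc p" .
  qed (use assms in auto)
  finally show ?case by (simp add: algebra_simps)
qed simp

lemma fps_trunc_power_approx:
  fixes \<phi> :: "real \<Rightarrow> complex"
  assumes "\<And>t. \<bar>t\<bar> < \<delta> \<Longrightarrow> norm (\<phi> t - fps_trunc n G (of_real t)) \<le> C * \<bar>t\<bar> ^ (n + 1)" and d: "\<delta> \<le> 1"
  shows "\<exists>C'. \<forall>t. \<bar>t\<bar> < \<delta> \<longrightarrow> norm (\<phi> t ^ p - fps_trunc n (G ^ p) (of_real t)) \<le> C' * \<bar>t\<bar> ^ (n + 1)"
proof -
  define a where "a = (\<Sum>i\<le>n. norm (fps_nth G i))"
  have a: "norm (fps_nth G i) \<le> a" if "i \<le> n" for i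
    unfolding a_def by (rule member_le_sum) (use that in auto)
  have a0: "a \<ge> 0" unfolding a_def by (intro sum_nonneg) auto
  define B where "B = 1 + (real n + 1) * a + \<bar>C\<bar>"
  have B: "B \<ge> 1" using a0 by (simp add: B_def)
  define C' where "C' = real p * B ^ p * C + real p * (real n + 1) ^ (p + 2) * a ^ p"
  have "norm (\<phi> t ^ p - fps_trunc n (G ^ p) (of_real t)) \<le> C' * \<bar>t\<bar> ^ (n + 1)" if t: "\<bar>t\<bar> < \<delta>" for t
  proof -
    let ?T = "fps_trunc n G (of_real t)"
    have t1: "norm (complex_of_real t) \<le> 1" using t d by simp
    have T: "norm ?T \<le> (real n + 1) * a" by (rule norm_fps_trunc_le[OF a t1])
    have "C * \<bar>t\<bar> ^ (n + 1) \<le> \<bar>C\<bar> * 1" using t d by (intro mult_mono power_le_one) auto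
    then have "norm (\<phi> t - ?T) \<le> \<bar>C\<bar>" using assms(1)[OF t] by simp
    moreover have "norm (\<phi> t) \<le> norm ?T + norm (\<phi> t - ?T)" by (rule norm_triangle_sub)
    ultimately have "norm (\<phi> t) \<le> B" "norm ?T \<le> B" using T by (auto simp: B_def)
    then have "norm (\<phi> t ^ p - ?T ^ p) \<le> real p * B ^ p * norm (\<phi> t - ?T)"
      using B by (intro norm_power_diff_le)
    also have "\<dots> \<le> real p * B ^ p * (C * \<bar>t\<bar> ^ (n + 1))" using assms(1)[OF t] B by (intro mult_left_mono) auto
    finally have 1: "norm (\<phi> t ^ p - ?T ^ p) \<le> real p * B ^ p * (C * \<bar>t\<bar> ^ (n + 1))" .
    have 2: "norm (?T ^ p - fps_trunc n (G ^ p) (of_real t)) \<le> real p * (real n + 1) ^ (p + 2) * a ^ p * \<bar>t\<bar> ^ (n + 1)"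
      using fps_trunc_power[OF a t1, of n p] by simp
    from norm_diff_triangle_le[OF 1 2] show ?thesis by (simp add: C'_def algebra_simps)
  qed
  then show ?thesis by blast
qed

lemma fps_eq_if_trunc_close:
  assumes "\<And>n. \<exists>C \<delta>. \<delta> > 0 \<and> (\<forall>t. \<bar>t\<bar> < \<delta> \<longrightarrow> norm (fps_trunc n X (of_real t) - fps_trunc n Y (of_real t)) \<le> C * \<bar>t\<bar> ^ (n + 1))"
  shows "X = Y"
proof (rule fps_ext)
  fix n
  obtain C \<delta> where C: "\<delta> > 0" "\<And>t. \<bar>t\<bar> < \<delta> \<Longrightarrow> norm (fps_trunc n X (of_real t) - fps_trunc n Y (of_real t)) \<le> C * \<bar>t\<bar> ^ (n + 1)"
    using assms[of n] by blast
  have "fps_nth X n - fps_nth Y n = 0"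
  proof (rule poly_coeffs_zero_if_small[where n = n and c = "\<lambda>i. fps_nth X i - fps_nth Y i"])
    fix e :: real assume e: "e > 0"
    define d where "d = min \<delta> (e / (\<bar>C\<bar> + 1))"
    have "norm (\<Sum>i\<le>n. (fps_nth X i - fps_nth Y i) * of_real t ^ i) \<le> e * t ^ n" if t: "0 < t" "t < d" for t
    proof -
      have "norm (\<Sum>i\<le>n. (fps_nth X i - fps_nth Y i) * of_real t ^ i) \<le> C * t ^ (n + 1)"
        using C(2)[of t] t by (simp add: fps_trunc_def d_def left_diff_distrib sum_subtractf)
      also have "\<dots> \<le> ((\<bar>C\<bar> + 1) * t) * t ^ n" using t by (simp add: mult_right_mono)
      also have "(\<bar>C\<bar> + 1) * t \<le> e" using t by (simp add: d_def pos_less_divide_eq mult.commute)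
      finally show ?thesis using t by (simp add: mult_right_mono)
    qed
    moreover have "d > 0" using C(1) e by (simp add: d_def add_nonneg_pos)
    ultimately show "\<exists>\<delta>>0. \<forall>t. 0 < t \<and> t < \<delta> \<longrightarrow> norm (\<Sum>i\<le>n. (fps_nth X i - fps_nth Y i) * of_real t ^ i) \<le> e * t ^ n" by blast
  qed simp
  then show "fps_nth X n = fps_nth Y n" by simp
qed

text \<open>Formal power series over a field form a valuation ring, so divisibility is decided by
  the order of vanishing. The relation between the orders gives \<open>G dvd H\<close>, and
  \<open>F = H / G\<close> is the root.\<close>

lemma fps_cusp_root:
  fixes G H :: "complex fps"
  assumes j: "j \<ge> 1" and eq: "G ^ (j + 1) = H ^ j"
  obtains F where "F ^ j = G" "F ^ (j + 1) = H"
proof (cases "G = 0")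
  case True
  then have "H ^ j = 0" using eq[symmetric] by simp
  then have "H = 0" by simp
  then show ?thesis using that[of 0] True j by simp
next
  case False
  then have "H ^ j \<noteq> 0" unfolding eq[symmetric] by simp
  then have H: "H \<noteq> 0" using j by auto
  have sd: "(j + 1) * subdegree G = j * subdegree H" using arg_cong[OF eq, of subdegree] by (simp only: subdegree_power)
  have "j * subdegree G \<le> j * subdegree H" unfolding sd[symmetric] by simp
  then have "subdegree G \<le> subdegree H" using j by simp
  then have "G dvd H" using fps_dvd_iff[OF False H] by simp
  then obtain F where F: "H = G * F" by (elim dvdE)
  have "G ^ j * G = G ^ j * F ^ j" using eq by (simp add: F power_mult_distrib mult.commute)
  then have "G = F ^ j" using False by simp
  then show ?thesis using that[of F] F by simp
qed

text \<open>The factor \<open>u - T\<close> can be extracted as \<open>(u - T) * T ^ j = (u ^ (j +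
  1) - T ^ (j + 1)) - u * (u ^ j - T ^ j)\<close>, and likewise with \<open>u ^ j\<close>. As
  \<open>u - T\<close> is at most twice the larger of the two norms, closeness of both powers gives
  closeness of \<open>u\<close> and \<open>T\<close>, with the loss of a root of order
  \<open>j + 1\<close>.\<close>

lemma cusp_stability:
  fixes u T :: complex
  assumes j: "j \<ge> 1" and A: "norm u \<le> A" "norm T \<le> A"
    and E: "norm (u ^ j - T ^ j) \<le> E" "norm (u ^ (j + 1) - T ^ (j + 1)) \<le> E"
  shows "norm (u - T) ^ (j + 1) \<le> 2 ^ (j + 1) * (A + 1) * E"
proof -
  have A0: "A \<ge> 0" using A norm_ge_zero order_trans by blast
  have "(u - T) * T ^ j = (u ^ (j + 1) - T ^ (j + 1)) - u * (u ^ j - T ^ j)" by (simp add: algebra_simps)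
  then have "norm (u - T) * norm T ^ j \<le> norm (u ^ (j + 1) - T ^ (j + 1)) + norm u * norm (u ^ j - T ^ j)"
    by (metis norm_mult norm_power norm_triangle_ineq4)
  also have "\<dots> \<le> E + A * E" using A A0 E by (intro add_mono mult_mono) auto
  finally have 1: "norm (u - T) * norm T ^ j \<le> (A + 1) * E" by (simp add: algebra_simps)
  have "(u - T) * u ^ j = (u ^ (j + 1) - T ^ (j + 1)) - T * (u ^ j - T ^ j)" by (simp add: algebra_simps)
  then have "norm (u - T) * norm u ^ j \<le> norm (u ^ (j + 1) - T ^ (j + 1)) + norm T * norm (u ^ j - T ^ j)"
    by (metis norm_mult norm_power norm_triangle_ineq4)
  also have "\<dots> \<le> E + A * E" using A A0 E by (intro add_mono mult_mono) auto
  finally have 2: "norm (u - T) * norm u ^ j \<le> (A + 1) * E" by (simp add: algebra_simps)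
  define m where "m = max (norm u) (norm T)"
  have "norm (u - T) \<le> 2 * m" using norm_triangle_ineq4[of u T] by (simp add: m_def max_def)
  then have "norm (u - T) ^ j \<le> (2 * m) ^ j" by (intro power_mono) auto
  then have "norm (u - T) * norm (u - T) ^ j \<le> norm (u - T) * (2 * m) ^ j" by (intro mult_left_mono) auto
  also have "\<dots> = 2 ^ j * (norm (u - T) * m ^ j)" by (simp add: power_mult_distrib)
  also have "norm (u - T) * m ^ j \<le> (A + 1) * E" using 1 2 by (auto simp: m_def max_def)
  finally have "norm (u - T) ^ (j + 1) \<le> 2 ^ j * ((A + 1) * E)" by simp
  also have "\<dots> \<le> 2 ^ (j + 1) * ((A + 1) * E)"
  proof (rule mult_right_mono)
    have "E \<ge> 0" using E(1) norm_ge_zero order_trans by blast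
    then show "(A + 1) * E \<ge> 0" using A0 by simp
  qed simp
  finally show ?thesis by (simp add: mult_ac)
qed

text \<open>The root of order \<open>j + 1\<close> lost in \<open>cusp_stability\<close> explains
  the relation between \<open>n\<close> and \<open>K\<close>. The constant \<open>D\<close> depends
  only on the bounds, not on \<open>F\<close>, \<open>w\<close> or \<open>t\<close>; this makes the
  expansions uniform in the base point and the direction.\<close>

lemma cusp_root_approx:
  fixes b c A0 :: real and j K n :: nat
  assumes j: "j \<ge> 1" and n: "n + 1 = (K + 1) * (j + 1)" and c: "c \<ge> 0" and A0: "A0 \<ge> 0"
  obtains D where "\<And>(F :: complex fps) w t. (\<And>i. i \<le> n \<Longrightarrow> norm (fps_nth F i) \<le> b) \<Longrightarrow> norm w \<le> A0 \<Longrightarrow> \<bar>t\<bar> \<le> 1 \<Longrightarrow>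
     norm (w ^ j - fps_trunc n (F ^ j) (of_real t)) \<le> c * \<bar>t\<bar> ^ (n + 1) \<Longrightarrow>
     norm (w ^ (j + 1) - fps_trunc n (F ^ (j + 1)) (of_real t)) \<le> c * \<bar>t\<bar> ^ (n + 1) \<Longrightarrow>
     norm (w - fps_trunc K F (of_real t)) \<le> D * \<bar>t\<bar> ^ (K + 1)"
proof -
  define b1 where "b1 = max 1 b"
  define s where "s = real n + 1"
  define E0 where "E0 = c + real (j + 1) * s ^ (j + 3) * b1 ^ (j + 1)"
  define A where "A = max A0 (s * b1)"
  define C where "C = 2 * (A + 1) * (E0 + 1)"
  have s: "s \<ge> 1" by (simp add: s_def)
  have b1: "b1 \<ge> 1" by (simp add: b1_def)
  have E0: "E0 \<ge> 0" using c s b1 by (simp add: E0_def)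
  have A: "A \<ge> 0" using A0 by (simp add: A_def)
  have C: "C \<ge> 0" using A E0 by (simp add: C_def)
  have nK: "K \<le> n" using n by simp
  show ?thesis
  proof (rule that[of "C + s * b1"])
    fix F :: "complex fps" and w t
    assume F: "\<And>i. i \<le> n \<Longrightarrow> norm (fps_nth F i) \<le> b" and w: "norm w \<le> A0" and t: "\<bar>t\<bar> \<le> 1"
      and g: "norm (w ^ j - fps_trunc n (F ^ j) (of_real t)) \<le> c * \<bar>t\<bar> ^ (n + 1)"
      and h: "norm (w ^ (j + 1) - fps_trunc n (F ^ (j + 1)) (of_real t)) \<le> c * \<bar>t\<bar> ^ (n + 1)"
    let ?T = "fps_trunc n F (of_real t)" and ?y = "\<bar>t\<bar> ^ (n + 1)"
    have F1: "norm (fps_nth F i) \<le> b1" if "i \<le> n" for i using F[OF that] by (simp add: b1_def)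
    have t1: "norm (complex_of_real t) \<le> 1" using t by simp
    have T: "norm ?T \<le> A" using norm_fps_trunc_le[OF F1 t1, of n] by (simp add: A_def s_def)
    have P: "norm (?T ^ p - fps_trunc n (F ^ p) (of_real t)) \<le> real (j + 1) * s ^ (j + 3) * b1 ^ (j + 1) * ?y" if "p \<le> j + 1" for p
    proof -
      have "norm (?T ^ p - fps_trunc n (F ^ p) (of_real t)) \<le> real p * s ^ (p + 2) * b1 ^ p * ?y"
        using fps_trunc_power[OF F1 t1, of n p] by (simp add: s_def)
      also have "\<dots> \<le> real (j + 1) * s ^ (j + 3) * b1 ^ (j + 1) * ?y"
        using that s b1 by (intro mult_right_mono mult_mono power_increasing) auto
      finally show ?thesis .
    qed
    have e: "norm (w ^ p - ?T ^ p) \<le> E0 * ?y" if p: "p \<le> j + 1" and q: "norm (w ^ p - fps_trunc n (F ^ p) (of_real t)) \<le> c * ?y" for p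
      using norm_diff_triangle_le[OF q P[OF p, unfolded norm_minus_commute[of "?T ^ p"]]] by (simp add: E0_def distrib_right)
    have "norm (w - ?T) ^ (j + 1) \<le> 2 ^ (j + 1) * (A + 1) * (E0 * ?y)"
      by (rule cusp_stability[OF j _ T e[OF _ g] e[OF _ h]]) (use w in \<open>auto simp: A_def\<close>)
    also have "\<dots> \<le> 2 ^ (j + 1) * (A + 1) ^ (j + 1) * ((E0 + 1) ^ (j + 1) * ?y)"
    proof (intro mult_mono mult_right_mono)
      show "A + 1 \<le> (A + 1) ^ (j + 1)" using self_le_power[of "A + 1" "j + 1"] A by simp
      have "E0 + 1 \<le> (E0 + 1) ^ (j + 1)" using self_le_power[of "E0 + 1" "j + 1"] E0 by simp
      then show "E0 \<le> (E0 + 1) ^ (j + 1)" by linarith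
    qed (use A E0 in auto)
    also have "?y = (\<bar>t\<bar> ^ (K + 1)) ^ (j + 1)" unfolding n by (rule power_mult)
    also have "2 ^ (j + 1) * (A + 1) ^ (j + 1) * ((E0 + 1) ^ (j + 1) * (\<bar>t\<bar> ^ (K + 1)) ^ (j + 1)) = (C * \<bar>t\<bar> ^ (K + 1)) ^ (j + 1)"
      by (simp only: C_def power_mult_distrib mult.assoc)
    finally have "norm (w - ?T) ^ (j + 1) \<le> (C * \<bar>t\<bar> ^ (K + 1)) ^ (j + 1)" .
    then have 1: "norm (w - ?T) \<le> C * \<bar>t\<bar> ^ (K + 1)"
      using C by (subst (asm) power_mono_iff) auto
    have "?T - fps_trunc K F (of_real t) = (\<Sum>i\<in>{..n} - {..K}. fps_nth F i * of_real t ^ i)"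
      unfolding fps_trunc_def by (rule sum_diff[symmetric]) (use nK in auto)
    also have "norm \<dots> \<le> (\<Sum>i\<in>{..n} - {..K}. b1 * \<bar>t\<bar> ^ (K + 1))"
    proof (rule sum_norm_le)
      fix i assume i: "i \<in> {..n} - {..K}"
      have "norm (fps_nth F i) * \<bar>t\<bar> ^ i \<le> b1 * \<bar>t\<bar> ^ (K + 1)"
        using i t F1[of i] b1 by (intro mult_mono power_decreasing) auto
      then show "norm (fps_nth F i * of_real t ^ i) \<le> b1 * \<bar>t\<bar> ^ (K + 1)" by (simp add: norm_mult norm_power)
    qed
    also have "\<dots> \<le> (\<Sum>i\<in>{..n}. b1 * \<bar>t\<bar> ^ (K + 1))" using b1 by (intro sum_mono2) auto
    also have "\<dots> = s * b1 * \<bar>t\<bar> ^ (K + 1)" by (simp add: s_def algebra_simps)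
    finally have 2: "norm (?T - fps_trunc K F (of_real t)) \<le> s * b1 * \<bar>t\<bar> ^ (K + 1)" .
    from norm_diff_triangle_le[OF 1 2] show "norm (w - fps_trunc K F (of_real t)) \<le> (C + s * b1) * \<bar>t\<bar> ^ (K + 1)"
      by (simp add: distrib_right)
  qed
qed

section \<open>Smoothness from expansions along lines\<close>

abbreviation line_err :: "(real^'n::finite \<Rightarrow> complex) \<Rightarrow> real^'n \<Rightarrow> real^'n \<Rightarrow> nat \<Rightarrow> (nat \<Rightarrow> complex) \<Rightarrow> real \<Rightarrow> real" where
  "line_err u x v K a t \<equiv> norm (u (x + t *\<^sub>R v) - (\<Sum>i\<le>K. a i * of_real t ^ i))"

text \<open>This class of functions is closed under partial derivatives, so its members are smooth.\<close>
definition line_taylor :: "real \<Rightarrow> (real^'n::finite \<Rightarrow> complex) \<Rightarrow> bool" where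
  "line_taylor R u \<longleftrightarrow> (\<forall>r K. r < R \<longrightarrow> (\<exists>C \<delta>. \<delta> > 0 \<and> (\<forall>x v. norm x < r \<longrightarrow> norm v \<le> 1 \<longrightarrow>
     (\<exists>a. \<forall>t. \<bar>t\<bar> < \<delta> \<longrightarrow> line_err u x v K a t \<le> C * \<bar>t\<bar> ^ (K + 1)))))"

lemma line_taylorE:
  fixes u :: "real^'n::finite \<Rightarrow> complex"
  assumes "line_taylor R u" "r < R"
  obtains \<delta> C a where "\<delta> > 0" "C \<ge> 0" "\<And>x v t. norm x < r \<Longrightarrow> norm v \<le> 1 \<Longrightarrow> \<bar>t\<bar> < \<delta> \<Longrightarrow>
     line_err u x v K (a x v) t \<le> C * \<bar>t\<bar> ^ (K + 1)"
    "\<And>x v. norm x < r \<Longrightarrow> norm v \<le> 1 \<Longrightarrow> a x v 0 = u x"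
proof -
  obtain C \<delta> where d: "\<delta> > 0" and C: "\<forall>x v. norm x < r \<longrightarrow> norm v \<le> 1 \<longrightarrow>
     (\<exists>a. \<forall>t. \<bar>t\<bar> < \<delta> \<longrightarrow> line_err u x v K a t \<le> C * \<bar>t\<bar> ^ (K + 1))"
    using assms unfolding line_taylor_def by blast
  then obtain a where a: "\<And>x v t. norm x < r \<Longrightarrow> norm v \<le> 1 \<Longrightarrow> \<bar>t\<bar> < \<delta> \<Longrightarrow>
     line_err u x v K (a x v) t \<le> C * \<bar>t\<bar> ^ (K + 1)"
    by metis
  show ?thesis
  proof (rule that[of \<delta> "\<bar>C\<bar>" a])
    fix x v :: "real^'n" and t :: real assume x: "norm x < r" "norm v \<le> 1" "\<bar>t\<bar> < \<delta>"
    have "C * \<bar>t\<bar> ^ (K + 1) \<le> \<bar>C\<bar> * \<bar>t\<bar> ^ (K + 1)" by (intro mult_right_mono) auto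
    with a[OF x] show "line_err u x v K (a x v) t \<le> \<bar>C\<bar> * \<bar>t\<bar> ^ (K + 1)" by linarith
  next
    fix x v :: "real^'n" assume x: "norm x < r" "norm v \<le> 1"
    have "(\<Sum>i\<le>K. a x v i * of_real 0 ^ i) = (\<Sum>i\<le>K. if i = 0 then a x v 0 else 0)"
      by (intro sum.cong) auto
    then show "a x v 0 = u x" using a[OF x, of 0] d by simp
  qed (use d in auto)
qed

lemma line_taylor_continuous_on:
  assumes "line_taylor R u"
  shows "continuous_on (ball 0 R) u"
proof (rule continuous_at_imp_continuous_on, rule ballI)
  fix x :: "real^'a" assume "x \<in> ball 0 R"
  then obtain r where r: "norm x < r" "r < R" using dense by auto
  obtain \<delta> C a where d: "\<delta> > 0" "C \<ge> 0" and C: "\<And>x v t. norm x < r \<Longrightarrow> norm v \<le> 1 \<Longrightarrow> \<bar>t\<bar> < \<delta> \<Longrightarrow>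
     line_err u x v 0 (a x v) t \<le> C * \<bar>t\<bar> ^ (0 + 1)"
    "\<And>x v. norm x < r \<Longrightarrow> norm v \<le> 1 \<Longrightarrow> a x v 0 = u x"
    by (rule line_taylorE[OF assms r(2), where K=0]) (rule that; (assumption | blast))
  show "isCont u x"
    unfolding continuous_at_eps_delta
  proof (intro allI impI)
    fix e :: real assume e: "e > 0"
    show "\<exists>d>0. \<forall>x'. dist x' x < d \<longrightarrow> dist (u x') (u x) < e"
    proof (intro exI[of _ "min \<delta> (e / (C + 1))"] conjI allI impI)
      show "min \<delta> (e / (C + 1)) > 0" using d e by simp
      fix x' assume x': "dist x' x < min \<delta> (e / (C + 1))"
      define t where "t = norm (x' - x)"
      \<comment> \<open>For \<open>x' = x\<close> the division by zero gives \<open>v = 0\<close>,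
        which is still an admissible direction.\<close>
      define v where "v = (1 / t) *\<^sub>R (x' - x)"
      have xv: "x + t *\<^sub>R v = x'" "norm v \<le> 1" by (auto simp: v_def t_def)
      have t: "t \<ge> 0" "t < \<delta>" "t < e / (C + 1)" using x' by (auto simp: t_def dist_norm)
      have "norm (u x' - u x) \<le> C * t"
        using C(1)[OF r(1) xv(2), of t] C(2)[OF r(1) xv(2)] t xv(1) by simp
      also have "\<dots> \<le> (C + 1) * t" using t by (intro mult_right_mono) auto
      also have "\<dots> < e" using t(3) d by (simp add: pos_less_divide_eq mult.commute)
      finally show "dist (u x') (u x) < e" by (simp add: dist_norm)
    qed
  qed
qed

lemma has_vector_derivative_if_quadratic:
  fixes \<phi> :: "real \<Rightarrow> complex"
  assumes d: "\<delta> > 0" and C: "\<And>t. \<bar>t\<bar> < \<delta> \<Longrightarrow> norm (\<phi> t - \<phi> 0 - of_real t * D) \<le> C * \<bar>t\<bar> ^ 2"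
  shows "(\<phi> has_vector_derivative D) (at 0)"
  unfolding has_vector_derivative_def has_derivative_at_alt
proof (intro conjI allI impI)
  show "bounded_linear (\<lambda>h. h *\<^sub>R D)" by (rule bounded_linear_scaleR_left)
  fix e :: real assume e: "e > 0"
  show "\<exists>d>0. \<forall>y. norm (y - 0) < d \<longrightarrow> norm (\<phi> y - \<phi> 0 - (y - 0) *\<^sub>R D) \<le> e * norm (y - 0)"
  proof (intro exI[of _ "min \<delta> (e / (\<bar>C\<bar> + 1))"] conjI allI impI)
    show "min \<delta> (e / (\<bar>C\<bar> + 1)) > 0" using d e by (simp add: add_nonneg_pos)
    fix y :: real assume y: "norm (y - 0) < min \<delta> (e / (\<bar>C\<bar> + 1))"
    have "norm (\<phi> y - \<phi> 0 - (y - 0) *\<^sub>R D) \<le> C * \<bar>y\<bar> ^ 2"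
      using C[of y] y by (simp add: scaleR_conv_of_real)
    also have "\<dots> \<le> ((\<bar>C\<bar> + 1) * \<bar>y\<bar>) * \<bar>y\<bar>" unfolding power2_eq_square mult.assoc[symmetric] by (intro mult_right_mono) auto
    also have "\<dots> \<le> e * \<bar>y\<bar>"
    proof (rule mult_right_mono)
      have "\<bar>y\<bar> * (\<bar>C\<bar> + 1) < e" using y by (simp add: pos_less_divide_eq add_nonneg_pos)
      then show "(\<bar>C\<bar> + 1) * \<bar>y\<bar> \<le> e" by (simp add: mult.commute)
    qed simp
    finally show "norm (\<phi> y - \<phi> 0 - (y - 0) *\<^sub>R D) \<le> e * norm (y - 0)" by simp
  qed
qed

lemma quadratic_from_expansion:
  fixes \<phi> :: "real \<Rightarrow> complex"
  assumes d: "\<bar>t\<bar> \<le> 1" and C: "norm (\<phi> t - (\<Sum>i\<le>Suc K. a i * of_real t ^ i)) \<le> C * \<bar>t\<bar> ^ (Suc K + 1)" "C \<ge> 0"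
    and a: "a 0 = \<phi> 0"
  shows "norm (\<phi> t - \<phi> 0 - of_real t * a 1) \<le> (C + (\<Sum>i\<le>Suc K. norm (a i))) * \<bar>t\<bar> ^ 2"
proof -
  have s: "(\<Sum>i\<le>Suc K. a i * of_real t ^ i) = a 0 + of_real t * a 1 + (\<Sum>i\<in>{..Suc K} - {0, 1}. a i * of_real t ^ i)"
    by (subst sum.subset_diff[of "{0, 1}"]) (auto simp: mult.commute)
  have "norm (\<Sum>i\<in>{..Suc K} - {0, 1}. a i * of_real t ^ i) \<le> (\<Sum>i\<in>{..Suc K} - {0, 1}. norm (a i) * \<bar>t\<bar> ^ 2)"
  proof (rule sum_norm_le)
    fix i assume i: "i \<in> {..Suc K} - {0, 1}"
    have "norm (a i) * \<bar>t\<bar> ^ i \<le> norm (a i) * \<bar>t\<bar> ^ 2"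
      using i d by (intro mult_left_mono power_decreasing) auto
    then show "norm (a i * of_real t ^ i) \<le> norm (a i) * \<bar>t\<bar> ^ 2" by (simp add: norm_mult norm_power)
  qed
  also have "\<dots> \<le> (\<Sum>i\<le>Suc K. norm (a i) * \<bar>t\<bar> ^ 2)" by (intro sum_mono2) auto
  finally have 1: "norm (\<Sum>i\<in>{..Suc K} - {0, 1}. a i * of_real t ^ i) \<le> (\<Sum>i\<le>Suc K. norm (a i)) * \<bar>t\<bar> ^ 2"
    by (simp only: sum_distrib_right)
  have "C * \<bar>t\<bar> ^ (Suc K + 1) \<le> C * \<bar>t\<bar> ^ 2" using d C(2) by (intro mult_left_mono power_decreasing) auto
  then have "norm (\<phi> t - (\<Sum>i\<le>Suc K. a i * of_real t ^ i)) \<le> C * \<bar>t\<bar> ^ 2" using C(1) by linarith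
  moreover have "\<phi> t - \<phi> 0 - of_real t * a 1 = (\<phi> t - (\<Sum>i\<le>Suc K. a i * of_real t ^ i)) + (\<Sum>i\<in>{..Suc K} - {0, 1}. a i * of_real t ^ i)"
    unfolding s a by simp
  ultimately show ?thesis using norm_triangle_mono[OF _ 1] by (simp only: distrib_right)
qed

lemma pdiff_eq_expansion_coeff:
  assumes d: "\<delta> > 0" and C: "C \<ge> 0" "\<And>t. \<bar>t\<bar> < \<delta> \<Longrightarrow> norm (u (x + t *\<^sub>R axis e 1) - (\<Sum>i\<le>Suc K. a i * of_real t ^ i)) \<le> C * \<bar>t\<bar> ^ (Suc K + 1)"
    and a: "a 0 = u x"
  shows "((\<lambda>t. u (x + t *\<^sub>R axis e 1)) has_vector_derivative a 1) (at 0)" "pdiff e u x = a 1"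
proof -
  show "((\<lambda>t. u (x + t *\<^sub>R axis e 1)) has_vector_derivative a 1) (at 0)"
  proof (rule has_vector_derivative_if_quadratic[where \<delta> = "min \<delta> 1" and C = "C + (\<Sum>i\<le>Suc K. norm (a i))"])
    show "norm (u (x + t *\<^sub>R axis e 1) - u (x + 0 *\<^sub>R axis e 1) - of_real t * a 1) \<le> (C + (\<Sum>i\<le>Suc K. norm (a i))) * \<bar>t\<bar>\<^sup>2"
      if "\<bar>t\<bar> < min \<delta> 1" for t
      by (rule quadratic_from_expansion[where \<phi> = "\<lambda>t. u (x + t *\<^sub>R axis e 1)"]) (use that C a in auto)
  qed (use d in auto)
  then show "pdiff e u x = a 1" unfolding pdiff_def by (rule vector_derivative_at)
qed

lemma line_taylor_has_pdiff:
  assumes "line_taylor R u" "x \<in> ball 0 R"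
  shows "((\<lambda>t. u (x + t *\<^sub>R axis e 1)) has_vector_derivative pdiff e u x) (at 0)"
proof -
  obtain r where r: "norm x < r" "r < R" using dense assms(2) by auto
  obtain \<delta> C a where d: "\<delta> > 0" "C \<ge> 0" and C: "\<And>x v t. norm x < r \<Longrightarrow> norm v \<le> 1 \<Longrightarrow> \<bar>t\<bar> < \<delta> \<Longrightarrow>
     line_err u x v (Suc 0) (a x v) t \<le> C * \<bar>t\<bar> ^ (Suc 0 + 1)"
    "\<And>x v. norm x < r \<Longrightarrow> norm v \<le> 1 \<Longrightarrow> a x v 0 = u x"
    by (rule line_taylorE[OF assms(1) r(2), where K="Suc 0"]) (rule that; (assumption | blast))
  have ax: "norm (axis e 1 :: real^'a) \<le> 1" by simp
  show ?thesis
    using pdiff_eq_expansion_coeff[OF d C(1)[OF r(1) ax] C(2)[OF r(1) ax]] by simp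
qed

text \<open>The weights come from Richardson extrapolation: doubling the nodes cancels one more power.\<close>
lemma differentiation_weights:
  "\<exists>l :: (real \<times> real) list. \<forall>i\<le>Suc K. (\<Sum>(c, p)\<leftarrow>l. c * p ^ i) = (if i = 1 then 1 else 0)"
proof (induction K)
  case 0
  show ?case by (intro exI[of _ "[(1, 1), (-1, 0)]"]) (auto simp: le_Suc_eq)
next
  case (Suc K)
  then obtain l :: "(real \<times> real) list" where l: "\<And>i. i \<le> Suc K \<Longrightarrow> (\<Sum>(c, p)\<leftarrow>l. c * p ^ i) = (if i = 1 then 1 else 0)" by blast
  \<comment> \<open>Doubling the nodes multiplies the i-th moment by \<open>2 ^ i\<close>. The new
    combination multiplies it by \<open>(q - 2 ^ i) / (q - 2)\<close>, which is one for
    \<open>i = 1\<close> and zero for the new index \<open>i = K + 2\<close>; the moments that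
    vanished before still vanish.\<close>
  define q :: real where "q = 2 ^ Suc (Suc K)"
  have "(2::real) ^ K \<ge> 1" by simp
  then have q: "q - 2 > 0" unfolding q_def power_Suc by linarith
  define l' where "l' = map (\<lambda>(c, p). (q * c / (q - 2), p)) l @ map (\<lambda>(c, p). (- c / (q - 2), 2 * p)) l"
  have e: "(\<Sum>(c, p)\<leftarrow>l'. c * p ^ i) = (q - 2 ^ i) / (q - 2) * (\<Sum>(c, p)\<leftarrow>l. c * p ^ i)" for i
  proof -
    have 1: "(\<Sum>(c, p)\<leftarrow>map (\<lambda>(c, p). (q * c / (q - 2), p)) l. c * p ^ i) = q / (q - 2) * (\<Sum>(c, p)\<leftarrow>l. c * p ^ i)"
      by (induction l) (auto simp: algebra_simps)
    have 2: "(\<Sum>(c, p)\<leftarrow>map (\<lambda>(c, p). (- c / (q - 2), 2 * p)) l. c * p ^ i) = - (2 ^ i / (q - 2)) * (\<Sum>(c, p)\<leftarrow>l. c * p ^ i)"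
      by (induction l) (auto simp: algebra_simps power_mult_distrib)
    show ?thesis unfolding l'_def map_append sum_list_append 1 2 by (simp add: diff_divide_distrib left_diff_distrib)
  qed
  have "(\<Sum>(c, p)\<leftarrow>l'. c * p ^ i) = (if i = 1 then 1 else 0)" if i: "i \<le> Suc (Suc K)" for i
  proof (cases "i = Suc (Suc K)")
    case True
    then show ?thesis unfolding e by (simp add: q_def)
  next
    case False
    then show ?thesis unfolding e using l[of i] i q by simp
  qed
  then show ?case by blast
qed

lemma sum_list_norm_le:
  fixes g :: "'b \<Rightarrow> complex"
  assumes "\<And>x. x \<in> set l \<Longrightarrow> norm (g x) \<le> h x"
  shows "norm (\<Sum>x\<leftarrow>l. g x) \<le> (\<Sum>x\<leftarrow>l. h x)"
  using assms
proof (induction l)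
  case (Cons a l)
  then show ?case using norm_triangle_mono[of "g a" "h a" "\<Sum>x\<leftarrow>l. g x" "\<Sum>x\<leftarrow>l. h x"] by simp
qed simp

lemma sum_list_poly_swap:
  fixes b :: "'b \<Rightarrow> nat \<Rightarrow> complex"
  shows "(\<Sum>x\<leftarrow>l. g x * (\<Sum>i\<le>K. b x i * y ^ i)) = (\<Sum>i\<le>K. (\<Sum>x\<leftarrow>l. g x * b x i) * y ^ i)"
  by (induction l) (simp_all add: sum_distrib_left sum_distrib_right distrib_right sum.distrib mult.assoc)

text \<open>An expansion obtained after division by \<open>t\<close> says nothing at
  \<open>t = 0\<close>, so \<open>a 0 = p x\<close> needs a proof. From
  \<open>y = x + 2 * t *\<^sub>R v\<close>, in direction \<open>- v\<close>, the points
  \<open>x\<close> and \<open>x + t *\<^sub>R v\<close> both sit at nonzero parameters; the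
  expansion of order zero at \<open>y\<close> therefore compares \<open>p x\<close> with
  \<open>p (x + t *\<^sub>R v)\<close>, which tends to \<open>a 0\<close>.\<close>

lemma line_taylor_if_punctured:
  fixes p :: "real^'n::finite \<Rightarrow> complex"
  assumes P: "\<And>r K. r < R \<Longrightarrow> \<exists>C \<delta>. \<delta> > 0 \<and> C \<ge> 0 \<and> (\<forall>x v. norm x < r \<longrightarrow> norm v \<le> 1 \<longrightarrow>
     (\<exists>a. \<forall>t. t \<noteq> 0 \<longrightarrow> \<bar>t\<bar> < \<delta> \<longrightarrow> line_err p x v K a t \<le> C * \<bar>t\<bar> ^ (K + 1)))"
  shows "line_taylor R p"
  unfolding line_taylor_def
proof (intro allI impI)
  fix r :: real and K :: nat assume r: "r < R"
  define r1 where "r1 = (r + R) / 2"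
  have r1: "r < r1" "r1 < R" using r by (auto simp: r1_def)
  obtain C \<delta> where d: "\<delta> > 0" "C \<ge> 0" and C: "\<forall>x v. norm x < r \<longrightarrow> norm v \<le> 1 \<longrightarrow>
     (\<exists>a. \<forall>t. t \<noteq> 0 \<longrightarrow> \<bar>t\<bar> < \<delta> \<longrightarrow> line_err p x v K a t \<le> C * \<bar>t\<bar> ^ (K + 1))"
    using P[OF r, of K] by blast
  obtain C0 \<delta>0 where d0: "\<delta>0 > 0" "C0 \<ge> 0" and C0: "\<forall>x v. norm x < r1 \<longrightarrow> norm v \<le> 1 \<longrightarrow>
     (\<exists>a. \<forall>t. t \<noteq> 0 \<longrightarrow> \<bar>t\<bar> < \<delta>0 \<longrightarrow> line_err p x v 0 a t \<le> C0 * \<bar>t\<bar> ^ (0 + 1))"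
    using P[OF r1(2), of 0] by blast
  show "\<exists>C \<delta>. \<delta> > 0 \<and> (\<forall>x v. norm x < r \<longrightarrow> norm v \<le> 1 \<longrightarrow>
     (\<exists>a. \<forall>t. \<bar>t\<bar> < \<delta> \<longrightarrow> line_err p x v K a t \<le> C * \<bar>t\<bar> ^ (K + 1)))"
  proof (rule exI[of _ C], rule exI[of _ \<delta>], intro conjI allI impI)
    show "\<delta> > 0" by (rule d)
    fix x v :: "real^'n" assume x: "norm x < r" and v: "norm v \<le> 1"
    obtain a where a: "\<And>t. t \<noteq> 0 \<Longrightarrow> \<bar>t\<bar> < \<delta> \<Longrightarrow> line_err p x v K a t \<le> C * \<bar>t\<bar> ^ (K + 1)"
      using C x v by blast
    define S where "S = (\<Sum>i\<le>K. norm (a i))"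
    have z: "(\<Sum>i\<le>K. a i * of_real 0 ^ i) = a 0"
    proof -
      have "(\<Sum>i\<le>K. a i * of_real 0 ^ i) = (\<Sum>i\<le>K. if i = 0 then a 0 else 0)" by (intro sum.cong) auto
      then show ?thesis by simp
    qed
    have "norm (p x - a 0) \<le> 0"
    proof (rule le_zero_if_le_linear[where \<delta> = "min (min \<delta> 1) (min (\<delta>0 / 2) ((r1 - r) / 2))" and K = "3 * C0 + C + S"])
      show "min (min \<delta> 1) (min (\<delta>0 / 2) ((r1 - r) / 2)) > 0" using d d0 r1 by simp
      fix t :: real assume t: "0 < t" "t < min (min \<delta> 1) (min (\<delta>0 / 2) ((r1 - r) / 2))"
      have t': "t < \<delta>" "t < 1" "2 * t < \<delta>0" "2 * t < r1 - r" using t by auto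
      define y where "y = x + (2 * t) *\<^sub>R v"
      have "norm y \<le> norm x + 2 * t * norm v" unfolding y_def using t by (intro order_trans[OF norm_triangle_ineq]) simp
      also have "2 * t * norm v \<le> 2 * t * 1" using v t by (intro mult_left_mono) auto
      finally have y: "norm y < r1" using x t' by simp
      have "norm (- v) \<le> 1" using v by simp
      then obtain b where b: "\<And>s. s \<noteq> 0 \<Longrightarrow> \<bar>s\<bar> < \<delta>0 \<Longrightarrow> line_err p y (- v) 0 b s \<le> C0 * \<bar>s\<bar> ^ (0 + 1)"
        using C0 y by blast
      have "(2 * t) *\<^sub>R v = t *\<^sub>R v + t *\<^sub>R v" by (simp flip: scaleR_add_left)
      then have y2: "y + t *\<^sub>R (- v) = x + t *\<^sub>R v" by (simp add: y_def)
      have y1: "y + (2 * t) *\<^sub>R (- v) = x" by (simp add: y_def)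
      have b1: "norm (p x - b 0) \<le> C0 * (2 * t)" and b2: "norm (p (x + t *\<^sub>R v) - b 0) \<le> C0 * t"
        using b[of "2 * t"] b[of t] t t' unfolding y1 y2 by auto
      have "C * t ^ (K + 1) \<le> C * t"
        using d t t' by (intro mult_left_mono) (simp_all add: mult_left_le power_le_one)
      then have a1: "line_err p x v K a t \<le> C * t"
        using a[of t] t t' by auto
      have "(\<Sum>i\<le>K. a i * of_real t ^ i) - a 0 = (\<Sum>i\<le>K. a i * (of_real t ^ i - of_real 0 ^ i))"
        unfolding z[symmetric] by (simp add: sum_subtractf right_diff_distrib)
      also have "norm \<dots> \<le> (\<Sum>i\<le>K. norm (a i) * t)"
      proof (rule sum_norm_le)
        fix i
        have "norm (complex_of_real t ^ i - of_real 0 ^ i) \<le> t"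
        proof (cases i)
          case (Suc m)
          have "t * t ^ m \<le> t * 1" using t t' by (intro mult_left_mono power_le_one) auto
          then show ?thesis using t Suc by (simp add: norm_mult norm_power)
        qed (use t in auto)
        then show "norm (a i * (of_real t ^ i - of_real 0 ^ i)) \<le> norm (a i) * t"
          unfolding norm_mult by (rule mult_left_mono) simp
      qed
      finally have s1: "norm ((\<Sum>i\<le>K. a i * of_real t ^ i) - a 0) \<le> S * t" by (simp add: S_def sum_distrib_right)
      have "norm (p x - p (x + t *\<^sub>R v)) \<le> C0 * (2 * t) + C0 * t"
        by (rule norm_diff_triangle_le[OF b1]) (use b2 in \<open>simp add: norm_minus_commute\<close>)
      from norm_diff_triangle_le[OF norm_diff_triangle_le[OF this a1] s1]
      show "norm (p x - a 0) \<le> (3 * C0 + C + S) * t" by (simp add: algebra_simps)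
    qed
    then have a0: "a 0 = p x" by simp
    have "line_err p x v K a t \<le> C * \<bar>t\<bar> ^ (K + 1)" if "\<bar>t\<bar> < \<delta>" for t
      using a[OF _ that] z a0 by (cases "t = 0") auto
    then show "\<exists>a. \<forall>t. \<bar>t\<bar> < \<delta> \<longrightarrow> line_err p x v K a t \<le> C * \<bar>t\<bar> ^ (K + 1)"
      by blast
  qed
qed

text \<open>The weighted sum of the values \<open>u (y + (t * p) *\<^sub>R axis e 1)\<close> at
  \<open>y = x + t *\<^sub>R v\<close> is expanded twice. Seen from \<open>y\<close> along the axis,
  it is \<open>t\<close> times the partial derivative at \<open>y\<close>, up to order
  \<open>K + 2\<close>. Seen from \<open>x\<close>, the same points lie on the fixed lines in the
  directions \<open>v + p *\<^sub>R axis e 1\<close>, so it is a polynomial in \<open>t\<close> up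
  to that order. Comparison and division by \<open>t\<close> give the expansion of the
  derivative.\<close>

lemma line_taylor_pdiff:
  fixes u :: "real^'n::finite \<Rightarrow> complex"
  assumes u: "line_taylor R u"
  shows "line_taylor R (pdiff e u)"
proof (rule line_taylor_if_punctured)
  fix r :: real and K :: nat assume r: "r < R"
  define r1 where "r1 = (r + R) / 2"
  have r1: "r < r1" "r1 < R" using r by (auto simp: r1_def)
  obtain \<delta> C a where d: "\<delta> > 0" "C \<ge> 0" and C: "\<And>x v t. norm x < r1 \<Longrightarrow> norm v \<le> 1 \<Longrightarrow> \<bar>t\<bar> < \<delta> \<Longrightarrow>
     line_err u x v (Suc K) (a x v) t \<le> C * \<bar>t\<bar> ^ (Suc K + 1)"
    and a0: "\<And>x v. norm x < r1 \<Longrightarrow> norm v \<le> 1 \<Longrightarrow> a x v 0 = u x"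
    by (rule line_taylorE[OF u r1(2), where K="Suc K"]) (rule that; (assumption | blast))
  obtain l :: "(real \<times> real) list" where l: "\<And>i. i \<le> Suc K \<Longrightarrow> (\<Sum>(c, p)\<leftarrow>l. c * p ^ i) = (if i = 1 then 1 else 0)"
    using differentiation_weights by blast
  \<comment> \<open>Bounds the norm of every direction \<open>v + p *\<^sub>R axis e 1\<close> in
    use; dividing by \<open>A\<close> brings these directions into the unit ball.\<close>
  define A where "A = 1 + (\<Sum>cp\<leftarrow>l. \<bar>snd cp\<bar>)"
  define S where "S = (\<Sum>cp\<leftarrow>l. \<bar>fst cp\<bar>)"
  have nn: "0 \<le> (\<Sum>cp\<leftarrow>xs. \<bar>snd cp\<bar>)" "0 \<le> (\<Sum>cp\<leftarrow>xs. \<bar>fst cp\<bar>)" for xs :: "(real \<times> real) list"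
    by (induction xs) auto
  have lA: "\<bar>p\<bar> \<le> A - 1" if "(c, p) \<in> set l" for c p
  proof -
    have "cp \<in> set xs \<Longrightarrow> \<bar>snd cp\<bar> \<le> (\<Sum>cp\<leftarrow>xs. \<bar>snd cp\<bar>)" for cp and xs :: "(real \<times> real) list"
      by (induction xs) (auto intro: add_increasing nn)
    from this[OF that] have "\<bar>p\<bar> \<le> (\<Sum>cp\<leftarrow>l. \<bar>snd cp\<bar>)" by simp
    then show ?thesis by (simp add: A_def)
  qed
  have A1: "A \<ge> 1" unfolding A_def using nn(1)[of l] by linarith
  have S0: "S \<ge> 0" unfolding S_def by (rule nn(2))
  let ?e = "axis e 1 :: real^'n"
  have e1: "norm ?e \<le> 1" by simp
  define E where "E = S * (C * A ^ (Suc K + 1))"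
  define \<delta>' where "\<delta>' = min (\<delta> / A) (r1 - r)"
  have d': "\<delta>' > 0" using d A1 r1 by (simp add: \<delta>'_def)
  show "\<exists>C \<delta>. \<delta> > 0 \<and> C \<ge> 0 \<and> (\<forall>x v. norm x < r \<longrightarrow> norm v \<le> 1 \<longrightarrow>
     (\<exists>a. \<forall>t. t \<noteq> 0 \<longrightarrow> \<bar>t\<bar> < \<delta> \<longrightarrow> line_err (pdiff e u) x v K a t \<le> C * \<bar>t\<bar> ^ (K + 1)))"
  proof (rule exI[of _ "2 * E"], rule exI[of _ \<delta>'], intro conjI allI impI)
    show "\<delta>' > 0" by (rule d')
    show "2 * E \<ge> 0" using S0 d A1 by (simp add: E_def)
    fix x v :: "real^'n" assume x: "norm x < r" and v: "norm v \<le> 1"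
    define w where "w p = (1 / A) *\<^sub>R (v + p *\<^sub>R ?e)" for p
    define b where "b cp i = a x (w (snd cp)) i * of_real A ^ i" for cp :: "real \<times> real" and i
    define B where "B i = (\<Sum>cp\<leftarrow>l. of_real (fst cp) * b cp i)" for i
    have xr1: "norm x < r1" using x r1 by simp
    have main: "norm (of_real t * pdiff e u (x + t *\<^sub>R v) - (\<Sum>i\<le>Suc K. B i * of_real t ^ i)) \<le> 2 * E * \<bar>t\<bar> ^ (Suc K + 1)"
      if t: "\<bar>t\<bar> < \<delta>'" for t
    proof -
      define y where "y = x + t *\<^sub>R v"
      let ?u = "\<lambda>cp. u (y + (t * snd cp) *\<^sub>R ?e)" and ?E = "C * (A * \<bar>t\<bar>) ^ (Suc K + 1)"
      let ?PA = "\<lambda>cp. \<Sum>i\<le>Suc K. (a y ?e i * of_real (snd cp) ^ i) * of_real t ^ i"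
      let ?Pa = "\<lambda>cp. \<Sum>i\<le>Suc K. a y ?e i * of_real (t * snd cp) ^ i"
      let ?Pb = "\<lambda>cp. \<Sum>i\<le>Suc K. b cp i * of_real t ^ i"
      have tA: "\<bar>t\<bar> * A < \<delta>" using t A1 by (simp add: \<delta>'_def pos_less_divide_eq)
      have "norm y \<le> norm x + \<bar>t\<bar> * norm v" unfolding y_def by (intro order_trans[OF norm_triangle_ineq]) simp
      also have "\<bar>t\<bar> * norm v \<le> \<bar>t\<bar> * 1" using v by (intro mult_left_mono) auto
      finally have y: "norm y < r1" using x t by (simp add: \<delta>'_def)
      have p: "pdiff e u y = a y ?e 1"
        by (rule pdiff_eq_expansion_coeff(2)[OF d C[OF y e1] a0[OF y e1]])
      define V where "V = (\<Sum>cp\<leftarrow>l. of_real (fst cp) * ?u cp)"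
      have St: "(\<Sum>cp\<leftarrow>l. \<bar>fst cp\<bar> * ?E) = E * \<bar>t\<bar> ^ (Suc K + 1)"
        unfolding sum_list_mult_const by (simp add: E_def S_def case_prod_beta power_mult_distrib mult_ac)
      have 1: "norm (V - (\<Sum>cp\<leftarrow>l. of_real (fst cp) * ?PA cp)) \<le> E * \<bar>t\<bar> ^ (Suc K + 1)"
      proof -
        have "V - (\<Sum>cp\<leftarrow>l. of_real (fst cp) * ?PA cp)
          = (\<Sum>cp\<leftarrow>l. of_real (fst cp) * (?u cp - ?Pa cp))"
          unfolding V_def sum_list_subtractf[symmetric]
          by (intro arg_cong[of _ _ sum_list] map_cong refl) (simp only: right_diff_distrib power_mult_distrib of_real_mult mult_ac)
        also have "norm \<dots> \<le> (\<Sum>cp\<leftarrow>l. \<bar>fst cp\<bar> * ?E)"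
        proof (rule sum_list_norm_le)
          fix cp assume cp: "cp \<in> set l"
          have pA: "\<bar>snd cp\<bar> \<le> A" using lA[of "fst cp" "snd cp"] cp by simp
          have tp: "\<bar>t * snd cp\<bar> \<le> A * \<bar>t\<bar>" using mult_left_mono[OF pA abs_ge_zero[of t]] by (simp add: abs_mult mult.commute[of A])
          have "norm (?u cp - ?Pa cp) \<le> C * \<bar>t * snd cp\<bar> ^ (Suc K + 1)"
            using tp tA by (intro C y e1) (simp add: mult.commute)
          also have "\<dots> \<le> C * (A * \<bar>t\<bar>) ^ (Suc K + 1)" using tp d by (intro mult_left_mono power_mono) auto
          finally show "norm (of_real (fst cp) * (?u cp - ?Pa cp)) \<le> \<bar>fst cp\<bar> * ?E"
            unfolding norm_mult norm_of_real by (intro mult_left_mono) auto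
        qed
        finally show ?thesis unfolding St .
      qed
      have p1: "(\<Sum>cp\<leftarrow>l. of_real (fst cp) * ?PA cp) = of_real t * pdiff e u y"
      proof -
        have "(\<Sum>cp\<leftarrow>l. of_real (fst cp) * (a y ?e i * of_real (snd cp) ^ i)) = (if i = 1 then a y ?e 1 else 0)" if i: "i \<le> Suc K" for i
        proof -
          have "(\<Sum>cp\<leftarrow>l. of_real (fst cp) * (a y ?e i * of_real (snd cp) ^ i)) = a y ?e i * of_real (\<Sum>(c, p)\<leftarrow>l. c * p ^ i)"
            by (induction l) (auto simp: algebra_simps)
          then show ?thesis using l[OF i] by simp
        qed
        then have "(\<Sum>i\<le>Suc K. (\<Sum>cp\<leftarrow>l. of_real (fst cp) * (a y ?e i * of_real (snd cp) ^ i)) * of_real t ^ i) = (\<Sum>i\<le>Suc K. if i = 1 then a y ?e 1 * of_real t else 0)"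
          by (intro sum.cong) auto
        then show ?thesis unfolding sum_list_poly_swap p by (simp add: sum.delta mult.commute)
      qed
      have 2: "norm (V - (\<Sum>cp\<leftarrow>l. of_real (fst cp) * ?Pb cp)) \<le> E * \<bar>t\<bar> ^ (Suc K + 1)"
      proof -
        have "V - (\<Sum>cp\<leftarrow>l. of_real (fst cp) * ?Pb cp)
          = (\<Sum>cp\<leftarrow>l. of_real (fst cp) * (?u cp - ?Pb cp))"
          unfolding V_def sum_list_subtractf[symmetric] by (simp only: right_diff_distrib)
        also have "norm \<dots> \<le> (\<Sum>cp\<leftarrow>l. \<bar>fst cp\<bar> * ?E)"
        proof (rule sum_list_norm_le)
          fix cp assume cp: "cp \<in> set l"
          have "norm (v + snd cp *\<^sub>R ?e) \<le> norm v + \<bar>snd cp\<bar> * norm ?e" by (intro order_trans[OF norm_triangle_ineq]) simp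
          also have "\<dots> \<le> A" using lA[of "fst cp" "snd cp"] cp v by simp
          finally have w: "norm (w (snd cp)) \<le> 1" using A1 by (simp add: w_def)
          have yx: "y + (t * snd cp) *\<^sub>R ?e = x + (t * A) *\<^sub>R w (snd cp)"
            using A1 by (simp add: y_def w_def scaleR_add_right)
          have s: "?Pb cp = (\<Sum>i\<le>Suc K. a x (w (snd cp)) i * of_real (t * A) ^ i)"
            by (intro sum.cong) (simp_all only: b_def of_real_mult power_mult_distrib mult_ac)
          have "\<bar>t * A\<bar> < \<delta>" using tA A1 by (simp add: abs_mult)
          from C[OF xr1 w this]
          have "norm (?u cp - ?Pb cp) \<le> C * (A * \<bar>t\<bar>) ^ (Suc K + 1)"
            using A1 unfolding yx s by (simp add: abs_mult mult.commute)
          then show "norm (of_real (fst cp) * (?u cp - ?Pb cp)) \<le> \<bar>fst cp\<bar> * ?E"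
            unfolding norm_mult norm_of_real by (intro mult_left_mono) auto
        qed
        finally show ?thesis unfolding St .
      qed
      have p2: "(\<Sum>cp\<leftarrow>l. of_real (fst cp) * ?Pb cp) = (\<Sum>i\<le>Suc K. B i * of_real t ^ i)"
        unfolding sum_list_poly_swap B_def ..
      from norm_diff_triangle_le[OF 1[unfolded p1 norm_minus_commute[of V]] 2[unfolded p2]]
      show ?thesis by (simp add: y_def)
    qed
    \<comment> \<open>The case \<open>t = 0\<close> of \<open>main\<close>; it is what permits the
      division by \<open>t\<close>.\<close>
    have B0: "B 0 = 0"
    proof -
      have "(\<Sum>i\<le>Suc K. B i * of_real 0 ^ i) = (\<Sum>i\<le>Suc K. if i = 0 then B 0 else 0)" by (intro sum.cong) auto
      then show ?thesis using main[of 0] d' by simp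
    qed
    have "line_err (pdiff e u) x v K (\<lambda>i. B (Suc i)) t \<le> 2 * E * \<bar>t\<bar> ^ (K + 1)"
      if t: "t \<noteq> 0" "\<bar>t\<bar> < \<delta>'" for t
    proof -
      have "(\<Sum>i\<le>Suc K. B i * of_real t ^ i) = of_real t * (\<Sum>i\<le>K. B (Suc i) * of_real t ^ i)"
        by (subst sum.atMost_Suc_shift) (simp add: B0 sum_distrib_left mult_ac)
      then have "norm (of_real t * (pdiff e u (x + t *\<^sub>R v) - (\<Sum>i\<le>K. B (Suc i) * of_real t ^ i))) \<le> 2 * E * \<bar>t\<bar> ^ (Suc K + 1)"
        using main[OF t(2)] by (simp add: right_diff_distrib)
      then have "\<bar>t\<bar> * line_err (pdiff e u) x v K (\<lambda>i. B (Suc i)) t \<le> \<bar>t\<bar> * (2 * E * \<bar>t\<bar> ^ (K + 1))"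
        by (simp add: norm_mult mult_ac)
      then show ?thesis using t by simp
    qed
    then show "\<exists>a. \<forall>t. t \<noteq> 0 \<longrightarrow> \<bar>t\<bar> < \<delta>' \<longrightarrow> line_err (pdiff e u) x v K a t \<le> 2 * E * \<bar>t\<bar> ^ (K + 1)"
      by (intro exI[of _ "\<lambda>i. B (Suc i)"]) blast
  qed
qed

lemma line_taylor_pdiffs: "line_taylor R u \<Longrightarrow> line_taylor R (pdiffs is u)"
  by (induction "is") (auto intro: line_taylor_pdiff)

lemma line_taylor_smooth_on:
  assumes "line_taylor R u"
  shows "smooth_on (ball 0 R) u"
  unfolding smooth_on_def
proof (intro allI conjI ballI)
  fix "is" :: "'a list"
  show "continuous_on (ball 0 R) (pdiffs is u)"
    by (intro line_taylor_continuous_on line_taylor_pdiffs assms)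
  fix i and x :: "real^'a" assume "x \<in> ball 0 R"
  then show "((\<lambda>t. pdiffs is u (x + t *\<^sub>R axis i 1)) has_vector_derivative pdiffs (i # is) u x) (at 0)"
    using line_taylor_has_pdiff[OF line_taylor_pdiffs[OF assms]] by simp
qed

section \<open>Mixed differences and polarization\<close>

fun fdiff :: "real \<Rightarrow> 'n::finite list \<Rightarrow> (real^'n \<Rightarrow> complex) \<Rightarrow> real^'n \<Rightarrow> complex" where
  "fdiff t [] u y = u y"
| "fdiff t (i # is) u y = fdiff t is u (y + t *\<^sub>R axis i 1) - fdiff t is u y"

lemma fdiff_snoc: "fdiff t (is @ [i]) u y = fdiff t is u (y + t *\<^sub>R axis i 1) - fdiff t is u y"
proof (induction "is" arbitrary: y)
  case (Cons a "is")
  have "y + t *\<^sub>R axis i 1 + t *\<^sub>R axis a 1 = y + t *\<^sub>R axis a 1 + t *\<^sub>R axis i 1" by (simp add: add_ac)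
  then show ?case unfolding append_Cons fdiff.simps Cons by (simp only:) simp
qed simp

text \<open>Bookkeeping for the inductions on differences: all points visited by a difference over a
  word lie within its length times \<open>t\<close> of the base point.\<close>

lemma norm_diff_cons_le:
  fixes t :: real and z w :: "real^'n::finite"
  assumes t: "t \<ge> 0" and z: "norm (z - w) \<le> length is * t \<or> norm (z - (w + t *\<^sub>R axis j 1)) \<le> length is * t"
  shows "norm (z - w) \<le> length (j # is) * t"
proof -
  let ?a = "t *\<^sub>R axis j 1 :: real^'n"
  have "norm (z - w) \<le> norm (z - (w + ?a)) + norm ?a"
    using norm_triangle_ineq[of "z - (w + ?a)" ?a] by simp
  then show ?thesis using z t by (auto simp: algebra_simps)
qed

lemma fdiff_has_vector_derivative:
  fixes t :: real and u :: "real^'n::finite \<Rightarrow> complex"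
  assumes t: "t \<ge> 0"
    and u: "\<And>z. norm (z - w) \<le> length is * t \<Longrightarrow> ((\<lambda>s. u (z + s *\<^sub>R e)) has_vector_derivative D z) (at 0)"
  shows "((\<lambda>s. fdiff t is u (w + s *\<^sub>R e)) has_vector_derivative fdiff t is D w) (at 0)"
  using u
proof (induction "is" arbitrary: w)
  case Nil
  then show ?case by simp
next
  case (Cons j "is")
  let ?a = "t *\<^sub>R axis j 1 :: real^'n"
  have 1: "((\<lambda>s. fdiff t is u ((w + ?a) + s *\<^sub>R e)) has_vector_derivative fdiff t is D (w + ?a)) (at 0)"
    by (rule Cons.IH, rule Cons.prems, rule norm_diff_cons_le[OF t disjI2])
  have 2: "((\<lambda>s. fdiff t is u (w + s *\<^sub>R e)) has_vector_derivative fdiff t is D w) (at 0)"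
    by (rule Cons.IH, rule Cons.prems, rule norm_diff_cons_le[OF t disjI1])
  from has_vector_derivative_diff[OF 1 2] show ?case by (simp add: algebra_simps)
qed

text \<open>The base point \<open>y\<close> varies near \<open>x\<close> because the induction needs
  this: the last difference is estimated by the mean value inequality along a segment, at whose
  points the shorter difference of \<open>pdiff i u\<close> must be controlled. Induction from the
  right fits \<open>pdiffs (is @ [i]) u = pdiffs is (pdiff i u)\<close>.\<close>

lemma fdiff_limit:
  fixes u :: "real^'n::finite \<Rightarrow> complex"
  assumes "line_taylor R u" and x: "x \<in> ball 0 R" and "\<epsilon> > 0"
  shows "\<exists>\<delta>>0. \<forall>y t. norm (y - x) < \<delta> \<longrightarrow> 0 < t \<longrightarrow> t < \<delta> \<longrightarrow>
     norm (fdiff t is u y - of_real t ^ length is * pdiffs is u x) \<le> \<epsilon> * t ^ length is"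
  using assms(1,3)
proof (induction "is" arbitrary: u \<epsilon> rule: rev_induct)
  case Nil
  have "isCont u x" using line_taylor_continuous_on[OF Nil(1)] x
    by (simp add: continuous_on_eq_continuous_at)
  then obtain d where "d > 0" "\<And>y. dist y x < d \<Longrightarrow> dist (u y) (u x) < \<epsilon>"
    using Nil(2) unfolding continuous_at_eps_delta by blast
  then show ?case by (intro exI[of _ d]) (auto simp: dist_norm less_imp_le)
next
  case (snoc i "is")
  let ?k = "length is" and ?e = "axis i 1 :: real^'n" and ?L = "pdiffs is (pdiff i u) x"
  have L: "pdiffs (is @ [i]) u = pdiffs is (pdiff i u)" by (induction "is") simp_all
  obtain d1 where d1: "d1 > 0" "\<And>y t. norm (y - x) < d1 \<Longrightarrow> 0 < t \<Longrightarrow> t < d1 \<Longrightarrow>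
     norm (fdiff t is (pdiff i u) y - of_real t ^ ?k * ?L) \<le> \<epsilon> * t ^ ?k"
    using snoc.IH[OF line_taylor_pdiff[OF snoc.prems(1)] snoc.prems(2)] by blast
  \<comment> \<open>On the segment the base point is within \<open>2 * \<delta>\<close> of
    \<open>x\<close>, and the difference reaches at most \<open>?k * t\<close> further, so all
    points stay inside the ball.\<close>
  define \<delta> where "\<delta> = min (d1 / 2) ((R - norm x) / (real ?k + 3))"
  have dp: "\<delta> > 0" using d1 x by (simp add: \<delta>_def)
  have dd: "2 * \<delta> \<le> d1" by (simp add: \<delta>_def)
  have "\<delta> \<le> (R - norm x) / (real ?k + 3)" by (simp add: \<delta>_def)
  then have dk: "(real ?k + 3) * \<delta> \<le> R - norm x" by (simp add: pos_le_divide_eq mult.commute)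
  have "norm (fdiff t (is @ [i]) u y - of_real t ^ length (is @ [i]) * pdiffs (is @ [i]) u x) \<le> \<epsilon> * t ^ length (is @ [i])"
    if y: "norm (y - x) < \<delta>" and t: "0 < t" "t < \<delta>" for y t
  proof -
    define h where "h s = fdiff t is u (y + s *\<^sub>R ?e) - s *\<^sub>R (of_real t ^ ?k * ?L)" for s
    have "norm (h t - h 0) \<le> (\<epsilon> * t ^ ?k) * \<bar>t - 0\<bar>"
    proof (rule vector_derivative_norm_bound[where S = "{0..t}" and f' = "\<lambda>s. fdiff t is (pdiff i u) (y + s *\<^sub>R ?e) - of_real t ^ ?k * ?L"])
      fix s assume s: "s \<in> {0..t}"
      define w where "w = y + s *\<^sub>R ?e"
      have wx: "norm (w - x) < 2 * \<delta>"
      proof -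
        have "norm (w - x) \<le> norm (y - x) + norm (s *\<^sub>R ?e)"
          unfolding w_def using norm_triangle_ineq[of "y - x" "s *\<^sub>R ?e"] by (simp add: algebra_simps)
        then show ?thesis using y s t by simp
      qed
      have "((\<lambda>s'. fdiff t is u (w + s' *\<^sub>R ?e)) has_vector_derivative fdiff t is (pdiff i u) w) (at 0)"
      proof (rule fdiff_has_vector_derivative)
        fix z assume z: "norm (z - w) \<le> real ?k * t"
        have "norm z \<le> norm x + norm (w - x) + norm (z - w)"
          using norm_triangle_ineq[of "x + (w - x)" "z - w"] norm_triangle_ineq[of x "w - x"] by simp
        moreover have "real ?k * t \<le> real ?k * \<delta>" using t by (intro mult_left_mono) auto
        ultimately have "norm z < norm x + (real ?k + 3) * \<delta>" using wx z dp by (simp add: distrib_right)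
        then have "z \<in> ball 0 R" using dk by simp
        then show "((\<lambda>s. u (z + s *\<^sub>R ?e)) has_vector_derivative pdiff i u z) (at 0)"
          by (rule line_taylor_has_pdiff[OF snoc.prems(1)])
      qed (use t in simp)
      then have "((\<lambda>s. fdiff t is u (y + s *\<^sub>R ?e)) has_vector_derivative fdiff t is (pdiff i u) w) (at s within {0..t})"
        unfolding w_def by (rule has_vector_derivative_shift_line)
      then show "(h has_vector_derivative fdiff t is (pdiff i u) (y + s *\<^sub>R ?e) - of_real t ^ ?k * ?L) (at s within {0..t})"
        unfolding h_def w_def by (auto intro!: derivative_eq_intros)
      show "norm (fdiff t is (pdiff i u) (y + s *\<^sub>R ?e) - of_real t ^ ?k * ?L) \<le> \<epsilon> * t ^ ?k"
        using d1(2)[of w t] wx dd t y dp by (simp add: w_def)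
    qed (use t in auto)
    moreover have "h t - h 0 = fdiff t (is @ [i]) u y - of_real t ^ length (is @ [i]) * pdiffs (is @ [i]) u x"
      by (simp add: h_def fdiff_snoc L scaleR_conv_of_real mult_ac)
    ultimately show ?thesis using t by (simp add: mult_ac)
  qed
  then show ?case using dp by blast
qed

lemma norm_fdiff_le:
  fixes t :: real
  assumes "\<And>w. norm (w - y) \<le> length is * t \<Longrightarrow> norm (\<phi> w) \<le> B" and t: "t \<ge> 0"
  shows "norm (fdiff t is \<phi> y) \<le> 2 ^ length is * B"
  using assms(1)
proof (induction "is" arbitrary: y)
  case Nil
  then show ?case by simp
next
  case (Cons j "is")
  let ?a = "t *\<^sub>R axis j 1 :: real^'a"
  have 1: "norm (fdiff t is \<phi> (y + ?a)) \<le> 2 ^ length is * B"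
    by (rule Cons.IH, rule Cons.prems, rule norm_diff_cons_le[OF t disjI2])
  have 2: "norm (fdiff t is \<phi> y) \<le> 2 ^ length is * B"
    by (rule Cons.IH, rule Cons.prems, rule norm_diff_cons_le[OF t disjI1])
  from norm_triangle_le_diff[of "fdiff t is \<phi> (y + ?a)" "fdiff t is \<phi> y", OF order_trans[OF add_mono[OF 1 2] order_refl]]
  show ?case by (simp add: mult_ac)
qed

lemma fdiff_rescale: "fdiff t is u (x + t *\<^sub>R w) = fdiff 1 is (\<lambda>w. u (x + t *\<^sub>R w)) w"
proof (induction "is" arbitrary: w)
  case (Cons i "is")
  have eq: "x + t *\<^sub>R w + t *\<^sub>R axis i 1 = x + t *\<^sub>R (w + axis i 1)" by (simp add: scaleR_add_right)
  show ?case unfolding fdiff.simps scaleR_one eq Cons ..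
qed simp

lemma fdiff_poly: "fdiff t is (\<lambda>w. u w - (\<Sum>i\<le>K. a i w * c i)) y = fdiff t is u y - (\<Sum>i\<le>K. fdiff t is (a i) y * c i)"
  by (induction "is" arbitrary: y) (simp_all add: left_diff_distrib sum_subtractf)

text \<open>Polarization: a mixed partial derivative is a limit of mixed differences, which only involve
  the expansions at \<open>x\<close> along finitely many directions.\<close>
lemma norm_pdiffs_le_of_expansions:
  fixes u :: "real^'n::finite \<Rightarrow> complex"
  assumes u: "line_taylor R u" and x: "x \<in> ball 0 R" and k: "k = length is"
    and a: "\<And>w t. norm w \<le> k \<Longrightarrow> 0 < t \<Longrightarrow> t < \<delta> \<Longrightarrow>
        norm (u (x + t *\<^sub>R w) - (\<Sum>i\<le>k. a i w * of_real t ^ i)) \<le> C * t ^ (k + 1)"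
    and d: "\<delta> > 0" and B: "\<And>w. norm w \<le> k \<Longrightarrow> norm (a k w) \<le> B"
  shows "norm (pdiffs is u x) \<le> 2 ^ k * B"
proof -
  define L where "L = pdiffs is u x"
  define S where "S i = fdiff 1 is (a i) 0" for i
  \<comment> \<open>The mixed difference of \<open>u\<close> at \<open>x\<close> is a polynomial in
    \<open>t\<close> with coefficients \<open>S i\<close>, up to order \<open>k + 1\<close>, and
    also \<open>t ^ k * L\<close> up to \<open>o(t^k)\<close>. So the coefficients agree up to index
    \<open>k\<close>; the condition \<open>k = k\<close> is the instance \<open>i = k\<close> of
    that comparison.\<close>
  have "S k - (if k = k then L else 0) = 0"
  proof (rule poly_coeffs_zero_if_small[where n = k and c = "\<lambda>i. S i - (if i = k then L else 0)"])
    fix \<epsilon> :: real assume e: "\<epsilon> > 0"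
    obtain d1 where d1: "d1 > 0" "\<And>t. 0 < t \<Longrightarrow> t < d1 \<Longrightarrow> norm (fdiff t is u x - of_real t ^ k * L) \<le> \<epsilon> / 2 * t ^ k"
      using fdiff_limit[OF u x, of "\<epsilon> / 2" "is"] e unfolding k L_def by (metis half_gt_zero norm_zero right_minus_eq)
    define C' where "C' = 2 ^ k * \<bar>C\<bar>"
    define d2 where "d2 = min (min d1 \<delta>) (\<epsilon> / (2 * (C' + 1)))"
    have C': "C' \<ge> 0" by (simp add: C'_def)
    have "norm (\<Sum>i\<le>k. (S i - (if i = k then L else 0)) * of_real t ^ i) \<le> \<epsilon> * t ^ k" if t: "0 < t" "t < d2" for t
    proof -
      have t': "t < d1" "t < \<delta>" "t < \<epsilon> / (2 * (C' + 1))" using t by (auto simp: d2_def)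
      have "fdiff t is u x - (\<Sum>i\<le>k. S i * of_real t ^ i) = fdiff 1 is (\<lambda>w. u (x + t *\<^sub>R w) - (\<Sum>i\<le>k. a i w * of_real t ^ i)) 0"
        using fdiff_rescale[of t "is" u x 0] by (simp add: fdiff_poly S_def)
      moreover have "norm (fdiff 1 is (\<lambda>w. u (x + t *\<^sub>R w) - (\<Sum>i\<le>k. a i w * of_real t ^ i)) 0) \<le> 2 ^ length is * (\<bar>C\<bar> * t ^ (k + 1))"
      proof (rule norm_fdiff_le)
        fix w :: "real^'n" assume "norm (w - 0) \<le> real (length is) * 1"
        then have "norm (u (x + t *\<^sub>R w) - (\<Sum>i\<le>k. a i w * of_real t ^ i)) \<le> C * t ^ (k + 1)"
          using t t' k by (intro a) auto
        also have "\<dots> \<le> \<bar>C\<bar> * t ^ (k + 1)" using t by (intro mult_right_mono) auto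
        finally show "norm (u (x + t *\<^sub>R w) - (\<Sum>i\<le>k. a i w * of_real t ^ i)) \<le> \<bar>C\<bar> * t ^ (k + 1)" .
      qed simp
      ultimately have 1: "norm (fdiff t is u x - (\<Sum>i\<le>k. S i * of_real t ^ i)) \<le> C' * t ^ (k + 1)"
        by (simp add: C'_def k mult_ac)
      have "C' * t \<le> \<epsilon> / 2"
      proof -
        have "t * (2 * (C' + 1)) < \<epsilon>" using t' C' by (simp add: pos_less_divide_eq)
        then show ?thesis using t by (simp add: algebra_simps)
      qed
      then have "(C' * t) * t ^ k \<le> \<epsilon> / 2 * t ^ k" using t by (intro mult_right_mono) auto
      with 1 have 2: "norm (fdiff t is u x - (\<Sum>i\<le>k. S i * of_real t ^ i)) \<le> \<epsilon> / 2 * t ^ k" by (simp add: mult_ac)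
      have "(\<Sum>i\<le>k. (S i - (if i = k then L else 0)) * of_real t ^ i) = (\<Sum>i\<le>k. S i * of_real t ^ i) - of_real t ^ k * L"
      proof -
        have "(\<Sum>i\<le>k. (if i = k then L else 0) * of_real t ^ i) = (\<Sum>i\<le>k. if i = k then of_real t ^ k * L else 0)"
          by (intro sum.cong) auto
        then show ?thesis by (simp add: left_diff_distrib sum_subtractf)
      qed
      moreover have "norm ((\<Sum>i\<le>k. S i * of_real t ^ i) - of_real t ^ k * L) \<le> \<epsilon> / 2 * t ^ k + \<epsilon> / 2 * t ^ k"
        by (rule norm_diff_triangle_le[OF 2[unfolded norm_minus_commute[of "fdiff t is u x"]] d1(2)[OF t(1) t'(1)]])
      moreover have "\<epsilon> / 2 * t ^ k + \<epsilon> / 2 * t ^ k = \<epsilon> * t ^ k" by simp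
      ultimately show ?thesis by (simp only:)
    qed
    moreover have "d2 > 0" using d d1 e C' by (simp add: d2_def add_nonneg_pos)
    ultimately show "\<exists>\<delta>>0. \<forall>t. 0 < t \<and> t < \<delta> \<longrightarrow> norm (\<Sum>i\<le>k. (S i - (if i = k then L else 0)) * of_real t ^ i) \<le> \<epsilon> * t ^ k"
      by blast
  qed simp
  then have "L = S k" by simp
  moreover have "norm (S k) \<le> 2 ^ length is * B"
    unfolding S_def by (rule norm_fdiff_le) (use B k in auto)
  ultimately show ?thesis by (simp add: L_def k)
qed

section \<open>The division property\<close>

context
  fixes M :: "nat \<Rightarrow> real" and f :: "real^'n::finite \<Rightarrow> complex" and j :: nat and R K \<sigma> :: real
  assumes M: "weight_seq M" and I: "intersectable M" and G: "moderate_growth M"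
    and j: "j \<ge> 1" and R: "R > 0" and K: "K \<ge> 1" and \<sigma>: "\<sigma> > 0"
    and g: "smooth_on (ball 0 R) (\<lambda>x. f x ^ j)" and h: "smooth_on (ball 0 R) (\<lambda>x. f x ^ (j + 1))"
    and gb: "\<And>is y. y \<in> ball 0 R \<Longrightarrow> norm (pdiffs is (\<lambda>x. f x ^ j) y) \<le> K * (\<sigma> ^ length is * M (length is))"
    and hb: "\<And>is y. y \<in> ball 0 R \<Longrightarrow> norm (pdiffs is (\<lambda>x. f x ^ (j + 1)) y) \<le> K * (\<sigma> ^ length is * M (length is))"
begin

abbreviation "lpow p v x \<equiv> line_fps v (\<lambda>x. f x ^ p) x"

text \<open>The candidate for the Taylor series of \<open>f\<close> along a line, available before
  any smoothness of \<open>f\<close> is known.\<close>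

definition root_fps :: "real^'n \<Rightarrow> real^'n \<Rightarrow> complex fps" where
  "root_fps v x = (SOME F. F ^ j = lpow j v x \<and> F ^ (j + 1) = lpow (j + 1) v x)"

lemma line_pow_taylor:
  assumes p: "p \<in> {j, j + 1}" and v: "norm v \<le> 1" and x: "norm x < r" and t: "\<bar>t\<bar> < R - r"
  shows "norm (f (x + t *\<^sub>R v) ^ p - fps_trunc n (lpow p v x) (of_real t))
     \<le> CARD('n) ^ (n + 1) * (K * (\<sigma> ^ (n + 1) * M (n + 1))) * \<bar>t\<bar> ^ (n + 1)"
proof -
  have "smooth_on (ball 0 R) (\<lambda>x. f x ^ p)" using g h p by auto
  then show ?thesis
  proof (rule line_fps_taylor[OF _ v x t])
    fix "is" :: "'n list" and y :: "real^'n" assume y: "y \<in> ball 0 R" and l: "length is = n + 1"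
    from p have "p = j \<or> p = j + 1" by simp
    then show "norm (pdiffs is (\<lambda>x. f x ^ p) y) \<le> K * (\<sigma> ^ (n + 1) * M (n + 1))"
      using gb[OF y, of "is"] hb[OF y, of "is"] unfolding l by (elim disjE) (simp_all only:)
  qed
qed

text \<open>\<open>lpow j v x ^ (j + 1)\<close> and \<open>lpow (j + 1) v x ^ j\<close> both expand
  the same function, the power \<open>j * (j + 1)\<close> of \<open>f\<close> on the line, to every
  order. Hence they coincide, and \<open>fps_cusp_root\<close> applies.\<close>

lemma root_fps:
  assumes v: "norm v \<le> 1" and x: "norm x < R"
  shows "root_fps v x ^ j = lpow j v x" "root_fps v x ^ (j + 1) = lpow (j + 1) v x"
proof -
  obtain r where r: "norm x < r" "r < R" using dense x by blast
  let ?f = "\<lambda>t. f (x + t *\<^sub>R v)" and ?r = "min 1 (R - r)"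
  have approx: "\<exists>C'. \<forall>t. \<bar>t\<bar> < ?r \<longrightarrow> norm ((?f t ^ p) ^ q - fps_trunc n (lpow p v x ^ q) (of_real t)) \<le> C' * \<bar>t\<bar> ^ (n + 1)"
    if p: "p \<in> {j, j + 1}" for p q n
    by (rule fps_trunc_power_approx[where \<phi> = "\<lambda>t. ?f t ^ p"]) (use line_pow_taylor[OF p v r(1)] in auto)
  have "lpow j v x ^ (j + 1) = lpow (j + 1) v x ^ j"
  proof (rule fps_eq_if_trunc_close)
    fix n
    let ?T1 = "\<lambda>t. fps_trunc n (lpow j v x ^ (j + 1)) (of_real t)"
    let ?T2 = "\<lambda>t. fps_trunc n (lpow (j + 1) v x ^ j) (of_real t)"
    obtain C1 where C1: "\<And>t. \<bar>t\<bar> < ?r \<Longrightarrow> norm ((?f t ^ j) ^ (j + 1) - ?T1 t) \<le> C1 * \<bar>t\<bar> ^ (n + 1)"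
      using approx[of j "j + 1" n] by blast
    obtain C2 where C2: "\<And>t. \<bar>t\<bar> < ?r \<Longrightarrow> norm ((?f t ^ (j + 1)) ^ j - ?T2 t) \<le> C2 * \<bar>t\<bar> ^ (n + 1)"
      using approx[of "j + 1" j n] by blast
    have e: "(?f t ^ (j + 1)) ^ j = (?f t ^ j) ^ (j + 1)" for t
      by (simp only: power_mult[symmetric] mult.commute)
    have "norm (?T1 t - ?T2 t) \<le> (C1 + C2) * \<bar>t\<bar> ^ (n + 1)"
      if t: "\<bar>t\<bar> < ?r" for t
      using norm_diff_triangle_le[OF C1[OF t, unfolded norm_minus_commute[of "(?f t ^ j) ^ (j + 1)"]] C2[OF t, unfolded e]]
      by (simp add: distrib_right)
    moreover have "min 1 (R - r) > 0" using r by simp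
    ultimately show "\<exists>C \<delta>. \<delta> > 0 \<and> (\<forall>t. \<bar>t\<bar> < \<delta> \<longrightarrow> norm (?T1 t - ?T2 t) \<le> C * \<bar>t\<bar> ^ (n + 1))"
      by blast
  qed
  then obtain F where "F ^ j = lpow j v x" "F ^ (j + 1) = lpow (j + 1) v x" by (rule fps_cusp_root[OF j])
  then have "root_fps v x ^ j = lpow j v x \<and> root_fps v x ^ (j + 1) = lpow (j + 1) v x"
    unfolding root_fps_def by (intro someI[of "\<lambda>F. F ^ j = lpow j v x \<and> F ^ (j + 1) = lpow (j + 1) v x" F]) simp
  then show "root_fps v x ^ j = lpow j v x" "root_fps v x ^ (j + 1) = lpow (j + 1) v x" by auto
qed

lemma norm_root_le:
  fixes z :: complex
  assumes "norm (z ^ j) \<le> K"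
  shows "norm z \<le> K"
proof (rule ccontr)
  assume "\<not> norm z \<le> K"
  then have z: "norm z > K" by simp
  then have "norm z \<le> norm z ^ j" using self_le_power[of "norm z" j] K j by simp
  then show False using assms z by (simp add: norm_power)
qed

lemma norm_f_le: "y \<in> ball 0 R \<Longrightarrow> norm (f y) \<le> K"
  by (rule norm_root_le) (use gb[of y "[]"] weight_seq_basics(1)[OF M] in simp)

lemma line_pow_coeff_bound:
  assumes p: "p \<in> {j, j + 1}" and v: "norm v \<le> 1" and x: "norm x < R"
  shows "norm (fps_nth (lpow p v x) i) \<le> K * ((CARD('n) * \<sigma>) ^ i * (M i / fact i))"
proof -
  have "norm (dir_deriv v (\<lambda>x. f x ^ p) i x) \<le> CARD('n) ^ i * (K * (\<sigma> ^ i * M i))"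
    by (rule norm_dir_deriv_le[OF v]) (use gb[of x] hb[of x] p x in auto)
  then have "norm (dir_deriv v (\<lambda>x. f x ^ p) i x) / fact i \<le> CARD('n) ^ i * (K * (\<sigma> ^ i * M i)) / fact i"
    by (rule divide_right_mono) simp
  then show ?thesis by (simp add: line_fps_def norm_divide power_mult_distrib mult_ac)
qed

text \<open>For fixed \<open>k \<ge> 1\<close>, \<open>weight_root_bound\<close> puts the needed
  coefficients of the two known powers below a geometric sequence \<open>K * \<tau> ^ i\<close>,
  where \<open>\<tau>\<close> is a constant times the k-th root of \<open>M k / fact k\<close>. The
  bound for the root returns \<open>\<tau> ^ k\<close>, which is \<open>M k / fact k\<close> up to a
  geometric factor. One \<open>C\<close> serves all points, directions and orders.\<close>

lemma root_fps_coeff_bound: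
  obtains C where "C \<ge> 1" "\<And>v x k. norm v \<le> 1 \<Longrightarrow> norm x < R \<Longrightarrow>
     norm (fps_nth (root_fps v x) k) \<le> C ^ (k + 1) * (M k / fact k)"
proof -
  note W = weight_seq_basics[OF M]
  \<comment> \<open>Doubled, because \<open>cusp_order\<close> contains \<open>k + 1\<close>, which
    is at most \<open>2 * k\<close> for \<open>k \<ge> 1\<close>.\<close>
  define L where "L = 2 * (j * (4 * j + 1))"
  have L: "L \<ge> 1" using j by (simp add: L_def)
  obtain C1 where C1: "C1 \<ge> 1" "\<And>i k. 1 \<le> k \<Longrightarrow> i \<le> L * k \<Longrightarrow> M i / fact i \<le> C1 ^ i * (M k / fact k) powr (i / k)"
    using weight_root_bound[OF M I G L] by blast
  obtain B where B: "B \<ge> 1" "\<And>(F :: complex fps) k K \<tau>. K \<ge> 1 \<Longrightarrow> \<tau> > 0 \<Longrightarrow>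
      cusp_coeffs_le j k (\<lambda>i. K * \<tau> ^ i) F \<Longrightarrow>
      norm (fps_nth F k) \<le> K * \<tau> ^ k * B ^ (k + 1)"
    by (rule fps_cusp_coeff_bound[OF j]) (rule that; (assumption | blast))
  define a where "a = CARD('n) * \<sigma> * C1"
  have a: "a > 0" using \<sigma> C1 by (simp add: a_def)
  define C where "C = K * B * (a + 1)"
  have KB: "K * B \<ge> 1" by (rule mult_ge_one[OF K B(1)])
  have C: "C \<ge> 1" unfolding C_def using a by (intro mult_ge_one KB) simp
  have CK: "C \<ge> K" unfolding C_def mult.assoc using K B(1) a mult_left_mono[of 1 "B * (a + 1)" K] mult_ge_one[of B "a + 1"] by simp
  show ?thesis
  proof (rule that[OF C])
    fix v x :: "real^'n" and k assume v: "norm v \<le> 1" and x: "norm x < R"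
    note F = root_fps[OF v x]
    show "norm (fps_nth (root_fps v x) k) \<le> C ^ (k + 1) * (M k / fact k)"
    proof (cases "k = 0")
      \<comment> \<open>The choice of \<open>\<tau>\<close> needs \<open>k \<ge> 1\<close>; the
        constant term is bounded directly through its j-th power.\<close>
      case True
      have "fps_nth (root_fps v x) 0 ^ j = fps_nth (lpow j v x) 0" unfolding F(1)[symmetric] by (rule fps_power_zeroth[symmetric])
      then have "norm (fps_nth (root_fps v x) 0 ^ j) \<le> K"
        using line_pow_coeff_bound[OF _ v x, of j 0] W(1) by simp
      then have "norm (fps_nth (root_fps v x) 0) \<le> K" by (rule norm_root_le)
      then show ?thesis using True CK W(1) by simp
    next
      case False
      then have k: "k \<ge> 1" by simp
      define m where "m = M k / fact k"
      have m: "m > 0" using W(2) by (simp add: m_def)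
      define \<tau> where "\<tau> = a * m powr (1 / k)"
      have tau: "\<tau> > 0" using a m by (simp add: \<tau>_def)
      have bd: "norm (fps_nth (root_fps v x ^ p) i) \<le> K * \<tau> ^ i" if p: "p \<in> {j, j + 1}" and i: "i \<le> cusp_order j k" for p i
      proof -
        have "c * (k + 1) \<le> 2 * c * k" for c :: nat
          using mult_le_mono2[of "k + 1" "2 * k" c] k by (simp add: mult_ac)
        then have "cusp_order j k \<le> L * k" unfolding cusp_order_def L_def .
        then have iL: "i \<le> L * k" using i by simp
        have "norm (fps_nth (root_fps v x ^ p) i) = norm (fps_nth (lpow p v x) i)" using p F by auto
        also have "\<dots> \<le> K * ((CARD('n) * \<sigma>) ^ i * (M i / fact i))" by (rule line_pow_coeff_bound[OF p v x])
        also have "\<dots> \<le> K * ((CARD('n) * \<sigma>) ^ i * (C1 ^ i * m powr (i / k)))"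
          using K \<sigma> C1(2)[OF k iL] by (intro mult_left_mono) (auto simp: m_def)
        also have "\<dots> = K * \<tau> ^ i"
          using m k by (simp add: \<tau>_def a_def power_mult_distrib powr_root_power)
        finally show ?thesis .
      qed
      have "norm (fps_nth (root_fps v x) k) \<le> K * \<tau> ^ k * B ^ (k + 1)"
        by (rule B(2)[OF K tau]) (unfold cusp_coeffs_le_def, intro allI impI conjI bd; simp)
      also have "\<tau> ^ k = a ^ k * m" using m k by (simp add: \<tau>_def power_mult_distrib powr_root_power)
      also have "K * (a ^ k * m) * B ^ (k + 1) \<le> K ^ (k + 1) * ((a + 1) ^ (k + 1) * m) * B ^ (k + 1)"
      proof (intro mult_right_mono mult_mono)
        show "K \<le> K ^ (k + 1)" using self_le_power[of K "k + 1"] K by simp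
        have "a ^ k \<le> (a + 1) ^ k" using a by (intro power_mono) auto
        also have "\<dots> \<le> (a + 1) ^ (k + 1)" using a by (intro power_increasing) auto
        finally show "a ^ k \<le> (a + 1) ^ (k + 1)" .
      qed (use a m K B in auto)
      also have "\<dots> = C ^ (k + 1) * m" by (simp only: C_def power_mult_distrib mult_ac)
      finally show ?thesis by (simp add: m_def)
    qed
  qed
qed

text \<open>The coefficient bounds are uniform in \<open>x\<close> and \<open>v\<close>, so a single
  \<open>D\<close> from \<open>cusp_root_approx\<close> covers all lines through the smaller
  ball.\<close>

lemma root_fps_expansion:
  assumes r: "r < R"
  shows "\<exists>D. \<forall>x v t. norm x < r \<longrightarrow> norm v \<le> 1 \<longrightarrow> \<bar>t\<bar> < min 1 (R - r) \<longrightarrow>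
     norm (f (x + t *\<^sub>R v) - fps_trunc k (root_fps v x) (of_real t)) \<le> D * \<bar>t\<bar> ^ (k + 1)"
proof -
  obtain C where C: "C \<ge> 1" "\<And>v x k. norm v \<le> 1 \<Longrightarrow> norm x < R \<Longrightarrow>
     norm (fps_nth (root_fps v x) k) \<le> C ^ (k + 1) * (M k / fact k)"
    using root_fps_coeff_bound by blast
  define n where "n = (k + 1) * (j + 1) - 1"
  have n: "n + 1 = (k + 1) * (j + 1)" by (simp add: n_def)
  define b where "b = (\<Sum>i\<le>n. C ^ (i + 1) * (M i / fact i))"
  define c where "c = real (CARD('n) ^ (n + 1)) * (K * (\<sigma> ^ (n + 1) * M (n + 1)))"
  have pos: "M i > 0" for i using weight_seq_basics(2)[OF M] .
  have c0: "c \<ge> 0" using K \<sigma> pos[of "n + 1"] by (simp add: c_def)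
  have K0: "K \<ge> 0" using K by simp
  obtain D where D: "\<And>(F :: complex fps) w t. (\<And>i. i \<le> n \<Longrightarrow> norm (fps_nth F i) \<le> b) \<Longrightarrow> norm w \<le> K \<Longrightarrow> \<bar>t\<bar> \<le> 1 \<Longrightarrow>
     norm (w ^ j - fps_trunc n (F ^ j) (of_real t)) \<le> c * \<bar>t\<bar> ^ (n + 1) \<Longrightarrow>
     norm (w ^ (j + 1) - fps_trunc n (F ^ (j + 1)) (of_real t)) \<le> c * \<bar>t\<bar> ^ (n + 1) \<Longrightarrow>
     norm (w - fps_trunc k F (of_real t)) \<le> D * \<bar>t\<bar> ^ (k + 1)"
    by (rule cusp_root_approx[OF j n c0 K0, of b]) (rule that; (assumption | blast))
  have "norm (f (x + t *\<^sub>R v) - fps_trunc k (root_fps v x) (of_real t)) \<le> D * \<bar>t\<bar> ^ (k + 1)"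
    if x: "norm x < r" and v: "norm v \<le> 1" and t: "\<bar>t\<bar> < min 1 (R - r)" for x v t
  proof (rule D)
    have xR: "norm x < R" using x r by simp
    fix i assume i: "i \<le> n"
    have "norm (fps_nth (root_fps v x) i) \<le> C ^ (i + 1) * (M i / fact i)" by (rule C(2)[OF v xR])
    also have "\<dots> \<le> b" unfolding b_def
      by (rule member_le_sum[where f = "\<lambda>i. C ^ (i + 1) * (M i / fact i)"]) (use i C(1) pos in \<open>auto simp: less_imp_le\<close>)
    finally show "norm (fps_nth (root_fps v x) i) \<le> b" .
  next
    have xR: "norm x < R" using x r by simp
    have tR: "\<bar>t\<bar> < R - r" using t by simp
    have "norm (x + t *\<^sub>R v) \<le> norm x + \<bar>t\<bar> * norm v" by (rule order_trans[OF norm_triangle_ineq]) simp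
    also have "\<bar>t\<bar> * norm v \<le> \<bar>t\<bar> * 1" using v by (intro mult_left_mono) auto
    finally have "x + t *\<^sub>R v \<in> ball 0 R" using x tR by simp
    then show "norm (f (x + t *\<^sub>R v)) \<le> K" by (rule norm_f_le)
    show "norm (f (x + t *\<^sub>R v) ^ j - fps_trunc n (root_fps v x ^ j) (of_real t)) \<le> c * \<bar>t\<bar> ^ (n + 1)"
      unfolding root_fps(1)[OF v xR] c_def by (rule line_pow_taylor[OF _ v x tR]) simp
    show "norm (f (x + t *\<^sub>R v) ^ (j + 1) - fps_trunc n (root_fps v x ^ (j + 1)) (of_real t)) \<le> c * \<bar>t\<bar> ^ (n + 1)"
      unfolding root_fps(2)[OF v xR] c_def by (rule line_pow_taylor[OF _ v x tR]) simp
  qed (use t in auto)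
  then show ?thesis by blast
qed

lemma f_line_taylor: "line_taylor R f"
  unfolding line_taylor_def
proof (intro allI impI)
  fix r :: real and k :: nat assume r: "r < R"
  obtain D where "\<forall>x v t. norm x < r \<longrightarrow> norm v \<le> 1 \<longrightarrow> \<bar>t\<bar> < min 1 (R - r) \<longrightarrow>
     norm (f (x + t *\<^sub>R v) - fps_trunc k (root_fps v x) (of_real t)) \<le> D * \<bar>t\<bar> ^ (k + 1)"
    using root_fps_expansion[OF r] by blast
  then show "\<exists>C \<delta>. \<delta> > 0 \<and> (\<forall>x v. norm x < r \<longrightarrow> norm v \<le> 1 \<longrightarrow>
     (\<exists>a. \<forall>t. \<bar>t\<bar> < \<delta> \<longrightarrow> norm (f (x + t *\<^sub>R v) - (\<Sum>i\<le>k. a i * of_real t ^ i)) \<le> C * \<bar>t\<bar> ^ (k + 1)))"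
    unfolding fps_trunc_def using r by (intro exI[of _ D] exI[of _ "min 1 (R - r)"]) (simp, blast)
qed

text \<open>Polarization for a word of length \<open>k\<close> uses directions of norm up to
  \<open>k\<close>. Scaling them to norm at most one costs \<open>k ^ k\<close> in the coefficient
  of order \<open>k\<close>, which by \<open>k ^ k \<le> exp 1 ^ k * fact k\<close> is compensated
  by the denominator of \<open>M k / fact k\<close>.\<close>

lemma f_pdiffs_bound:
  obtains A \<rho> where "A \<ge> 0" "\<rho> > 0" "\<And>is x. x \<in> ball 0 R \<Longrightarrow> norm (pdiffs is f x) \<le> A * (\<rho> ^ length is * M (length is))"
proof -
  obtain C where C: "C \<ge> 1" "\<And>v x k. norm v \<le> 1 \<Longrightarrow> norm x < R \<Longrightarrow>
     norm (fps_nth (root_fps v x) k) \<le> C ^ (k + 1) * (M k / fact k)"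
    using root_fps_coeff_bound by blast
  have pos: "M i > 0" for i using weight_seq_basics(2)[OF M] .
  show ?thesis
  proof (rule that[of C "2 * C * exp 1"])
    fix "is" :: "'n list" and x :: "real^'n" assume x: "x \<in> ball 0 R"
    define k where "k = length is"
    \<comment> \<open>The maximum with one avoids a division by zero for the empty word;
      \<open>\<kappa> ^ k\<close> is still \<open>k ^ k\<close>.\<close>
    define \<kappa> where "\<kappa> = real (max 1 k)"
    have kap: "\<kappa> \<ge> 1" "\<kappa> \<ge> k" by (auto simp: \<kappa>_def)
    have kk: "\<kappa> ^ k = real k ^ k" by (cases "k = 0") (auto simp: \<kappa>_def max_def)
    have xR: "norm x < R" using x by simp
    obtain r where r: "norm x < r" "r < R" using dense xR by blast
    obtain D where D: "\<And>x v t. norm x < r \<Longrightarrow> norm v \<le> 1 \<Longrightarrow> \<bar>t\<bar> < min 1 (R - r) \<Longrightarrow>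
       norm (f (x + t *\<^sub>R v) - fps_trunc k (root_fps v x) (of_real t)) \<le> D * \<bar>t\<bar> ^ (k + 1)"
      using root_fps_expansion[OF r(2), of k] by blast
    define a where "a i w = fps_nth (root_fps ((1 / \<kappa>) *\<^sub>R w) x) i * of_real \<kappa> ^ i" for i w
    have w1: "norm ((1 / \<kappa>) *\<^sub>R w) \<le> 1" if "norm w \<le> k" for w :: "real^'n"
      using that kap by (simp add: divide_le_eq)
    have "norm (pdiffs is f x) \<le> 2 ^ k * (C ^ (k + 1) * (M k / fact k) * \<kappa> ^ k)"
    proof (rule norm_pdiffs_le_of_expansions[OF f_line_taylor x k_def])
      fix w :: "real^'n" assume w: "norm w \<le> k"
      show "norm (a k w) \<le> C ^ (k + 1) * (M k / fact k) * \<kappa> ^ k"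
        unfolding a_def norm_mult norm_power norm_of_real using kap
        by (intro mult_mono C(2)[OF w1[OF w] xR]) (use C(1) pos[of k] in \<open>auto simp: less_imp_le\<close>)
      fix t :: real assume t: "0 < t" "t < min 1 (R - r) / \<kappa>"
      have tk: "t * \<kappa> < min 1 (R - r)" using t kap by (simp add: pos_less_divide_eq)
      have e: "x + t *\<^sub>R w = x + (t * \<kappa>) *\<^sub>R ((1 / \<kappa>) *\<^sub>R w)" using kap by simp
      have s: "(\<Sum>i\<le>k. a i w * of_real t ^ i) = fps_trunc k (root_fps ((1 / \<kappa>) *\<^sub>R w) x) (of_real (t * \<kappa>))"
        unfolding fps_trunc_def a_def by (intro sum.cong refl) (simp only: of_real_mult power_mult_distrib mult_ac)
      have tk': "\<bar>t * \<kappa>\<bar> = t * \<kappa>" using t kap by (simp add: abs_mult)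
      have "\<bar>t * \<kappa>\<bar> < min 1 (R - r)" using tk unfolding tk' .
      from D[OF r(1) w1[OF w] this, folded e s, unfolded tk']
      have "norm (f (x + t *\<^sub>R w) - (\<Sum>i\<le>k. a i w * of_real t ^ i)) \<le> D * (t * \<kappa>) ^ (k + 1)"
        .
      then show "norm (f (x + t *\<^sub>R w) - (\<Sum>i\<le>k. a i w * of_real t ^ i)) \<le> (D * \<kappa> ^ (k + 1)) * t ^ (k + 1)"
        by (simp only: power_mult_distrib mult_ac)
    qed (use r kap in auto)
    also have "\<dots> = 2 ^ k * (C ^ (k + 1) * (M k / fact k)) * real k ^ k" unfolding kk by simp
    also have "\<dots> \<le> 2 ^ k * (C ^ (k + 1) * (M k / fact k)) * (exp 1 ^ k * fact k)"
      using C(1) pos[of k] by (intro mult_left_mono power_self_le_exp_fact) auto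
    also have "\<dots> = C * ((2 * C * exp 1) ^ k * M k)"
      by (simp add: power_mult_distrib)
    finally show "norm (pdiffs is f x) \<le> C * ((2 * C * exp 1) ^ length is * M (length is))" by (simp add: k_def)
  qed (use C in auto)
qed

end

section \<open>Passage to germs\<close>

lemma germ_E_M_ball:
  assumes M: "weight_seq M" and f: "germ_E_M M f"
  obtains R0 where "R0 > 0" "\<And>R. 0 < R \<Longrightarrow> R \<le> R0 \<Longrightarrow> smooth_on (ball 0 R) f \<and>
    (\<exists>K \<sigma>. \<sigma> > 0 \<and> (\<forall>is. \<forall>y\<in>ball 0 R. norm (pdiffs is f y) \<le> K * (\<sigma> ^ length is * M (length is))))"
proof -
  obtain U where U: "open U" "0 \<in> U" "f \<in> E_M M U" using f by (auto simp: germ_E_M_def)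
  obtain R0 where R0: "R0 > 0" "cball 0 R0 \<subseteq> U" using U open_contains_cball by blast
  show ?thesis
  proof (rule that[OF R0(1)])
    fix R assume R: "0 < R" "R \<le> R0"
    have sub: "closure (ball 0 R) \<subseteq> U" using R R0 by (auto simp: subset_iff)
    have "compact (closure (ball (0 :: real^'a) R))" using R by simp
    moreover have "ball 0 R \<subseteq> U" using sub closure_subset by blast
    ultimately obtain \<sigma> where s: "\<sigma> > 0" "f \<in> B_M M \<sigma> (ball 0 R)" using U(3) sub unfolding E_M_def by blast
    then obtain K where K: "\<And>y is. y \<in> ball 0 R \<Longrightarrow> norm (pdiffs is f y) / (\<sigma> ^ length is * M (length is)) \<le> K"
      unfolding B_M_def bdd_above_def by fastforce
    have "norm (pdiffs is f y) \<le> K * (\<sigma> ^ length is * M (length is))" if "y \<in> ball 0 R" for y "is"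
      using K[OF that, of "is"] s(1) weight_seq_basics(2)[OF M] by (simp add: pos_divide_le_eq)
    then show "smooth_on (ball 0 R) f \<and> (\<exists>K \<sigma>. \<sigma> > 0 \<and> (\<forall>is. \<forall>y\<in>ball 0 R. norm (pdiffs is f y) \<le> K * (\<sigma> ^ length is * M (length is))))"
      using s unfolding B_M_def by blast
  qed
qed

lemma smooth_on_subset: "smooth_on U f \<Longrightarrow> V \<subseteq> U \<Longrightarrow> smooth_on V f"
  unfolding smooth_on_def by (meson continuous_on_subset subsetD)

theorem theorem2p7:
  fixes M :: "nat \<Rightarrow> real"
  assumes "weight_seq M" and "quasianalytic M" and "intersectable M" and "moderate_growth M"
  shows "property_D (germ_E_M M :: (real^'n::finite \<Rightarrow> complex) \<Rightarrow> bool)"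
  unfolding property_D_def
proof (intro allI impI, elim conjE)
  fix f :: "real^'n \<Rightarrow> complex" and j :: nat
  assume j: "1 \<le> j" and g: "germ_E_M M (\<lambda>x. f x ^ j)" and h: "germ_E_M M (\<lambda>x. f x ^ (j + 1))"
  note M = assms(1)
  have pos: "M i > 0" for i using weight_seq_basics(2)[OF M] .
  obtain R1 where R1: "R1 > 0" "\<And>R. 0 < R \<Longrightarrow> R \<le> R1 \<Longrightarrow> smooth_on (ball 0 R) (\<lambda>x. f x ^ j) \<and>
    (\<exists>K \<sigma>. \<sigma> > 0 \<and> (\<forall>is. \<forall>y\<in>ball 0 R. norm (pdiffs is (\<lambda>x. f x ^ j) y) \<le> K * (\<sigma> ^ length is * M (length is))))"
    by (rule germ_E_M_ball[OF M g]) (rule that; (assumption | blast))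
  obtain R2 where R2: "R2 > 0" "\<And>R. 0 < R \<Longrightarrow> R \<le> R2 \<Longrightarrow> smooth_on (ball 0 R) (\<lambda>x. f x ^ (j + 1)) \<and>
    (\<exists>K \<sigma>. \<sigma> > 0 \<and> (\<forall>is. \<forall>y\<in>ball 0 R. norm (pdiffs is (\<lambda>x. f x ^ (j + 1)) y) \<le> K * (\<sigma> ^ length is * M (length is))))"
    by (rule germ_E_M_ball[OF M h]) (rule that; (assumption | blast))
  \<comment> \<open>The bounds for each power hold on all smaller balls, so a common radius can be
    taken.\<close>
  define R where "R = min R1 R2"
  have R: "R > 0" "R \<le> R1" "R \<le> R2" using R1 R2 by (auto simp: R_def)
  obtain K1 s1 where 1: "smooth_on (ball 0 R) (\<lambda>x. f x ^ j)" "s1 > 0"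
    "\<And>is y. y \<in> ball 0 R \<Longrightarrow> norm (pdiffs is (\<lambda>x. f x ^ j) y) \<le> K1 * (s1 ^ length is * M (length is))"
    using R1(2)[OF R(1,2)] by blast
  obtain K2 s2 where 2: "smooth_on (ball 0 R) (\<lambda>x. f x ^ (j + 1))" "s2 > 0"
    "\<And>is y. y \<in> ball 0 R \<Longrightarrow> norm (pdiffs is (\<lambda>x. f x ^ (j + 1)) y) \<le> K2 * (s2 ^ length is * M (length is))"
    using R2(2)[OF R(1,3)] by blast
  define K \<sigma> where "K = max 1 (max K1 K2)" and "\<sigma> = max s1 s2"
  have le: "K' * (s ^ i * M i) \<le> K * (\<sigma> ^ i * M i)" if "K' \<le> K" "0 < s" "s \<le> \<sigma>" for K' s i
    using that pos[of i] by (intro mult_mono power_mono) (auto simp: K_def less_imp_le)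
  have K: "K \<ge> 1" "\<sigma> > 0" using 1(2) by (auto simp: K_def \<sigma>_def)
  have gb: "norm (pdiffs is (\<lambda>x. f x ^ j) y) \<le> K * (\<sigma> ^ length is * M (length is))" if "y \<in> ball 0 R" for "is" y
    by (rule order_trans[OF 1(3)[OF that] le]) (use 1(2) in \<open>auto simp: K_def \<sigma>_def\<close>)
  have hb: "norm (pdiffs is (\<lambda>x. f x ^ (j + 1)) y) \<le> K * (\<sigma> ^ length is * M (length is))" if "y \<in> ball 0 R" for "is" y
    by (rule order_trans[OF 2(3)[OF that] le]) (use 2(2) in \<open>auto simp: K_def \<sigma>_def\<close>)
  note ctxt = M assms(3,4) j R(1) K 1(1) 2(1) gb hb
  have sm: "smooth_on (ball 0 R) f" by (rule line_taylor_smooth_on[OF f_line_taylor[OF ctxt]])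
  obtain A \<rho> where A: "A \<ge> 0" "\<rho> > 0" "\<And>is x. x \<in> ball 0 R \<Longrightarrow> norm (pdiffs is f x) \<le> A * (\<rho> ^ length is * M (length is))"
    by (rule f_pdiffs_bound[OF ctxt]) (assumption | (rule that; (assumption | blast)))+
  have "f \<in> B_M M \<rho> V" if V: "V \<subseteq> ball 0 R" for V
  proof -
    have "norm (pdiffs is f x) / (\<rho> ^ length is * M (length is)) \<le> A" if "x \<in> V" for x "is"
      using A(3)[of x "is"] V that A(2) pos[of "length is"] by (auto simp: pos_divide_le_eq)
    then show ?thesis using smooth_on_subset[OF sm V] unfolding B_M_def by (auto intro!: bdd_aboveI[of _ A])
  qed
  \<comment> \<open>The derivative bound is uniform on the whole ball, so the same
    \<open>\<rho>\<close> serves every relatively compact subset.\<close>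
  then have "f \<in> E_M M (ball 0 R)" using sm A(2) unfolding E_M_def by blast
  then show "germ_E_M M f" unfolding germ_E_M_def using R(1) by (intro exI[of _ "ball 0 R"]) auto
qed

end
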